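(* Let $X_{\mathrm{AH}}$ be a Banach space which has very few operators, has a shrinking Schauder basis, and whose dual space is isomorphic to $\ell_1$. Let $Y$ be a closed, infinite-dimensional subspace of $X_{\mathrm{AH}}$ such that: (i) $Y$ is the closed linear span of a subsequence of the Schauder basis for $X_{\mathrm{AH}}$; (ii) $Y$ has infinite codimension in $X_{\mathrm{AH}}$; (iii) $Y^*$ is isomorphic to $\ell_1$; (iv) every bounded operator from $Y$ into $X_{\mathrm{AH}}$ is the sum of a scalar multiple of the inclusion map $J\colon Y\to X_{\mathrm{AH}}$ and a compact operator. Let $Z=X_{\mathrm{AH}}\oplus Y$, and let $\mathscr{M}_1,\mathscr{M}_2\subseteq\mathscr{B}(Z)$ be as defined in the context. Then $\mathscr{M}_1$ and $\mathscr{M}_2$ are the only non-fixed, maximal left ideals of $\mathscr{B}(Z)$, and (i) $\mathscr{M}_1$ is generated as a left ideal by the two operators $$\begin{pmatrix} I_{X_{\mathrm{AH}}} & 0\\ 0 & 0\end{pmatrix}\qquad\text{and}\qquad\begin{pmatrix}0 & J\\ 0 & 0\end{pmatrix},$$ but $\mathscr{M}_1$ is not generated as a left ideal by a single bounded operator on $Z$; (ii) $\mathscr{M}_2$ is not finitely generated as a left ideal.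
   Context: The scalar field is $\mathbb{K}=\mathbb{R}$ or $\mathbb{C}$. A Banach space $E$ has very few operators if $E$ is infinite-dimensional and $\mathscr{B}(E)=\mathbb{K}I_E+\mathscr{K}(E)$, where $\mathscr{B}(E)$ is the algebra of bounded operators and $\mathscr{K}(E)$ the ideal of compact operators on $E$. $Z$ carries the norm $\|(x,y)\|=\max\{\|x\|,\|y\|\}$. Under the stated assumptions every $T\in\mathscr{B}(Z)$ has a unique representation as an operator-valued matrix $$T=\begin{pmatrix}\alpha_{1,1}I_{X_{\mathrm{AH}}}+K_{1,1} & \alpha_{1,2}J+K_{1,2}\\ K_{2,1} & \alpha_{2,2}I_Y+K_{2,2}\end{pmatrix}$$ with $\alpha_{1,1},\alpha_{1,2},\alpha_{2,2}\in\mathbb{K}$ and compact operators $K_{1,1}\colon X_{\mathrm{AH}}\to X_{\mathrm{AH}}$, $K_{1,2}\colon Y\to X_{\mathrm{AH}}$, $K_{2,1}\colon X_{\mathrm{AH}}\to Y$, $K_{2,2}\colon Y\to Y$. Define $\mathscr{M}_1=\{T\in\mathscr{B}(Z):\alpha_{2,2}=0\}$ and $\mathscr{M}_2=\{T\in\mathscr{B}(Z):\alpha_{1,1}=0\}$. For a Banach space $E$, a maximal left ideal of $\mathscr{B}(E)$ is fixed if it has the form $\{T\in\mathscr{B}(E):Tx=0\}$ for some non-zero $x\in E$, and non-fixed otherwise. A left ideal $\mathscr{L}$ of $\mathscr{B}(E)$ is generated as a left ideal by $R_1,\ldots,R_n$ if $\mathscr{L}=\{\sum_{j=1}^nS_jR_j:S_1,\ldots,S_n\in\mathscr{B}(E)\}$.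 *)

theory Defs
  imports "HOL-Analysis.Analysis" "HOL-Library.Function_Algebras"
begin

text \<open>The scalar field: up to an isometric isomorphism of fields, either the reals or the
  complex numbers.\<close>

class real_or_complex = real_normed_field +
  assumes real_or_complex:
    "\<exists>\<phi> :: 'a \<Rightarrow> complex. \<phi> 1 = 1 \<and> (\<forall>x y. \<phi> (x + y) = \<phi> x + \<phi> y)
        \<and> (\<forall>x y. \<phi> (x * y) = \<phi> x * \<phi> y) \<and> (\<forall>x. cmod (\<phi> x) = norm x)
        \<and> (range \<phi> = \<real> \<or> range \<phi> = UNIV)"

instance real :: real_or_complex
  by standard (rule exI[of _ complex_of_real], auto simp: Reals_def)

instance complex :: real_or_complex
  by standard (rule exI[of _ "\<lambda>z. z"], auto)

locale normed_scale = vector_space sc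
  for sc :: "'k::real_or_complex \<Rightarrow> 'a::real_normed_vector \<Rightarrow> 'a" +
  assumes norm_scale: "norm (sc c x) = norm c * norm x"
    and scale_of_real: "sc (of_real r) x = r *\<^sub>R x"

record ('k, 'a) nspace =
  carr :: "'a set"
  smult :: "'k \<Rightarrow> 'a \<Rightarrow> 'a"
  nrm :: "'a \<Rightarrow> real"

definition subsp :: "('k \<Rightarrow> 'a \<Rightarrow> 'a) \<Rightarrow> 'a set \<Rightarrow> ('k, 'a::real_normed_vector) nspace" where
  "subsp sc U = \<lparr>carr = U, smult = sc, nrm = norm\<rparr>"

definition scalars :: "('k, 'k::real_normed_field) nspace" where
  "scalars = \<lparr>carr = UNIV, smult = (*), nrm = norm\<rparr>"

definition sum_space :: "('k, 'a) nspace \<Rightarrow> ('k, 'b) nspace \<Rightarrow> ('k, 'a \<times> 'b) nspace"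
    (infixr "\<oplus>\<^sub>\<infinity>" 65) where
  "E \<oplus>\<^sub>\<infinity> F = \<lparr>carr = carr E \<times> carr F,
     smult = (\<lambda>c z. (smult E c (fst z), smult F c (snd z))),
     nrm = (\<lambda>z. max (nrm E (fst z)) (nrm F (snd z)))\<rparr>"

text \<open>Operators are total functions on the ambient type, normalised to vanish outside the
  carrier of their domain. Thus equality of operators is equality of functions, and sums and
  composites of operators are the pointwise sums and composites.\<close>

definition bop :: "('k, 'a::ab_group_add) nspace \<Rightarrow> ('k, 'b::ab_group_add) nspace \<Rightarrow> ('a \<Rightarrow> 'b) set" where
  "bop E F = {T. (\<forall>x\<in>carr E. T x \<in> carr F) \<and> (\<forall>x. x \<notin> carr E \<longrightarrow> T x = 0)
     \<and> (\<forall>x\<in>carr E. \<forall>y\<in>carr E. T (x + y) = T x + T y)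
     \<and> (\<forall>c. \<forall>x\<in>carr E. T (smult E c x) = smult F c (T x))
     \<and> (\<exists>C. \<forall>x\<in>carr E. nrm F (T x) \<le> C * nrm E x)}"

definition isomorphic :: "('k, 'a::ab_group_add) nspace \<Rightarrow> ('k, 'b::ab_group_add) nspace \<Rightarrow> bool" where
  "isomorphic E F \<longleftrightarrow> (\<exists>T\<in>bop E F. bij_betw T (carr E) (carr F)
     \<and> (\<exists>c>0. \<forall>x\<in>carr E. c * nrm E x \<le> nrm F (T x)))"

definition dual_space :: "('k::real_normed_field, 'a::ab_group_add) nspace \<Rightarrow> ('k, 'a \<Rightarrow> 'k) nspace" where
  "dual_space E = \<lparr>carr = bop E scalars,
     smult = (\<lambda>c f x. c * f x),
     nrm = (\<lambda>f. Sup {norm (f x) |x. x \<in> carr E \<and> nrm E x \<le> 1})\<rparr>"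

definition ell1 :: "('k::real_normed_field, nat \<Rightarrow> 'k) nspace" where
  "ell1 = \<lparr>carr = {a. summable (\<lambda>n. norm (a n))},
     smult = (\<lambda>c a n. c * a n),
     nrm = (\<lambda>a. \<Sum>n. norm (a n))\<rparr>"

text \<open>Compact operators between closed subspaces of an ambient space.\<close>

definition kop :: "('k \<Rightarrow> 'a::real_normed_vector \<Rightarrow> 'a) \<Rightarrow> 'a set \<Rightarrow> 'a set \<Rightarrow> ('a \<Rightarrow> 'a) set" where
  "kop sc U V = {T \<in> bop (subsp sc U) (subsp sc V).
     compact (closure (T ` {x \<in> U. norm x \<le> 1}))}"

text \<open>The inclusion of \<open>U\<close> into any larger subspace, in particular the identity operator of \<open>U\<close>.\<close>

definition incl :: "'a set \<Rightarrow> 'a \<Rightarrow> 'a::zero" where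
  "incl U x = (if x \<in> U then x else 0)"

definition infinite_dim :: "('k::field \<Rightarrow> 'a::ab_group_add \<Rightarrow> 'a) \<Rightarrow> 'a set \<Rightarrow> bool" where
  "infinite_dim sc U \<longleftrightarrow> \<not> (\<exists>B. finite B \<and> module.span sc B = U)"

definition infinite_codim :: "('k::field \<Rightarrow> 'a::ab_group_add \<Rightarrow> 'a) \<Rightarrow> 'a set \<Rightarrow> bool" where
  "infinite_codim sc U \<longleftrightarrow> \<not> (\<exists>B. finite B \<and> module.span sc (U \<union> B) = UNIV)"

definition very_few_operators :: "('k::field \<Rightarrow> 'a::real_normed_vector \<Rightarrow> 'a) \<Rightarrow> bool" where
  "very_few_operators sc \<longleftrightarrow> infinite_dim sc UNIV \<and>
     bop (subsp sc UNIV) (subsp sc UNIV) =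
       {\<lambda>x. sc c x + K x |c K. K \<in> kop sc UNIV UNIV}"

definition schauder_basis :: "('k \<Rightarrow> 'a::real_normed_vector \<Rightarrow> 'a) \<Rightarrow> (nat \<Rightarrow> 'a) \<Rightarrow> bool" where
  "schauder_basis sc b \<longleftrightarrow> (\<forall>x. \<exists>!c :: nat \<Rightarrow> 'k. (\<lambda>n. sc (c n) (b n)) sums x)"

definition closed_span :: "('k::field \<Rightarrow> 'a::real_normed_vector \<Rightarrow> 'a) \<Rightarrow> 'a set \<Rightarrow> 'a set" where
  "closed_span sc A = closure (module.span sc A)"

text \<open>A basis is shrinking if, for every functional, the norms of its restrictions to the closed
  spans of the tails of the basis tend to \<open>0\<close>.\<close>

definition shrinking :: "('k::real_normed_field \<Rightarrow> 'a::real_normed_vector \<Rightarrow> 'a) \<Rightarrow> (nat \<Rightarrow> 'a) \<Rightarrow> bool" where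
  "shrinking sc b \<longleftrightarrow> (\<forall>f\<in>bop (subsp sc UNIV) scalars.
     (\<lambda>n. Sup {norm (f x) |x. x \<in> closed_span sc (b ` {n..}) \<and> norm x \<le> 1}) \<longlonglongrightarrow> 0)"

definition left_ideal :: "('k, 'a::ab_group_add) nspace \<Rightarrow> ('a \<Rightarrow> 'a) set \<Rightarrow> bool" where
  "left_ideal E L \<longleftrightarrow> L \<subseteq> bop E E \<and> 0 \<in> L
     \<and> (\<forall>S\<in>L. \<forall>T\<in>L. S + T \<in> L) \<and> (\<forall>c. \<forall>T\<in>L. (\<lambda>x. smult E c (T x)) \<in> L)
     \<and> (\<forall>S\<in>bop E E. \<forall>T\<in>L. S \<circ> T \<in> L)"

definition maximal_left_ideal :: "('k, 'a::ab_group_add) nspace \<Rightarrow> ('a \<Rightarrow> 'a) set \<Rightarrow> bool" where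
  "maximal_left_ideal E L \<longleftrightarrow> left_ideal E L \<and> L \<noteq> bop E E
     \<and> (\<forall>N. left_ideal E N \<and> L \<subseteq> N \<longrightarrow> N = L \<or> N = bop E E)"

definition fixed_ideal :: "('k, 'a::ab_group_add) nspace \<Rightarrow> ('a \<Rightarrow> 'a) set \<Rightarrow> bool" where
  "fixed_ideal E L \<longleftrightarrow> (\<exists>x\<in>carr E. x \<noteq> 0 \<and> L = {T \<in> bop E E. T x = 0})"

definition left_generated :: "('k, 'a::ab_group_add) nspace \<Rightarrow> ('a \<Rightarrow> 'a) set \<Rightarrow> ('a \<Rightarrow> 'a) list \<Rightarrow> bool" where
  "left_generated E L Rs \<longleftrightarrow>
     L = {\<Sum>j<length Rs. S j \<circ> Rs ! j |S. \<forall>j<length Rs. S j \<in> bop E E}"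

definition spaceZ :: "('k \<Rightarrow> 'a \<Rightarrow> 'a) \<Rightarrow> 'a set \<Rightarrow> ('k, 'a \<times> 'a::real_normed_vector) nspace" where
  "spaceZ sc Y = subsp sc UNIV \<oplus>\<^sub>\<infinity> subsp sc Y"

text \<open>The operator on \<open>UNIV \<times> Y\<close> with rows \<open>(A, B)\<close> and \<open>(C, D)\<close>.\<close>

definition opmat :: "'a set \<Rightarrow> ('a \<Rightarrow> 'a) \<Rightarrow> ('a \<Rightarrow> 'a) \<Rightarrow> ('a \<Rightarrow> 'a) \<Rightarrow> ('a \<Rightarrow> 'a) \<Rightarrow> 'a \<times> 'a \<Rightarrow> 'a \<times> 'a::ab_group_add" where
  "opmat Y A B C D z = (if snd z \<in> Y
     then (A (fst z) + B (snd z), C (fst z) + D (snd z)) else 0)"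

definition matrix_rep :: "('k \<Rightarrow> 'a::real_normed_vector \<Rightarrow> 'a) \<Rightarrow> 'a set \<Rightarrow>
    ('a \<times> 'a \<Rightarrow> 'a \<times> 'a) \<Rightarrow> 'k \<Rightarrow> 'k \<Rightarrow> 'k \<Rightarrow> bool" where
  "matrix_rep sc Y T a11 a12 a22 \<longleftrightarrow>
     (\<exists>K11\<in>kop sc UNIV UNIV. \<exists>K12\<in>kop sc Y UNIV. \<exists>K21\<in>kop sc UNIV Y. \<exists>K22\<in>kop sc Y Y.
        T = opmat Y (\<lambda>x. sc a11 x + K11 x) (\<lambda>y. sc a12 (incl Y y) + K12 y)
                    K21                   (\<lambda>y. sc a22 (incl Y y) + K22 y))"

text \<open>In the setting of the theorem the scalars in \<open>matrix_rep\<close> exist and are unique for every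
  bounded operator, so the quantifiers below merely name them.\<close>

definition M1 :: "('k::zero \<Rightarrow> 'a::real_normed_vector \<Rightarrow> 'a) \<Rightarrow> 'a set \<Rightarrow> ('a \<times> 'a \<Rightarrow> 'a \<times> 'a) set" where
  "M1 sc Y = {T \<in> bop (spaceZ sc Y) (spaceZ sc Y).
     \<exists>a11 a12 a22. matrix_rep sc Y T a11 a12 a22 \<and> a22 = 0}"

definition M2 :: "('k::zero \<Rightarrow> 'a::real_normed_vector \<Rightarrow> 'a) \<Rightarrow> 'a set \<Rightarrow> ('a \<times> 'a \<Rightarrow> 'a \<times> 'a) set" where
  "M2 sc Y = {T \<in> bop (spaceZ sc Y) (spaceZ sc Y).
     \<exists>a11 a12 a22. matrix_rep sc Y T a11 a12 a22 \<and> a11 = 0}"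

end

theory Submission
  imports Defs
begin

text \<open>
  Write \<open>X\<close> for the ambient space and \<open>Z = X \<oplus> Y\<close>. Modulo compact operators, an operator on \<open>Z\<close> is an
  upper triangular \<open>2 \<times> 2\<close> matrix of scalars: an operator \<open>X \<rightarrow> Y\<close> is \<open>k I + K\<close> with \<open>K\<close> compact, and
  \<open>k \<noteq> 0\<close> would force \<open>Y\<close> to have finite codimension. Reading off the scalar matrix is multiplicative,
  so \<open>M1\<close> and \<open>M2\<close> are kernels of characters and hence maximal left ideals.

  Let \<open>L\<close> be a maximal left ideal that does not contain every compact operator. Then \<open>I = S + K\<close> with
  \<open>S \<in> L\<close> and \<open>K\<close> compact. The Schauder basis approximates \<open>K\<close> by finite-rank operators, so a Neumann
  series puts some \<open>I - F\<close> with \<open>F\<close> of finite rank into \<open>L\<close>. If no non-zero vector is annihilated by all of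
  \<open>L\<close>, the rank of \<open>F\<close> can be lowered until \<open>I \<in> L\<close>; so \<open>L\<close> is fixed. Otherwise \<open>L\<close> contains
  all compact operators, and an inspection of triangular matrices leaves only \<open>M1\<close> and \<open>M2\<close>.

  That \<open>M1\<close> has the two stated generators amounts to extending compact operators \<open>Y \<rightarrow> X\<close> and \<open>Y \<rightarrow> Y\<close>
  to \<open>X\<close>, which is possible because the duals of the target spaces are isomorphic to \<open>\<ell>\<^sub>1\<close>; the scalar
  matrices show that one generator does not suffice. If \<open>M2\<close> were generated by \<open>R\<^sub>1, \<dots>, R\<^sub>n\<close>, then
  every functional \<open>f\<close> on \<open>X\<close> would satisfy \<open>\<bar>f x\<bar> \<le> C (\<parallel>R\<^sub>1 x\<parallel> + \<dots> + \<parallel>R\<^sub>n x\<parallel>)\<close>, where the \<open>R\<^sub>i\<close> are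
  compact on \<open>X\<close>; a gliding hump argument excludes this.
\<close>

section \<open>The Hahn-Banach theorem\<close>

text \<open>The two ideals behave differently because of what happens on one summand. An element of
  \<open>M1\<close> acts on \<open>Y\<close> as a multiple of \<open>J\<close> plus a compact
  operator, so the second generator may carry \<open>y\<close> into \<open>X\<close> without loss,
  and all that is missing is an extension of the compact part to \<open>X\<close>. An element of
  \<open>M2\<close> is entirely compact on \<open>X\<close>, and left multiples of finitely many
  compact operators cannot recover every functional there. The extension must be exact, while
  finite-rank approximation produces it only up to an error. What saves the argument is that the
  norm of an approximate extension is a fixed multiple of the norm of the given operator: the error
  can be extended again, and the corrections form a convergent series. Compactness is handled as
  total boundedness of the seminorm \<open>norm (T x)\<close>, so that sums, composites and
  restrictions of compact operators reduce to comparing seminorms.\<close>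

definition sublinear :: "('a::real_vector \<Rightarrow> real) \<Rightarrow> bool" where
  "sublinear q \<longleftrightarrow> (\<forall>x y. q (x + y) \<le> q x + q y) \<and> (\<forall>r x. 0 \<le> r \<longrightarrow> q (r *\<^sub>R x) = r * q x)"

lemma sublinearI:
  assumes "\<And>x y. q (x + y) \<le> q x + q y" and "\<And>r x. 0 < r \<Longrightarrow> q (r *\<^sub>R x) \<le> r * q x" and "q 0 = 0"
  shows "sublinear q"
proof -
  have "q (r *\<^sub>R x) = r * q x" if "r > 0" for r x
  proof (rule antisym)
    show "q (r *\<^sub>R x) \<le> r * q x" by (rule assms(2)[OF that])
    \<comment> \<open>The assumed inequality, applied to \<open>inverse r\<close>, gives the reverse
      inequality.\<close>
    have "q (inverse r *\<^sub>R (r *\<^sub>R x)) \<le> inverse r * q (r *\<^sub>R x)"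
      using that by (intro assms(2)) simp
    then show "r * q x \<le> q (r *\<^sub>R x)" using that by (simp add: field_simps)
  qed
  then show ?thesis
    unfolding sublinear_def using assms by (auto simp: order.order_iff_strict)
qed

lemma sublinear_add: "sublinear q \<Longrightarrow> q (x + y) \<le> q x + q y"
  and sublinear_scale: "sublinear q \<Longrightarrow> 0 \<le> r \<Longrightarrow> q (r *\<^sub>R x) = r * q x"
  by (auto simp: sublinear_def)

lemma sublinear_zero: "sublinear q \<Longrightarrow> q 0 = 0"
  using sublinear_scale[of q 0 0] by simp

lemma sublinear_minus_le: "sublinear q \<Longrightarrow> - q (- x) \<le> q x"
  using sublinear_add[of q x "- x"] sublinear_zero[of q] by simp

text \<open>Infima of chains stay finite because a sublinear \<open>q\<close> below \<open>p\<close>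
  satisfies \<open>- p (- x) \<le> - q (- x) \<le> q x\<close>; comparability within the chain makes
  the infimum subadditive.\<close>

lemma minimal_sublinear_exists:
  assumes p: "sublinear p"
  obtains q where "sublinear q" "\<And>x. q x \<le> p x"
    "\<And>q'. sublinear q' \<Longrightarrow> (\<And>x. q' x \<le> q x) \<Longrightarrow> q' = q"
proof -
  define A where "A = {q. sublinear q \<and> (\<forall>x. q x \<le> p x)}"
  \<comment> \<open>The order is reversed: \<open>?P q q'\<close> puts \<open>q'\<close> below
    \<open>q\<close>, so that the maximal element supplied by Zorn's lemma is a minimal
    functional.\<close>
  let ?P = "\<lambda>q q'. \<forall>x. q' x \<le> (q x :: real)"
  have "\<exists>m\<in>A. \<forall>a\<in>A. ?P m a \<longrightarrow> a = m"
  proof (rule predicate_Zorn)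
    show "partial_order_on A (relation_of ?P A)"
      by (rule partial_order_on_relation_ofI) (auto intro: order_trans antisym intro!: ext)
  next
    fix C assume C: "C \<in> Chains (relation_of ?P A)"
    then have CA: "q \<in> A" if "q \<in> C" for q
      using that unfolding Chains_def relation_of_def by auto
    have lin: "?P q q' \<or> ?P q' q" if "q \<in> C" "q' \<in> C" for q q'
      using C that unfolding Chains_def relation_of_def by auto
    show "\<exists>u\<in>A. \<forall>a\<in>C. ?P a u"
    proof (cases "C = {}")
      case True
      then show ?thesis using p by (auto simp: A_def)
    next
      case False
      define u where "u x = (INF q\<in>C. q x)" for x
      have bdd: "bdd_below ((\<lambda>q. q x) ` C)" for x
      proof (rule bdd_belowI2[where m = "- p (- x)"])
        fix q assume "q \<in> C"
        then have "sublinear q" "q (- x) \<le> p (- x)" using CA by (auto simp: A_def)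
        then show "- p (- x) \<le> q x" using sublinear_minus_le[of q x] by linarith
      qed
      have ule: "u x \<le> q x" if "q \<in> C" for q x
        unfolding u_def by (rule cINF_lower[OF bdd that])
      have "sublinear u"
      proof (rule sublinearI)
        fix x y
        have *: "u (x + y) \<le> q1 x + q2 y" if C12: "q1 \<in> C" "q2 \<in> C" for q1 q2
        proof -
          obtain q where q: "q \<in> C" "q x \<le> q1 x" "q y \<le> q2 y"
            using lin[OF C12] C12 by auto
          have "u (x + y) \<le> q (x + y)" by (rule ule[OF q(1)])
          also have "\<dots> \<le> q x + q y"
            using CA[OF q(1)] by (auto simp: A_def sublinear_add)
          finally show ?thesis using q by linarith
        qed
        have "u (x + y) - q2 y \<le> u x" if "q2 \<in> C" for q2
          unfolding u_def[of x] using *[OF _ that] by (intro cINF_greatest[OF False]) (simp add: algebra_simps)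
        then have "u (x + y) - u x \<le> q2 y" if "q2 \<in> C" for q2 using that by force
        then have "u (x + y) - u x \<le> u y"
          unfolding u_def[of y] by (intro cINF_greatest[OF False])
        then show "u (x + y) \<le> u x + u y" by linarith
      next
        fix r :: real and x assume r: "r > 0"
        have "u (r *\<^sub>R x) / r \<le> u x"
          unfolding u_def[of x]
        proof (rule cINF_greatest[OF False])
          fix q assume q: "q \<in> C"
          have "u (r *\<^sub>R x) \<le> r * q x"
            using ule[OF q, of "r *\<^sub>R x"] CA[OF q] r by (simp add: A_def sublinear_scale)
          then show "u (r *\<^sub>R x) / r \<le> q x" using r by (simp add: field_simps)
        qed
        then show "u (r *\<^sub>R x) \<le> r * u x" using r by (simp add: field_simps)
      next
        have "(\<lambda>q. q 0) ` C = {0}" using False CA by (force simp: A_def sublinear_zero)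
        then show "u 0 = 0" by (simp add: u_def)
      qed
      moreover have "u x \<le> p x" for x
      proof -
        obtain q where "q \<in> C" using False by auto
        then show ?thesis using ule[of q x] CA[of q] by (auto simp: A_def intro: order_trans)
      qed
      ultimately have "u \<in> A" by (simp add: A_def)
      then show ?thesis using ule by blast
    qed
  qed
  then obtain m where m: "m \<in> A" "\<forall>a\<in>A. ?P m a \<longrightarrow> a = m" by blast
  show ?thesis
  proof (rule that[of m])
    fix q' assume "sublinear q'" "\<And>x. q' x \<le> m x"
    moreover from this have "q' \<in> A" using m(1) by (auto simp: A_def intro: order_trans)
    ultimately show "q' = m" using m(2) by blast
  qed (use m in \<open>auto simp: A_def\<close>)
qed

text \<open>Fix \<open>x\<close> and let \<open>w z\<close> be the infimum over
  \<open>t \<ge> 0\<close> of \<open>q (z + t x) - t q x\<close>. This is sublinear and lies below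
  \<open>q\<close>, so minimality gives \<open>w = q\<close>, and \<open>t = 1\<close> yields
  superadditivity.\<close>

lemma minimal_sublinear_linear:
  assumes q: "sublinear q" and min: "\<And>q'. sublinear q' \<Longrightarrow> (\<And>x. q' x \<le> q x) \<Longrightarrow> q' = q"
  shows "linear q"
proof -
  have sup: "q z + q x \<le> q (z + x)" for x z
  proof -
    define w where "w z = (INF t\<in>{0..}. q (z + t *\<^sub>R x) - t * q x)" for z
    have bdd: "bdd_below ((\<lambda>t. q (z + t *\<^sub>R x) - t * q x) ` {0..})" for z
    proof (rule bdd_belowI2[where m = "- q (- z)"])
      fix t :: real assume "t \<in> {0..}"
      then have "t * q x \<le> q (z + t *\<^sub>R x) + q (- z)"
        using sublinear_add[OF q, of "z + t *\<^sub>R x" "- z"] sublinear_scale[OF q, of t x] by simp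
      then show "- q (- z) \<le> q (z + t *\<^sub>R x) - t * q x" by linarith
    qed
    have wle: "w z \<le> q (z + t *\<^sub>R x) - t * q x" if "t \<ge> 0" for t z
      unfolding w_def using that by (intro cINF_lower[OF bdd]) simp
    have "sublinear w"
    proof (rule sublinearI)
      fix y z
      have *: "w (y + z) \<le> (q (y + s *\<^sub>R x) - s * q x) + (q (z + t *\<^sub>R x) - t * q x)"
        if "s \<ge> 0" "t \<ge> 0" for s t
      proof -
        have "w (y + z) \<le> q ((y + z) + (s + t) *\<^sub>R x) - (s + t) * q x" using that by (intro wle) simp
        also have "(y + z) + (s + t) *\<^sub>R x = (y + s *\<^sub>R x) + (z + t *\<^sub>R x)" by (simp add: algebra_simps)
        also have "q \<dots> \<le> q (y + s *\<^sub>R x) + q (z + t *\<^sub>R x)" by (rule sublinear_add[OF q])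
        finally show ?thesis by (simp add: algebra_simps)
      qed
      have "w (y + z) - (q (z + t *\<^sub>R x) - t * q x) \<le> w y" if "t \<ge> 0" for t
        unfolding w_def[of y] using *[OF _ that] by (intro cINF_greatest) (auto simp: algebra_simps)
      then have "w (y + z) - w y \<le> q (z + t *\<^sub>R x) - t * q x" if "t \<ge> 0" for t using that by force
      then have "w (y + z) - w y \<le> w z"
        unfolding w_def[of z] by (intro cINF_greatest) auto
      then show "w (y + z) \<le> w y + w z" by linarith
    next
      fix r :: real and z assume r: "r > 0"
      have "w (r *\<^sub>R z) / r \<le> w z"
        unfolding w_def[of z]
      proof (rule cINF_greatest)
        fix t :: real assume t: "t \<in> {0..}"
        have "w (r *\<^sub>R z) \<le> q (r *\<^sub>R z + (r * t) *\<^sub>R x) - (r * t) * q x" using r t by (intro wle) simp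
        also have "r *\<^sub>R z + (r * t) *\<^sub>R x = r *\<^sub>R (z + t *\<^sub>R x)" by (simp add: algebra_simps)
        also have "q \<dots> = r * q (z + t *\<^sub>R x)" using r by (intro sublinear_scale[OF q]) simp
        finally show "w (r *\<^sub>R z) / r \<le> q (z + t *\<^sub>R x) - t * q x" using r by (simp add: field_simps)
      qed simp
      then show "w (r *\<^sub>R z) \<le> r * w z" using r by (simp add: field_simps)
    next
      have "q (0 + t *\<^sub>R x) - t * q x = 0" if "t \<in> {0..}" for t
        using that by (simp add: sublinear_scale[OF q])
      then have "(\<lambda>t. q (0 + t *\<^sub>R x) - t * q x) ` {0..} = {0}" by force
      then show "w 0 = 0" unfolding w_def by simp
    qed
    moreover have "w z \<le> q z" for z using wle[of 0 z] by simp
    ultimately have "w = q" by (rule min)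
    then show ?thesis using wle[of 1 z] by simp
  qed
  have add: "q (x + y) = q x + q y" for x y
    using sup[of x y] sublinear_add[OF q, of x y] by simp
  have neg: "q (- x) = - q x" for x
    using add[of x "- x"] sublinear_zero[OF q] by simp
  show ?thesis
  proof (rule linearI)
    fix r :: real and x
    show "q (r *\<^sub>R x) = r *\<^sub>R q x"
      using sublinear_scale[OF q, of r x] sublinear_scale[OF q, of "- r" x] neg[of "r *\<^sub>R x"]
      by (cases "r \<ge> 0") auto
  qed (rule add)
qed

text \<open>The infimal convolution \<open>w\<close> of \<open>p\<close> and \<open>f\<close> is
  sublinear, lies below \<open>p\<close>, and on \<open>Y\<close> lies below \<open>f\<close>. A
  minimal sublinear functional below \<open>w\<close> is linear; on \<open>Y\<close> it is at most
  \<open>f\<close> at both \<open>y\<close> and \<open>- y\<close>, hence equal to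
  \<open>f\<close>.\<close>

theorem Hahn_Banach_sublinear:
  assumes p: "sublinear p" and Y: "subspace Y"
    and add: "\<And>x y. x \<in> Y \<Longrightarrow> y \<in> Y \<Longrightarrow> f (x + y) = f x + f y"
    and scale: "\<And>r x. x \<in> Y \<Longrightarrow> f (r *\<^sub>R x) = r * f x"
    and le: "\<And>x. x \<in> Y \<Longrightarrow> f x \<le> p x"
  obtains g where "linear g" "\<And>x. x \<in> Y \<Longrightarrow> g x = f x" "\<And>x. g x \<le> p x"
proof -
  define w where "w z = (INF y\<in>Y. p (z - y) + f y)" for z
  have Y0: "Y \<noteq> {}" "0 \<in> Y" using Y subspace_0 by auto
  have f0: "f 0 = 0" using scale[of 0 0] Y0 by simp
  have fneg: "f (- y) = - f y" if "y \<in> Y" for y using scale[of y "-1"] that by simp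
  have low: "- p (- z) \<le> p (z - y) + f y" if "y \<in> Y" for y z
  proof -
    have "- f y \<le> p (- y)" using le[of "- y"] fneg that Y by (simp add: subspace_neg)
    also have "\<dots> \<le> p (z - y) + p (- z)" using sublinear_add[OF p, of "z - y" "- z"] by simp
    finally show ?thesis by linarith
  qed
  have bdd: "bdd_below ((\<lambda>y. p (z - y) + f y) ` Y)" for z
    by (rule bdd_belowI2[OF low])
  have wle: "w z \<le> p (z - y) + f y" if "y \<in> Y" for y z
    unfolding w_def by (rule cINF_lower[OF bdd that])
  have "sublinear w"
  proof (rule sublinearI)
    fix x z
    have *: "w (x + z) \<le> (p (x - y) + f y) + (p (z - y') + f y')" if "y \<in> Y" "y' \<in> Y" for y y'
    proof -
      have "w (x + z) \<le> p ((x + z) - (y + y')) + f (y + y')"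
        using that by (intro wle) (simp add: subspace_add[OF Y])
      also have "(x + z) - (y + y') = (x - y) + (z - y')" by simp
      also have "p \<dots> \<le> p (x - y) + p (z - y')" by (rule sublinear_add[OF p])
      finally show ?thesis using add[OF that] by simp
    qed
    have "w (x + z) - (p (z - y') + f y') \<le> w x" if "y' \<in> Y" for y'
      unfolding w_def[of x] using *[OF _ that] by (intro cINF_greatest[OF Y0(1)]) (simp add: algebra_simps)
    then have "w (x + z) - w x \<le> p (z - y') + f y'" if "y' \<in> Y" for y' using that by force
    then have "w (x + z) - w x \<le> w z"
      unfolding w_def[of z] by (intro cINF_greatest[OF Y0(1)])
    then show "w (x + z) \<le> w x + w z" by linarith
  next
    fix r :: real and z assume r: "r > 0"
    have "w (r *\<^sub>R z) / r \<le> w z"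
      unfolding w_def[of z]
    proof (rule cINF_greatest[OF Y0(1)])
      fix y assume y: "y \<in> Y"
      have "w (r *\<^sub>R z) \<le> p (r *\<^sub>R z - r *\<^sub>R y) + f (r *\<^sub>R y)"
        using y by (intro wle) (simp add: subspace_scale[OF Y])
      also have "r *\<^sub>R z - r *\<^sub>R y = r *\<^sub>R (z - y)" by (simp add: algebra_simps)
      finally show "w (r *\<^sub>R z) / r \<le> p (z - y) + f y"
        using r y sublinear_scale[OF p, of r "z - y"] scale[OF y, of r]
        by (simp add: pos_divide_le_eq distrib_left mult.commute)
    qed
    then show "w (r *\<^sub>R z) \<le> r * w z" using r by (simp add: field_simps)
  next
    have "w 0 \<le> 0" using wle[OF Y0(2), of 0] sublinear_zero[OF p] f0 by simp
    moreover have "0 \<le> w 0"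
      unfolding w_def using low[of _ 0] sublinear_zero[OF p] by (intro cINF_greatest[OF Y0(1)]) simp
    ultimately show "w 0 = 0" by simp
  qed
  then obtain g where g: "sublinear g" "\<And>x. g x \<le> w x"
    and min: "\<And>q'. sublinear q' \<Longrightarrow> (\<And>x. q' x \<le> g x) \<Longrightarrow> q' = g"
    by (rule minimal_sublinear_exists) blast
  have lin: "linear g" by (rule minimal_sublinear_linear[OF g(1) min])
  have gp: "g x \<le> p x" for x
    using g(2)[of x] wle[OF Y0(2), of x] f0 by simp
  have gf: "g y \<le> f y" if "y \<in> Y" for y
    using g(2)[of y] wle[OF that, of y] sublinear_zero[OF p] by simp
  have "g y = f y" if "y \<in> Y" for y
    using gf[OF that] gf[of "- y"] that fneg[OF that] linear_neg[OF lin, of y] subspace_neg[OF Y that]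
    by simp
  with lin gp show ?thesis using that by blast
qed

section \<open>The scalar field: real parts, compact balls, completeness\<close>

lemma scalar_field_embedding:
  obtains \<phi> :: "'k::real_or_complex \<Rightarrow> complex" where
    "\<And>x y. \<phi> (x + y) = \<phi> x + \<phi> y" "\<And>x y. \<phi> (x * y) = \<phi> x * \<phi> y"
    "\<And>x. cmod (\<phi> x) = norm x" "range \<phi> = \<real> \<or> range \<phi> = UNIV"
    "\<And>r. \<phi> (of_real r) = of_real r"
proof -
  obtain \<phi> :: "'k \<Rightarrow> complex" where \<phi>: "\<phi> 1 = 1" "\<And>x y. \<phi> (x + y) = \<phi> x + \<phi> y"
    "\<And>x y. \<phi> (x * y) = \<phi> x * \<phi> y" "\<And>x. cmod (\<phi> x) = norm x"
    "range \<phi> = \<real> \<or> range \<phi> = UNIV"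
    using real_or_complex[where 'a = 'k] by blast
  \<comment> \<open>A point of the plane at the distances of a real \<open>r\<close> from \<open>0\<close> and \<open>1\<close> equals \<open>r\<close>.\<close>
  have "\<phi> (of_real r) = of_real r" for r
  proof -
    have diff: "\<phi> (x - y) = \<phi> x - \<phi> y" for x y using \<phi>(2)[of "x - y" y] by simp
    have 1: "cmod (\<phi> (of_real r)) ^ 2 = r ^ 2" by (simp add: \<phi>(4))
    have "cmod (\<phi> (of_real r) - 1) = \<bar>r - 1\<bar>"
      using \<phi>(4)[of "of_real r - 1"] by (metis diff \<phi>(1) norm_of_real of_real_1 of_real_diff)
    then have 2: "cmod (\<phi> (of_real r) - 1) ^ 2 = (r - 1) ^ 2" by simp
    have "Re (\<phi> (of_real r)) = r"
      using 1 2 unfolding cmod_power2 by (simp add: power2_eq_square algebra_simps)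
    moreover have "Im (\<phi> (of_real r)) = 0" using 1 calculation by (simp add: cmod_power2)
    ultimately show ?thesis by (simp add: complex_eq_iff)
  qed
  with \<phi> show ?thesis using that by blast
qed

text \<open>Here \<open>j\<close> is an imaginary unit for complex scalars and \<open>0\<close> for real ones, which lets the
  complexification formula below cover both cases.\<close>

lemma scalar_real_part:
  obtains re :: "'k::real_or_complex \<Rightarrow> real" and j :: 'k where
    "\<And>x y. re (x + y) = re x + re y" "\<And>r x. re (of_real r * x) = r * re x"
    "\<And>x. \<bar>re x\<bar> \<le> norm x" "norm j \<le> 1" "j = 0 \<or> j * j = -1"
    "\<And>c. c = of_real (re c) - j * of_real (re (j * c))"
proof -
  obtain \<phi> :: "'k \<Rightarrow> complex" where \<phi>: "\<And>x y. \<phi> (x + y) = \<phi> x + \<phi> y"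
    "\<And>x y. \<phi> (x * y) = \<phi> x * \<phi> y" "\<And>x. cmod (\<phi> x) = norm x"
    "range \<phi> = \<real> \<or> range \<phi> = UNIV" "\<And>r. \<phi> (of_real r) = of_real r"
    by (rule scalar_field_embedding) blast
  have diff: "\<phi> (x - y) = \<phi> x - \<phi> y" for x y using \<phi>(1)[of "x - y" y] by simp
  have inj: "x = y" if "\<phi> x = \<phi> y" for x y
    using \<phi>(3)[of "x - y"] that by (simp add: diff)
  have \<phi>0: "\<phi> 0 = 0" using \<phi>(5)[of 0] by simp
  have \<phi>m1: "\<phi> (-1) = -1" using \<phi>(5)[of "-1"] by simp
  define re where "re x = Re (\<phi> x)" for x
  have re: "\<And>x y. re (x + y) = re x + re y" "\<And>r x. re (of_real r * x) = r * re x"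
    "\<And>x. \<bar>re x\<bar> \<le> norm x"
    by (auto simp: re_def \<phi> simp flip: \<phi>(3) intro: abs_Re_le_cmod)
  from \<phi>(4) show ?thesis
  proof
    assume R: "range \<phi> = \<real>"
    have "c = of_real (re c)" for c
    proof (rule inj)
      have "\<phi> c \<in> \<real>" using R by blast
      then show "\<phi> c = \<phi> (of_real (re c))" by (simp add: \<phi>(5) re_def complex_is_Real_iff complex_eq_iff)
    qed
    then show ?thesis using that[of re 0] re by simp
  next
    assume C: "range \<phi> = UNIV"
    then obtain j where j: "\<phi> j = \<i>" by (metis UNIV_I imageE)
    have "j * j = -1" by (rule inj) (simp add: \<phi> j \<phi>m1)
    moreover have "norm j \<le> 1" using \<phi>(3)[of j] j by simp
    moreover have "c = of_real (re c) - j * of_real (re (j * c))" for c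
      by (rule inj) (simp add: diff \<phi> j re_def complex_eq_iff)
    ultimately show ?thesis using that[of re j] re by simp
  qed
qed

text \<open>The embedding into the complex numbers is isometric with closed range, so the ball is
  the image of a compact set under its inverse. Completeness of the scalars and compactness of
  finite-rank operators rest on this.\<close>

lemma compact_cball_scalars: "compact (cball 0 r :: 'k::real_or_complex set)"
proof -
  obtain \<phi> :: "'k \<Rightarrow> complex" where \<phi>: "\<And>x y. \<phi> (x + y) = \<phi> x + \<phi> y"
    "\<And>x. cmod (\<phi> x) = norm x" "range \<phi> = \<real> \<or> range \<phi> = UNIV"
    by (rule scalar_field_embedding) blast
  have diff: "\<phi> (x - y) = \<phi> x - \<phi> y" for x y using \<phi>(1)[of "x - y" y] by simp
  have inj: "inj \<phi>" using \<phi>(2) diff by (metis eq_iff_diff_eq_0 injI norm_eq_zero)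
  define \<psi> where "\<psi> = inv \<phi>"
  have \<psi>: "\<phi> (\<psi> z) = z" if "z \<in> range \<phi>" for z using that by (simp add: \<psi>_def f_inv_into_f)
  have \<psi>\<phi>: "\<psi> (\<phi> x) = x" for x using inj by (simp add: \<psi>_def)
  have "closed (range \<phi>)" using \<phi>(3) closed_complex_Reals by auto
  then have "compact (cball 0 r \<inter> range \<phi>)" by (intro compact_Int_closed) auto
  moreover have "continuous_on (cball 0 r \<inter> range \<phi>) \<psi>"
  proof (rule continuous_on_iff[THEN iffD2], intro ballI allI impI)
    fix z and e :: real assume z: "z \<in> cball 0 r \<inter> range \<phi>" "e > 0"
    have "dist (\<psi> w) (\<psi> z) = dist w z" if "w \<in> range \<phi>" for w
      using \<phi>(2)[of "\<psi> w - \<psi> z"] that z by (simp add: dist_norm diff \<psi>)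
    then show "\<exists>d>0. \<forall>w\<in>cball 0 r \<inter> range \<phi>. dist w z < d \<longrightarrow> dist (\<psi> w) (\<psi> z) < e"
      using z by auto
  qed
  ultimately have "compact (\<psi> ` (cball 0 r \<inter> range \<phi>))" by (rule compact_continuous_image[rotated])
  also have "\<psi> ` (cball 0 r \<inter> range \<phi>) = cball 0 r"
  proof
    show "\<psi> ` (cball 0 r \<inter> range \<phi>) \<subseteq> cball 0 r" by (auto simp: \<psi>\<phi> \<phi>(2))
    show "cball 0 r \<subseteq> \<psi> ` (cball 0 r \<inter> range \<phi>)"
    proof
      fix x :: 'k assume "x \<in> cball 0 r"
      then have "\<phi> x \<in> cball 0 r \<inter> range \<phi>" by (simp add: \<phi>(2))
      then show "x \<in> \<psi> ` (cball 0 r \<inter> range \<phi>)" using \<psi>\<phi>[of x] by (metis imageI)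
    qed
  qed
  finally show ?thesis .
qed

lemma Cauchy_convergent_scalars:
  fixes X :: "nat \<Rightarrow> 'k::real_or_complex"
  assumes "Cauchy X" shows "convergent X"
proof -
  obtain r where r: "\<And>n. norm (X n) \<le> r"
    using cauchy_imp_bounded[OF assms] by (auto simp: bounded_iff)
  have "complete (cball 0 r :: 'k set)" by (rule compact_imp_complete[OF compact_cball_scalars])
  then show ?thesis using assms r by (auto simp: complete_def convergent_def)
qed

section \<open>Hahn-Banach extension over the scalar field\<close>

context normed_scale
begin

lemma scaleR_sc: "r *\<^sub>R sc c x = sc (r *\<^sub>R c) x"
  by (simp add: scaleR_conv_of_real flip: scale_of_real)

lemma bounded_bilinear_sc: "bounded_bilinear sc"
proof
  show "sc (r *\<^sub>R a) b = r *\<^sub>R sc a b" for r a b by (simp add: scaleR_sc)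
  show "sc a (r *\<^sub>R b) = r *\<^sub>R sc a b" for r a b
    by (simp add: mult.commute flip: scale_of_real)
  show "\<exists>K. \<forall>a b. norm (sc a b) \<le> norm a * norm b * K"
    by (rule exI[of _ 1]) (simp add: norm_scale)
qed (simp_all add: scale_left_distrib scale_right_distrib)

lemma tendsto_sc: "(f \<longlongrightarrow> a) F \<Longrightarrow> (g \<longlongrightarrow> b) F \<Longrightarrow> ((\<lambda>x. sc (f x) (g x)) \<longlongrightarrow> sc a b) F"
  by (rule bounded_bilinear.tendsto[OF bounded_bilinear_sc])

lemma real_subspace: "subspace U \<Longrightarrow> real_vector.subspace U"
  by (metis real_vector.subspace_def scale_of_real subspace_def)

lemma subspace_scaleR: "subspace U \<Longrightarrow> x \<in> U \<Longrightarrow> r *\<^sub>R x \<in> U"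
  by (metis scale_of_real subspace_scale)

text \<open>The real theorem extends the real part of \<open>f\<close>, and the full functional is
  recovered from its real part by the identity \<open>rej\<close>. The triangle inequality in that
  identity is the origin of the factor 2, which enters the later constants.\<close>

theorem Hahn_Banach:
  assumes Y: "subspace Y"
    and add: "\<And>x y. x \<in> Y \<Longrightarrow> y \<in> Y \<Longrightarrow> f (x + y) = f x + f y"
    and scale: "\<And>c x. x \<in> Y \<Longrightarrow> f (sc c x) = c * f x"
    and le: "\<And>x. x \<in> Y \<Longrightarrow> norm (f x) \<le> M * norm x" and M: "M \<ge> 0"
  obtains g where "\<And>x y. g (x + y) = g x + g y" "\<And>c x. g (sc c x) = c * g x"
    "\<And>x. norm (g x) \<le> 2 * M * norm x" "\<And>x. x \<in> Y \<Longrightarrow> g x = f x"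
proof -
  obtain re :: "'k \<Rightarrow> real" and j :: 'k where
    re: "\<And>x y. re (x + y) = re x + re y" "\<And>r x. re (of_real r * x) = r * re x"
    "\<And>x. \<bar>re x\<bar> \<le> norm x" and j: "norm j \<le> 1" "j = 0 \<or> j * j = -1"
    and rej: "\<And>c. c = of_real (re c) - j * of_real (re (j * c))"
    by (rule scalar_real_part) blast
  have sub: "sublinear (\<lambda>x :: 'a. M * norm x)"
    unfolding sublinear_def
  proof (intro conjI allI impI)
    show "M * norm (x + y) \<le> M * norm x + M * norm y" for x y :: 'a
      using mult_left_mono[OF norm_triangle_ineq[of x y] M] by (simp add: distrib_left)
  qed simp
  have res: "re (f (r *\<^sub>R x)) = r * re (f x)" if "x \<in> Y" for r x
    using that scale[of x "of_real r"] by (simp add: scale_of_real re(2))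
  have rele: "re (f x) \<le> M * norm x" if "x \<in> Y" for x
    using re(3)[of "f x"] le[OF that] by linarith
  obtain u where u: "linear u" "\<And>x. x \<in> Y \<Longrightarrow> u x = re (f x)" "\<And>x. u x \<le> M * norm x"
    by (rule Hahn_Banach_sublinear[OF sub real_subspace[OF Y], of "\<lambda>x. re (f x)"])
      ((simp add: re(1) add res rele; fail) | blast)+
  have uabs: "\<bar>u x\<bar> \<le> M * norm x" for x
    using u(3)[of x] u(3)[of "- x"] linear_neg[OF u(1), of x] by simp
  have uadd: "u (x + y) = u x + u y" for x y by (rule linear_add[OF u(1)])
  have uscale: "u (sc (of_real r) x) = r * u x" for r x
    using linear_scale[OF u(1), of r x] by (simp add: scale_of_real)
  define g where "g x = of_real (u x) - j * of_real (u (sc j x))" for x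
  have gadd: "g (x + y) = g x + g y" for x y
    by (simp add: g_def uadd scale_right_distrib algebra_simps)
  have greal: "g (sc (of_real r) x) = of_real r * g x" for r x
    unfolding g_def scale_left_commute[of j] uscale by (simp add: algebra_simps)
  have gj: "g (sc j x) = j * g x" for x
  proof (cases "j = 0")
    case True
    then show ?thesis using uscale[of 0 x] by (simp add: g_def)
  next
    case False
    then have jj: "j * j = -1" using j by blast
    have "u (sc j (sc j x)) = - u x" using jj linear_neg[OF u(1), of x] by simp
    then show ?thesis by (simp add: g_def algebra_simps jj flip: mult.assoc)
  qed
  have gscale: "g (sc c x) = c * g x" for c x
  proof -
    \<comment> \<open>Every scalar is \<open>a + b j\<close> with real \<open>a\<close> and
      \<open>b\<close>, so homogeneity follows from additivity, real homogeneity and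
      \<open>gj\<close>.\<close>
    define a b where "a = re c" and "b = - re (j * c)"
    have c: "c = of_real a + of_real b * j" using rej[of c] by (simp add: a_def b_def mult.commute)
    have "sc c x = sc (of_real a) x + sc (of_real b) (sc j x)" by (simp add: c scale_left_distrib)
    then have "g (sc c x) = of_real a * g x + of_real b * (j * g x)" by (simp only: gadd greal gj)
    then show ?thesis by (simp only: c distrib_right mult.assoc)
  qed
  show ?thesis
  proof (rule that[of g])
    show "norm (g x) \<le> 2 * M * norm x" for x
    proof -
      have "norm (g x) \<le> \<bar>u x\<bar> + norm j * \<bar>u (sc j x)\<bar>"
        unfolding g_def by (metis norm_mult norm_of_real norm_triangle_ineq4)
      also have "norm j * \<bar>u (sc j x)\<bar> \<le> 1 * (M * (1 * norm x))"
        using j(1) uabs[of "sc j x"] M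
        by (intro mult_mono order_trans[OF uabs] mult_left_mono) (auto simp: norm_scale mult_right_mono mult_left_le_one_le)
      finally show ?thesis using uabs[of x] by simp
    qed
    show "g x = f x" if "x \<in> Y" for x
      using that u(2)[of x] u(2)[of "sc j x"] scale[of x j] rej[of "f x"] subspace_scale[OF Y]
      by (simp add: g_def)
  qed (auto simp: gadd gscale)
qed

lemma norming_functional:
  assumes "x \<noteq> 0"
  obtains g where "\<And>x y. g (x + y) = g x + g y" "\<And>c x. g (sc c x) = c * g x"
    "\<And>x. norm (g x) \<le> 2 * norm x" "g x = of_real (norm x)"
proof -
  \<comment> \<open>\<open>co v\<close> is the coordinate of \<open>v\<close> on the line through
    \<open>x\<close>, unique because \<open>x\<close> is non-zero; the functional to be extended is
    \<open>co v * norm x\<close>.\<close>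
  define co where "co v = (SOME c. v = sc c x)" for v
  have co: "co (sc c x) = c" for c
    unfolding co_def using assms by (auto intro!: some_equality)
  have Y: "subspace (range (\<lambda>c. sc c x))"
    by (metis span_singleton subspace_span)
  obtain g where "\<And>x y. g (x + y) = g x + g y" "\<And>c x. g (sc c x) = c * g x"
    "\<And>x. norm (g x) \<le> 2 * 1 * norm x"
    and g: "\<And>v. v \<in> range (\<lambda>c. sc c x) \<Longrightarrow> g v = co v * of_real (norm x)"
  proof (rule Hahn_Banach[OF Y, of "\<lambda>v. co v * of_real (norm x)" 1])
    fix v w assume v: "v \<in> range (\<lambda>c. sc c x)"
    then show "norm (co v * of_real (norm x)) \<le> 1 * norm v"
      by (auto simp: co norm_scale norm_mult)
    show "co (sc c v) * of_real (norm x) = c * (co v * of_real (norm x))" for c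
      using v by (auto simp: co)
    assume "w \<in> range (\<lambda>c. sc c x)"
    then show "co (v + w) * of_real (norm x) = co v * of_real (norm x) + co w * of_real (norm x)"
      using v by (auto simp: co algebra_simps simp flip: scale_left_distrib)
  qed auto
  moreover have "g x = of_real (norm x)" using g[of "sc 1 x"] co[of 1] by (metis mult_1 rangeI scale_one)
  ultimately show ?thesis by (intro that[of g]) simp_all
qed

end

section \<open>Bounded and compact operators between subspaces\<close>

lemma scalars_eq_subsp: "scalars = subsp (*) UNIV"
  by (simp add: scalars_def subsp_def)

lemma normed_scale_mult: "normed_scale ((*) :: 'k::real_or_complex \<Rightarrow> 'k \<Rightarrow> 'k)"
  by standard (auto simp: algebra_simps norm_mult scaleR_conv_of_real)

lemma mem_bop_subsp:
  "T \<in> bop (subsp s U) (subsp t V) \<longleftrightarrow> (\<forall>x\<in>U. T x \<in> V) \<and> (\<forall>x. x \<notin> U \<longrightarrow> T x = 0)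
     \<and> (\<forall>x\<in>U. \<forall>y\<in>U. T (x + y) = T x + T y) \<and> (\<forall>c. \<forall>x\<in>U. T (s c x) = t c (T x))
     \<and> (\<exists>C. \<forall>x\<in>U. norm (T x) \<le> C * norm x)"
  by (simp add: bop_def subsp_def)

lemma bopI:
  assumes "\<And>x. x \<in> U \<Longrightarrow> T x \<in> V" "\<And>x. x \<notin> U \<Longrightarrow> T x = 0"
    "\<And>x y. x \<in> U \<Longrightarrow> y \<in> U \<Longrightarrow> T (x + y) = T x + T y" "\<And>c x. x \<in> U \<Longrightarrow> T (s c x) = t c (T x)"
    "\<And>x. x \<in> U \<Longrightarrow> norm (T x) \<le> C * norm x"
  shows "T \<in> bop (subsp s U) (subsp t V)"
  unfolding mem_bop_subsp using assms by blast

lemma bop_mem: "T \<in> bop (subsp s U) (subsp t V) \<Longrightarrow> x \<in> U \<Longrightarrow> T x \<in> V"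
  and bop_outside: "T \<in> bop (subsp s U) (subsp t V) \<Longrightarrow> x \<notin> U \<Longrightarrow> T x = 0"
  and bop_add: "T \<in> bop (subsp s U) (subsp t V) \<Longrightarrow> x \<in> U \<Longrightarrow> y \<in> U \<Longrightarrow> T (x + y) = T x + T y"
  and bop_scale: "T \<in> bop (subsp s U) (subsp t V) \<Longrightarrow> x \<in> U \<Longrightarrow> T (s c x) = t c (T x)"
  by (auto simp: mem_bop_subsp)

text \<open>Valid for any carrier: if \<open>0\<close> lies in \<open>U\<close>, additivity gives
  it, otherwise the normalisation outside \<open>U\<close> does.\<close>

lemma bop_zero: "T \<in> bop (subsp s U) (subsp t V) \<Longrightarrow> T 0 = 0"
  by (metis add.right_neutral add_cancel_right_right bop_add bop_outside)

lemma bop_bound: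
  assumes "T \<in> bop (subsp s U) (subsp t V)"
  obtains C where "C > 0" "\<And>x. x \<in> U \<Longrightarrow> norm (T x) \<le> C * norm x"
proof -
  obtain C where C: "\<And>x. x \<in> U \<Longrightarrow> norm (T x) \<le> C * norm x" using assms unfolding mem_bop_subsp by meson
  have "norm (T x) \<le> (\<bar>C\<bar> + 1) * norm x" if "x \<in> U" for x
    by (rule order_trans[OF C[OF that]]) (intro mult_right_mono, auto)
  then show ?thesis using that[of "\<bar>C\<bar> + 1"] by simp
qed

lemma bop_codomain:
  assumes "T \<in> bop (subsp s U) (subsp t V)" "\<And>x. x \<in> U \<Longrightarrow> T x \<in> W"
  shows "T \<in> bop (subsp s U) (subsp t W)"
  using assms by (auto simp: mem_bop_subsp)

lemma bop_comp:
  assumes S: "S \<in> bop (subsp t V) (subsp r W)" and T: "T \<in> bop (subsp s U) (subsp t V)"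
  shows "S \<circ> T \<in> bop (subsp s U) (subsp r W)"
proof -
  obtain C where C: "C > 0" "\<And>x. x \<in> V \<Longrightarrow> norm (S x) \<le> C * norm x" by (rule bop_bound[OF S]) blast
  obtain D where D: "D > 0" "\<And>x. x \<in> U \<Longrightarrow> norm (T x) \<le> D * norm x" by (rule bop_bound[OF T]) blast
  show ?thesis
  proof (rule bopI[where C = "C * D"])
    show "norm ((S \<circ> T) x) \<le> C * D * norm x" if "x \<in> U" for x
      using order_trans[OF C(2)[OF bop_mem[OF T that]] mult_left_mono[OF D(2)[OF that], of C]] C(1)
      by (simp add: mult.assoc)
  qed (auto simp: bop_mem[OF S] bop_mem[OF T] bop_outside[OF T] bop_zero[OF S] bop_add[OF T]
      bop_add[OF S] bop_scale[OF T] bop_scale[OF S])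
qed

lemma bop_diff:
  assumes T: "T \<in> bop (subsp s U) (subsp t V)" and s: "normed_scale s" and U: "module.subspace s U"
    and "x \<in> U" "y \<in> U"
  shows "T (x - y) = T x - T y"
proof -
  interpret normed_scale s by (rule s)
  show ?thesis using bop_add[OF T, of "x - y" y] assms(4,5) subspace_diff[OF U] by simp
qed

lemma bop_scaleR:
  assumes T: "T \<in> bop (subsp s U) (subsp t V)" and s: "normed_scale s" and t: "normed_scale t" and "x \<in> U"
  shows "T (r *\<^sub>R x) = r *\<^sub>R T x"
  using bop_scale[OF T \<open>x \<in> U\<close>, of "of_real r"]
  by (simp add: normed_scale.scale_of_real[OF s] normed_scale.scale_of_real[OF t])

lemma bop_sum:
  assumes T: "T \<in> bop (subsp s U) (subsp t V)" and s: "normed_scale s" and U: "module.subspace s U"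
    and "\<And>i. i \<in> I \<Longrightarrow> f i \<in> U"
  shows "T (\<Sum>i\<in>I. f i) = (\<Sum>i\<in>I. T (f i))"
  using assms(4)
proof (induction I rule: infinite_finite_induct)
  case (insert i I)
  interpret normed_scale s by (rule s)
  have "(\<Sum>i\<in>I. f i) \<in> U" using insert by (intro subspace_sum[OF U]) auto
  then show ?case using insert bop_add[OF T] by simp
qed (auto simp: bop_zero[OF T])

lemma zero_bop:
  assumes "normed_scale t" "0 \<in> V"
  shows "(0 :: _ \<Rightarrow> _) \<in> bop (subsp s U) (subsp t V)"
proof -
  interpret normed_scale t by fact
  show ?thesis using assms by (auto simp: mem_bop_subsp intro: exI[of _ 0])
qed

lemma plus_bop:
  assumes S: "S \<in> bop (subsp s U) (subsp t V)" and T: "T \<in> bop (subsp s U) (subsp t V)"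
    and t: "normed_scale t" and V: "module.subspace t V"
  shows "S + T \<in> bop (subsp s U) (subsp t V)"
proof -
  interpret normed_scale t by (rule t)
  obtain C where C: "C > 0" "\<And>x. x \<in> U \<Longrightarrow> norm (S x) \<le> C * norm x" by (rule bop_bound[OF S]) blast
  obtain D where D: "D > 0" "\<And>x. x \<in> U \<Longrightarrow> norm (T x) \<le> D * norm x" by (rule bop_bound[OF T]) blast
  show ?thesis
  proof (rule bopI[where C = "C + D"])
    show "norm ((S + T) x) \<le> (C + D) * norm x" if "x \<in> U" for x
      using norm_triangle_ineq[of "S x" "T x"] C(2)[OF that] D(2)[OF that]
      by (simp add: distrib_right)
  qed (auto simp: bop_mem[OF S] bop_mem[OF T] bop_outside[OF T] bop_outside[OF S] bop_add[OF T]
      bop_add[OF S] bop_scale[OF T] bop_scale[OF S] subspace_add[OF V] scale_right_distrib)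
qed

lemma scale_bop:
  assumes T: "T \<in> bop (subsp s U) (subsp t V)" and t: "normed_scale t" and V: "module.subspace t V"
  shows "(\<lambda>x. t c (T x)) \<in> bop (subsp s U) (subsp t V)"
proof -
  interpret normed_scale t by (rule t)
  obtain C where C: "C > 0" "\<And>x. x \<in> U \<Longrightarrow> norm (T x) \<le> C * norm x" by (rule bop_bound[OF T]) blast
  show ?thesis
  proof (rule bopI[where C = "norm c * C"])
    show "norm (t c (T x)) \<le> norm c * C * norm x" if "x \<in> U" for x
      using mult_left_mono[OF C(2)[OF that], of "norm c"] by (simp add: norm_scale)
  qed (auto simp: bop_mem[OF T] bop_outside[OF T] bop_add[OF T]
      bop_scale[OF T] subspace_scale[OF V] scale_right_distrib scale_left_commute)
qed

lemma minus_bop: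
  assumes S: "S \<in> bop (subsp s U) (subsp t V)" and T: "T \<in> bop (subsp s U) (subsp t V)"
    and t: "normed_scale t" and V: "module.subspace t V"
  shows "S - T \<in> bop (subsp s U) (subsp t V)"
proof -
  interpret normed_scale t by (rule t)
  have eq: "S - T = S + (\<lambda>x. t (-1) (T x))" by (auto simp: fun_eq_iff)
  show ?thesis unfolding eq by (rule plus_bop[OF S scale_bop[OF T t V] t V])
qed

section \<open>Totally bounded seminorms\<close>

definition seminorm_on :: "'a::real_normed_vector set \<Rightarrow> ('a \<Rightarrow> real) \<Rightarrow> bool" where
  "seminorm_on U p \<longleftrightarrow> (\<forall>x\<in>U. \<forall>y\<in>U. p (x - y) \<le> p x + p y) \<and> (\<forall>r>0. \<forall>x\<in>U. p (r *\<^sub>R x) = r * p x)"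

text \<open>Total boundedness of the unit ball of \<open>U\<close> for the seminorm \<open>p\<close>. An operator \<open>T\<close> into a
  Banach space is compact iff this holds for \<open>p x = norm (T x)\<close>.\<close>

definition tot_bdd :: "'a::real_normed_vector set \<Rightarrow> ('a \<Rightarrow> real) \<Rightarrow> bool" where
  "tot_bdd U p \<longleftrightarrow> seminorm_on U p \<and>
     (\<forall>e>0. \<exists>F. finite F \<and> F \<subseteq> {x\<in>U. norm x \<le> 1} \<and> (\<forall>x\<in>U. norm x \<le> 1 \<longrightarrow> (\<exists>y\<in>F. p (x - y) < e)))"

lemma tot_bdd_seminorm: "tot_bdd U p \<Longrightarrow> seminorm_on U p"
  by (simp add: tot_bdd_def)

lemma tot_bddE:
  assumes "tot_bdd U p" "e > 0"
  obtains F where "finite F" "F \<subseteq> {x\<in>U. norm x \<le> 1}" "\<And>x. x \<in> U \<Longrightarrow> norm x \<le> 1 \<Longrightarrow> \<exists>y\<in>F. p (x - y) < e"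
  using assms unfolding tot_bdd_def by meson

text \<open>Any member of a non-empty class \<open>R i\<close> serves as its centre. So it suffices
  to cover the ball by finitely many pieces of small diameter, with indices of any type.\<close>

lemma tot_bddI:
  assumes "seminorm_on U p"
    and "\<And>e. e > 0 \<Longrightarrow> \<exists>(I :: 'i set) R. finite I \<and> (\<forall>x\<in>U. norm x \<le> 1 \<longrightarrow> (\<exists>i\<in>I. R i x))
        \<and> (\<forall>i\<in>I. \<forall>x\<in>U. \<forall>y\<in>U. norm x \<le> 1 \<longrightarrow> norm y \<le> 1 \<longrightarrow> R i x \<longrightarrow> R i y \<longrightarrow> p (x - y) < e)"
  shows "tot_bdd U p"
  unfolding tot_bdd_def
proof (intro conjI allI impI assms(1))
  fix e :: real assume "e > 0"
  from assms(2)[OF this] obtain I :: "'i set" and R where "finite I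
      \<and> (\<forall>x\<in>U. norm x \<le> 1 \<longrightarrow> (\<exists>i\<in>I. R i x))
      \<and> (\<forall>i\<in>I. \<forall>x\<in>U. \<forall>y\<in>U. norm x \<le> 1 \<longrightarrow> norm y \<le> 1 \<longrightarrow> R i x \<longrightarrow> R i y \<longrightarrow> p (x - y) < e)"
    by (elim exE)
  then have I: "finite I" "\<And>x. x \<in> U \<Longrightarrow> norm x \<le> 1 \<Longrightarrow> \<exists>i\<in>I. R i x"
    "\<And>i x y. i \<in> I \<Longrightarrow> x \<in> U \<Longrightarrow> y \<in> U \<Longrightarrow> norm x \<le> 1 \<Longrightarrow> norm y \<le> 1 \<Longrightarrow> R i x \<Longrightarrow> R i y \<Longrightarrow> p (x - y) < e"
    by auto
  define J where "J = {i\<in>I. \<exists>x\<in>U. norm x \<le> 1 \<and> R i x}"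
  define c where "c i = (SOME x. x \<in> U \<and> norm x \<le> 1 \<and> R i x)" for i
  have c: "c i \<in> U" "norm (c i) \<le> 1" "R i (c i)" if "i \<in> J" for i
    using someI_ex[of "\<lambda>x. x \<in> U \<and> norm x \<le> 1 \<and> R i x"] that by (auto simp: J_def c_def)
  show "\<exists>F. finite F \<and> F \<subseteq> {x \<in> U. norm x \<le> 1} \<and> (\<forall>x\<in>U. norm x \<le> 1 \<longrightarrow> (\<exists>y\<in>F. p (x - y) < e))"
  proof (intro exI[of _ "c ` J"] conjI ballI impI)
    show "finite (c ` J)" using I(1) by (simp add: J_def)
    show "c ` J \<subseteq> {x \<in> U. norm x \<le> 1}" using c by auto
    fix x assume x: "x \<in> U" "norm x \<le> 1"
    then obtain i where i: "i \<in> I" "R i x" using I(2) by blast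
    then have "i \<in> J" using x by (auto simp: J_def)
    then show "\<exists>y\<in>c ` J. p (x - y) < e" using I(3)[OF i(1) x(1) c(1) x(2) c(2) i(2) c(3)] by blast
  qed
qed

lemma seminorm_on_norm_bop:
  assumes "T \<in> bop (subsp s U) (subsp t V)" "normed_scale s" "normed_scale t" "module.subspace s U"
  shows "seminorm_on U (\<lambda>x. norm (T x))"
  unfolding seminorm_on_def
  by (auto simp: bop_diff[OF assms(1,2,4)] bop_scaleR[OF assms(1-3)] norm_triangle_ineq4)

lemma seminorm_on_diff:
  "seminorm_on U p \<Longrightarrow> x \<in> U \<Longrightarrow> y \<in> U \<Longrightarrow> p (x - y) \<le> p x + p y"
  by (simp add: seminorm_on_def)

text \<open>Compactness of differences, left multiples and finite-rank operators is obtained by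
  dominating their seminorm by one already known to be totally bounded.\<close>

lemma tot_bdd_mono:
  assumes p: "tot_bdd U p" and q: "seminorm_on U q" and U: "\<And>x y. x \<in> U \<Longrightarrow> y \<in> U \<Longrightarrow> x - y \<in> U"
    and le: "\<And>x. x \<in> U \<Longrightarrow> q x \<le> C * p x"
  shows "tot_bdd U q"
  unfolding tot_bdd_def
proof (intro conjI allI impI q)
  fix e :: real assume e: "e > 0"
  \<comment> \<open>Nonnegativity is not built into \<open>seminorm_on\<close>; it follows from
    \<open>p 0 \<le> 2 * p x\<close> and \<open>p 0 \<le> 2 * p 0\<close>.\<close>
  have p0: "p x \<ge> 0" if "x \<in> U" for x
  proof -
    have 0: "p 0 \<ge> 0" using seminorm_on_diff[OF tot_bdd_seminorm[OF p] that that]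
        seminorm_on_diff[OF tot_bdd_seminorm[OF p] U[OF that that] U[OF that that]] by simp
    have "p (x - x) \<le> p x + p x" by (rule seminorm_on_diff[OF tot_bdd_seminorm[OF p] that that])
    then show ?thesis using 0 by simp
  qed
  obtain F where F: "finite F" "F \<subseteq> {x\<in>U. norm x \<le> 1}"
    "\<And>x. x \<in> U \<Longrightarrow> norm x \<le> 1 \<Longrightarrow> \<exists>y\<in>F. p (x - y) < e / (\<bar>C\<bar> + 1)"
    using tot_bddE[OF p, of "e / (\<bar>C\<bar> + 1)"] e by auto
  show "\<exists>F. finite F \<and> F \<subseteq> {x \<in> U. norm x \<le> 1} \<and> (\<forall>x\<in>U. norm x \<le> 1 \<longrightarrow> (\<exists>y\<in>F. q (x - y) < e))"
  proof (intro exI[of _ F] conjI ballI impI F(1,2))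
    fix x assume x: "x \<in> U" "norm x \<le> 1"
    then obtain y where y: "y \<in> F" "p (x - y) < e / (\<bar>C\<bar> + 1)" using F(3) by blast
    then have xy: "x - y \<in> U" using F(2) U x by auto
    have "q (x - y) \<le> C * p (x - y)" by (rule le[OF xy])
    also have "\<dots> \<le> (\<bar>C\<bar> + 1) * p (x - y)" by (intro mult_right_mono p0[OF xy]) auto
    also have "\<dots> < e" using y(2) by (simp add: field_simps)
    finally show "\<exists>y\<in>F. q (x - y) < e" using y(1) by blast
  qed
qed

lemma tot_bdd_add:
  fixes U :: "'a::real_normed_vector set"
  assumes p: "tot_bdd U p" and q: "tot_bdd U q" and U: "\<And>x y. x \<in> U \<Longrightarrow> y \<in> U \<Longrightarrow> x - y \<in> U"
  shows "tot_bdd U (\<lambda>x. p x + q x)"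
proof (rule tot_bddI)
  show "seminorm_on U (\<lambda>x. p x + q x)"
    using tot_bdd_seminorm[OF p] tot_bdd_seminorm[OF q]
    unfolding seminorm_on_def by (auto simp: distrib_left) (smt (verit))
  fix e :: real assume e: "e > 0"
  \<comment> \<open>With quarters, two points sharing a centre differ by less than
    \<open>e / 2\<close> in each seminorm. The index will be the pair of centres.\<close>
  obtain F where F: "finite F" "F \<subseteq> {x\<in>U. norm x \<le> 1}"
    "\<And>x. x \<in> U \<Longrightarrow> norm x \<le> 1 \<Longrightarrow> \<exists>y\<in>F. p (x - y) < e / 4"
    using tot_bddE[OF p, of "e / 4"] e by auto
  obtain G where G: "finite G" "G \<subseteq> {x\<in>U. norm x \<le> 1}"
    "\<And>x. x \<in> U \<Longrightarrow> norm x \<le> 1 \<Longrightarrow> \<exists>y\<in>G. q (x - y) < e / 4"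
    using tot_bddE[OF q, of "e / 4"] e by auto
  have close: "r (x - y) < e / 2"
    if "seminorm_on U r" "r (x - c) < e / 4" "r (y - c) < e / 4" "x \<in> U" "y \<in> U" "c \<in> U" for r x y c
    using seminorm_on_diff[OF that(1) U[OF that(4,6)] U[OF that(5,6)]] that(2,3) by simp
  show "\<exists>(I :: ('a \<times> 'a) set) R. finite I \<and> (\<forall>x\<in>U. norm x \<le> 1 \<longrightarrow> (\<exists>i\<in>I. R i x)) \<and> (\<forall>i\<in>I. \<forall>x\<in>U. \<forall>y\<in>U.
      norm x \<le> 1 \<longrightarrow> norm y \<le> 1 \<longrightarrow> R i x \<longrightarrow> R i y \<longrightarrow> p (x - y) + q (x - y) < e)"
  proof (intro exI[of _ "F \<times> G"] exI[of _ "\<lambda>i x. p (x - fst i) < e / 4 \<and> q (x - snd i) < e / 4"]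
      conjI ballI impI)
    fix x assume "x \<in> U" "norm x \<le> 1"
    then obtain a b where "a \<in> F" "p (x - a) < e / 4" "b \<in> G" "q (x - b) < e / 4" using F(3) G(3) by meson
    then show "\<exists>i\<in>F \<times> G. p (x - fst i) < e / 4 \<and> q (x - snd i) < e / 4"
      by (intro bexI[of _ "(a, b)"]) auto
  next
    fix i x y assume i: "i \<in> F \<times> G" "x \<in> U" "y \<in> U" "p (x - fst i) < e / 4 \<and> q (x - snd i) < e / 4"
      "p (y - fst i) < e / 4 \<and> q (y - snd i) < e / 4"
    have "fst i \<in> U" "snd i \<in> U" using i(1) F(2) G(2) by auto
    then have "p (x - y) < e / 2" "q (x - y) < e / 2"
      using i close[OF tot_bdd_seminorm[OF p], of x "fst i" y] close[OF tot_bdd_seminorm[OF q], of x "snd i" y]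
      by auto
    then show "p (x - y) + q (x - y) < e" by simp
  qed (use F G in auto)
qed

lemma tot_bdd_zero: "tot_bdd U (\<lambda>x. 0)"
proof (rule tot_bddI)
  show "seminorm_on U (\<lambda>x. 0)" by (simp add: seminorm_on_def)
  show "\<exists>(I :: unit set) R. finite I \<and> (\<forall>x\<in>U. norm x \<le> 1 \<longrightarrow> (\<exists>i\<in>I. R i x)) \<and> (\<forall>i\<in>I. \<forall>x\<in>U. \<forall>y\<in>U.
      norm x \<le> 1 \<longrightarrow> norm y \<le> 1 \<longrightarrow> R i x \<longrightarrow> R i y \<longrightarrow> (0::real) < e)" if "e > 0" for e
    using that by (intro exI[of _ UNIV] exI[of _ "\<lambda>_ _. True"]) auto
qed

lemma tot_bdd_sum:
  assumes "finite I" "\<And>i. i \<in> I \<Longrightarrow> tot_bdd U (p i)" "\<And>x y. x \<in> U \<Longrightarrow> y \<in> U \<Longrightarrow> x - y \<in> U"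
  shows "tot_bdd U (\<lambda>x. \<Sum>i\<in>I. p i x)"
  using assms
proof (induction I rule: finite_induct)
  case (insert i I)
  then show ?case using tot_bdd_add[of U "p i" "\<lambda>x. \<Sum>i\<in>I. p i x"] by simp
qed (simp add: tot_bdd_zero)

lemma tot_bdd_comp:
  fixes V :: "'b::real_normed_vector set"
  assumes p: "tot_bdd V p" and S: "S \<in> bop (subsp s U) (subsp t V)" and s: "normed_scale s" and t: "normed_scale t"
    and U: "module.subspace s U" and V: "module.subspace t V"
  shows "tot_bdd U (\<lambda>x. p (S x))"
proof (rule tot_bddI)
  interpret s: normed_scale s by (rule s)
  interpret t: normed_scale t by (rule t)
  have sp: "seminorm_on V p" by (rule tot_bdd_seminorm[OF p])
  have hom: "p (r *\<^sub>R x) = r * p x" if "r > 0" "x \<in> V" for r x using sp that by (simp add: seminorm_on_def)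
  show "seminorm_on U (\<lambda>x. p (S x))"
    unfolding seminorm_on_def
    by (auto simp: bop_diff[OF S s U] bop_scaleR[OF S s t] bop_mem[OF S] hom intro!: seminorm_on_diff[OF sp])
  fix e :: real assume e: "e > 0"
  obtain C where C: "C > 0" "\<And>x. x \<in> U \<Longrightarrow> norm (S x) \<le> C * norm x" by (rule bop_bound[OF S]) blast
  \<comment> \<open>\<open>S\<close> maps the unit ball into the ball of radius \<open>C\<close>, so
    the net in \<open>V\<close> is used after division by \<open>C\<close>; this turns the tolerance
    \<open>e / 2\<close> into \<open>e / (2 * C)\<close>.\<close>
  obtain F where F: "finite F" "F \<subseteq> {x\<in>V. norm x \<le> 1}"
    "\<And>x. x \<in> V \<Longrightarrow> norm x \<le> 1 \<Longrightarrow> \<exists>y\<in>F. p (x - y) < e / (2 * C)"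
    using tot_bddE[OF p, of "e / (2 * C)"] e C by auto
  show "\<exists>(I :: 'b set) R. finite I \<and> (\<forall>x\<in>U. norm x \<le> 1 \<longrightarrow> (\<exists>i\<in>I. R i x)) \<and> (\<forall>i\<in>I. \<forall>x\<in>U. \<forall>y\<in>U.
      norm x \<le> 1 \<longrightarrow> norm y \<le> 1 \<longrightarrow> R i x \<longrightarrow> R i y \<longrightarrow> p (S (x - y)) < e)"
  proof (intro exI[of _ F] exI[of _ "\<lambda>v x. p ((1 / C) *\<^sub>R S x - v) < e / (2 * C)"] conjI ballI impI F(1))
    fix x assume x: "x \<in> U" "norm x \<le> 1"
    have "norm (S x) \<le> C" using C(2)[OF x(1)] C(1) x(2) by (meson mult_left_le order_trans less_imp_le)
    then show "\<exists>v\<in>F. p ((1 / C) *\<^sub>R S x - v) < e / (2 * C)"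
      using C(1) bop_mem[OF S x(1)] by (intro F(3) t.subspace_scaleR[OF V]) (auto simp: field_simps)
  next
    fix v x y assume v: "v \<in> F" "x \<in> U" "y \<in> U" "p ((1 / C) *\<^sub>R S x - v) < e / (2 * C)"
      "p ((1 / C) *\<^sub>R S y - v) < e / (2 * C)"
    have vV: "v \<in> V" using v F by auto
    have m: "(1 / C) *\<^sub>R S z - v \<in> V" if "z \<in> U" for z
      by (intro t.subspace_diff[OF V] t.subspace_scaleR[OF V] bop_mem[OF S] that vV)
    have "(1 / C) * p (S x - S y) = p ((1 / C) *\<^sub>R (S x - S y))"
      using C(1) v by (intro hom[symmetric]) (auto intro!: t.subspace_diff[OF V] bop_mem[OF S])
    also have "(1 / C) *\<^sub>R (S x - S y) = ((1 / C) *\<^sub>R S x - v) - ((1 / C) *\<^sub>R S y - v)"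
      by (simp add: algebra_simps)
    also have "p \<dots> < e / (2 * C) + e / (2 * C)"
      using seminorm_on_diff[OF sp m[OF v(2)] m[OF v(3)]] v(4,5) by linarith
    finally show "p (S (x - y)) < e" using C(1) v by (simp add: bop_diff[OF S s U] field_simps)
  qed
qed

lemma compact_closure_iff_tot_bdd:
  fixes T :: "'a::real_normed_vector \<Rightarrow> 'b::banach"
  assumes T: "T \<in> bop (subsp s U) (subsp t V)" and s: "normed_scale s" and t: "normed_scale t" and U: "module.subspace s U"
  shows "compact (closure (T ` {x \<in> U. norm x \<le> 1})) \<longleftrightarrow> tot_bdd U (\<lambda>x. norm (T x))"
proof
  assume K: "compact (closure (T ` {x \<in> U. norm x \<le> 1}))"
  show "tot_bdd U (\<lambda>x. norm (T x))"
  proof (rule tot_bddI[OF seminorm_on_norm_bop[OF T s t U]])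
    fix e :: real assume e: "e > 0"
    then obtain k where k: "finite k" "closure (T ` {x \<in> U. norm x \<le> 1}) \<subseteq> (\<Union>x\<in>k. ball x (e / 2))"
      using K unfolding compact_eq_totally_bounded by (meson half_gt_zero)
    show "\<exists>(I :: 'b set) R. finite I \<and> (\<forall>x\<in>U. norm x \<le> 1 \<longrightarrow> (\<exists>i\<in>I. R i x)) \<and> (\<forall>i\<in>I. \<forall>x\<in>U. \<forall>y\<in>U.
      norm x \<le> 1 \<longrightarrow> norm y \<le> 1 \<longrightarrow> R i x \<longrightarrow> R i y \<longrightarrow> norm (T (x - y)) < e)"
    proof (intro exI[of _ k] exI[of _ "\<lambda>i x. T x \<in> ball i (e / 2)"] conjI ballI impI k(1))
      fix x assume "x \<in> U" "norm x \<le> 1"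
      then have "T x \<in> closure (T ` {x \<in> U. norm x \<le> 1})" using closure_subset by fastforce
      then show "\<exists>i\<in>k. T x \<in> ball i (e / 2)" using k(2) by blast
    next
      fix i x y assume "x \<in> U" "y \<in> U" "T x \<in> ball i (e / 2)" "T y \<in> ball i (e / 2)"
      then show "norm (T (x - y)) < e"
        using dist_triangle_half_r[of i "T x" e "T y"] by (simp add: bop_diff[OF T s U] dist_norm)
    qed
  qed
next
  assume tb: "tot_bdd U (\<lambda>x. norm (T x))"
  show "compact (closure (T ` {x \<in> U. norm x \<le> 1}))"
    unfolding compact_eq_totally_bounded
  proof (intro conjI allI impI)
    show "complete (closure (T ` {x \<in> U. norm x \<le> 1}))" by (simp add: complete_eq_closed)
    fix e :: real assume e: "e > 0"
    obtain F where F: "finite F" "F \<subseteq> {x\<in>U. norm x \<le> 1}"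
      "\<And>x. x \<in> U \<Longrightarrow> norm x \<le> 1 \<Longrightarrow> \<exists>y\<in>F. norm (T (x - y)) < e / 2"
      using tot_bddE[OF tb, of "e / 2"] e by auto
    \<comment> \<open>Closed balls, so that their finite union is closed and contains the closure of
      the image as well.\<close>
    have sub: "T ` {x \<in> U. norm x \<le> 1} \<subseteq> (\<Union>y\<in>F. cball (T y) (e / 2))"
    proof clarsimp
      fix x assume x: "x \<in> U" "norm x \<le> 1"
      then obtain y where "y \<in> F" "norm (T (x - y)) < e / 2" using F(3) by blast
      moreover from this have "y \<in> U" using F(2) by auto
      ultimately show "\<exists>y\<in>F. dist (T y) (T x) * 2 \<le> e"
        using x by (intro bexI[of _ y]) (auto simp: bop_diff[OF T s U] dist_norm norm_minus_commute)
    qed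
    have "closure (T ` {x \<in> U. norm x \<le> 1}) \<subseteq> (\<Union>y\<in>F. cball (T y) (e / 2))"
      by (rule closure_minimal[OF sub]) (intro closed_UN F(1) ballI closed_cball)
    also have "\<dots> \<subseteq> (\<Union>y\<in>T ` F. ball y e)" using e by auto
    finally show "\<exists>k. finite k \<and> closure (T ` {x \<in> U. norm x \<le> 1}) \<subseteq> (\<Union>x\<in>k. ball x e)"
      using F(1) by (intro exI[of _ "T ` F"]) simp
  qed
qed

lemma tot_bdd_functional:
  fixes f :: "'a::real_normed_vector \<Rightarrow> 'k::real_or_complex"
  assumes f: "f \<in> bop (subsp s U) (subsp (*) UNIV)" and s: "normed_scale s" and U: "module.subspace s U"
  shows "tot_bdd U (\<lambda>x. norm (f x))"
proof (rule tot_bddI[OF seminorm_on_norm_bop[OF f s normed_scale_mult U]])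
  fix e :: real assume e: "e > 0"
  obtain C where C: "C > 0" "\<And>x. x \<in> U \<Longrightarrow> norm (f x) \<le> C * norm x" by (rule bop_bound[OF f]) blast
  obtain k where k: "finite k" "cball (0::'k) C \<subseteq> (\<Union>x\<in>k. ball x (e / 2))"
    using compact_cball_scalars[where 'k = 'k, of C] e unfolding compact_eq_totally_bounded by (meson half_gt_zero)
  show "\<exists>(I :: 'k set) R. finite I \<and> (\<forall>x\<in>U. norm x \<le> 1 \<longrightarrow> (\<exists>i\<in>I. R i x)) \<and> (\<forall>i\<in>I. \<forall>x\<in>U. \<forall>y\<in>U.
      norm x \<le> 1 \<longrightarrow> norm y \<le> 1 \<longrightarrow> R i x \<longrightarrow> R i y \<longrightarrow> norm (f (x - y)) < e)"
  proof (intro exI[of _ k] exI[of _ "\<lambda>i x. f x \<in> ball i (e / 2)"] conjI ballI impI k(1))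
    fix x assume x: "x \<in> U" "norm x \<le> 1"
    have "norm (f x) \<le> C" using C(2)[OF x(1)] C(1) x(2) by (meson mult_left_le order_trans less_imp_le)
    then show "\<exists>i\<in>k. f x \<in> ball i (e / 2)" using k(2) by (force simp: dist_norm)
  next
    fix i x y assume "x \<in> U" "y \<in> U" "f x \<in> ball i (e / 2)" "f y \<in> ball i (e / 2)"
    then show "norm (f (x - y)) < e"
      using dist_triangle_half_r[of i "f x" e "f y"] by (simp add: bop_diff[OF f s U] dist_norm)
  qed
qed

section \<open>Riesz's lemma and subspaces of finite codimension\<close>

context normed_scale
begin

text \<open>If \<open>x\<close> has distance \<open>d > 0\<close> from \<open>M\<close>, then
  \<open>norm k * d \<le> norm (sc k x - m)\<close>. So the coefficients along a convergent sequence
  form a Cauchy sequence, and completeness of the scalars provides their limit.\<close>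

lemma closed_add_line:
  assumes M: "subspace M" "closed M"
  shows "closed {z. \<exists>k. z - sc k x \<in> M}"
proof (cases "x \<in> M")
  case True
  have "z \<in> M" if "z - sc k x \<in> M" for z k
    using subspace_add[OF M(1) that subspace_scale[OF M(1) True, of k]] by simp
  moreover have "\<exists>k. z - sc k x \<in> M" if "z \<in> M" for z
    using that by (intro exI[of _ 0]) simp
  ultimately have "{z. \<exists>k. z - sc k x \<in> M} = M" by blast
  then show ?thesis using M by simp
next
  case False
  define d where "d = infdist x M"
  have M0: "M \<noteq> {}" using subspace_0[OF M(1)] by auto
  have d: "d > 0" using False M M0 in_closed_iff_infdist_zero[of M x] infdist_nonneg[of x M] by (simp add: d_def less_le)
  have low: "norm k * d \<le> norm (sc k x - m)" if "m \<in> M" for k m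
  proof (cases "k = 0")
    case False
    have "sc k x - m = sc k (x - sc (inverse k) m)" using False by (simp add: scale_right_diff_distrib)
    then have "norm (sc k x - m) = norm k * norm (x - sc (inverse k) m)" by (simp add: norm_scale)
    moreover have "d \<le> norm (x - sc (inverse k) m)"
      unfolding d_def using infdist_le[OF subspace_scale[OF M(1) that]] by (simp add: dist_norm)
    ultimately show ?thesis by (simp add: mult_left_mono)
  qed simp
  show ?thesis
    unfolding closed_sequential_limits
  proof (intro allI impI)
    fix z l assume "(\<forall>n. z n \<in> {z. \<exists>k. z - sc k x \<in> M}) \<and> z \<longlonglongrightarrow> l"
    then obtain k where k: "\<And>n. z n - sc (k n) x \<in> M" and zl: "z \<longlonglongrightarrow> l"
      by simp metis
    have "Cauchy k"
      unfolding Cauchy_def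
    proof (intro allI impI)
      fix e :: real assume "e > 0"
      then have "e * d > 0" using d by simp
      then obtain N where N: "\<And>m n. m \<ge> N \<Longrightarrow> n \<ge> N \<Longrightarrow> dist (z m) (z n) < e * d"
        using LIMSEQ_imp_Cauchy[OF zl] unfolding Cauchy_def by meson
      have "dist (k m) (k n) < e" if "m \<ge> N" "n \<ge> N" for m n
      proof -
        have "norm (k m - k n) * d \<le> norm (sc (k m - k n) x - ((z n - sc (k n) x) - (z m - sc (k m) x)))"
          by (rule low) (intro subspace_diff[OF M(1)] k)
        also have "sc (k m - k n) x - ((z n - sc (k n) x) - (z m - sc (k m) x)) = z m - z n"
          by (simp add: scale_left_diff_distrib)
        finally have "norm (k m - k n) * d < e * d" using N[OF that] by (simp add: dist_norm)
        then show ?thesis using d by (simp add: dist_norm)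
      qed
      then show "\<exists>N. \<forall>m\<ge>N. \<forall>n\<ge>N. dist (k m) (k n) < e" by blast
    qed
    then obtain c where "k \<longlonglongrightarrow> c" using Cauchy_convergent_scalars by (auto simp: convergent_def)
    then have "(\<lambda>n. z n - sc (k n) x) \<longlonglongrightarrow> l - sc c x" by (intro tendsto_diff zl tendsto_sc tendsto_const)
    then have "l - sc c x \<in> M" using M(2) k by (rule closed_sequentially[rotated 2])
    then show "l \<in> {z. \<exists>k. z - sc k x \<in> M}" by blast
  qed
qed

lemma closed_span_Un_finite:
  assumes M: "subspace M" "closed M" and "finite B"
  shows "closed (span (M \<union> B))"
  using assms(3)
proof (induction B rule: finite_induct)
  case empty
  then show ?case using M by (simp add: span_eq_iff[THEN iffD2])
next
  case (insert x B)
  then show ?case using closed_add_line[OF subspace_span insert.IH, of x] by (simp add: span_insert)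
qed

text \<open>Were \<open>M\<close> proper, take \<open>x\<close> outside it at distance
  \<open>d\<close>, and \<open>m\<close> in \<open>M\<close> with \<open>dist x m < 2 * d\<close>.
  Dividing \<open>x - m\<close> by \<open>2 * d\<close> gives a vector of the unit ball at distance
  at least 1/2 from \<open>M\<close>.\<close>

lemma Riesz_subspace:
  assumes U: "subspace U" and M: "subspace M" "closed M" "M \<subseteq> U"
    and near: "\<And>x. x \<in> U \<Longrightarrow> norm x \<le> 1 \<Longrightarrow> \<exists>m\<in>M. norm (x - m) < 1 / 2"
  shows "M = U"
proof (rule ccontr)
  assume "M \<noteq> U"
  then obtain x where x: "x \<in> U" "x \<notin> M" using M(3) by blast
  define d where "d = infdist x M"
  have M0: "M \<noteq> {}" using subspace_0[OF M(1)] by auto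
  have d: "d > 0" using x M M0 in_closed_iff_infdist_zero[of M x] infdist_nonneg[of x M] by (simp add: d_def less_le)
  have "(INF a\<in>M. dist x a) < 2 * d" using d M0 by (simp add: d_def infdist_def)
  then obtain m where m: "m \<in> M" "dist x m < 2 * d"
    using M0 by (subst (asm) cINF_less_iff) (auto intro: bdd_belowI2[of _ 0])
  define u where "u = (1 / (2 * d)) *\<^sub>R (x - m)"
  have "u \<in> U" unfolding u_def using m M x by (intro subspace_scaleR[OF U] subspace_diff[OF U]) auto
  moreover have "norm u = norm (x - m) / (2 * d)" using d by (simp add: u_def)
  then have "norm u \<le> 1" using m d by (simp add: dist_norm divide_le_eq)
  ultimately obtain m' where m': "m' \<in> M" "norm (u - m') < 1 / 2" using near by blast
  have "m + (2 * d) *\<^sub>R m' \<in> M" using m m' by (intro subspace_add[OF M(1)] subspace_scaleR[OF M(1)])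
  then have "d \<le> norm (x - (m + (2 * d) *\<^sub>R m'))" unfolding d_def using infdist_le by (metis dist_norm)
  also have "x - (m + (2 * d) *\<^sub>R m') = (2 * d) *\<^sub>R (u - m')"
    using d by (simp add: u_def algebra_simps)
  also have "norm \<dots> < d" using m'(2) d by simp
  finally show False by simp
qed

text \<open>Since \<open>p\<close> controls the distance to \<open>M\<close>, adding a fine finite
  net of the unit ball brings every vector of that ball within 1/2, and Riesz's lemma applies. With
  \<open>M = {0}\<close> this shows that compact operators are not bounded below in infinite
  dimension; with \<open>M = Y\<close> it excludes a scalar part in operators from \<open>X\<close>
  to \<open>Y\<close>.\<close>

lemma tot_bdd_finite_codim:
  assumes U: "subspace U" and M: "subspace M" "closed M" "M \<subseteq> U" and p: "tot_bdd U p"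
    and C: "C \<ge> 0" and near: "\<And>x. x \<in> U \<Longrightarrow> \<exists>m\<in>M. norm (x - m) \<le> C * p x"
  obtains B where "finite B" "U = span (M \<union> B)"
proof -
  obtain F where F: "finite F" "F \<subseteq> {x\<in>U. norm x \<le> 1}"
    "\<And>x. x \<in> U \<Longrightarrow> norm x \<le> 1 \<Longrightarrow> \<exists>y\<in>F. p (x - y) < 1 / (2 * (C + 1))"
    using tot_bddE[OF p, of "1 / (2 * (C + 1))"] C by auto
  have "span (M \<union> F) = U"
  proof (rule Riesz_subspace[OF U])
    show "span (M \<union> F) \<subseteq> U" using F(2) M(3) U by (intro span_minimal) auto
    fix x assume x: "x \<in> U" "norm x \<le> 1"
    then obtain y where y: "y \<in> F" "p (x - y) < 1 / (2 * (C + 1))" using F(3) by blast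
    then have "x - y \<in> U" using F(2) subspace_diff[OF U] x by auto
    then obtain m where m: "m \<in> M" "norm (x - y - m) \<le> C * p (x - y)" using near by blast
    have "C * p (x - y) \<le> C * (1 / (2 * (C + 1)))" using y(2) C by (intro mult_left_mono) auto
    also have "\<dots> < 1 / 2" using C by (simp add: field_simps)
    finally have "norm (x - (y + m)) < 1 / 2" using m(2) by (simp add: diff_diff_eq)
    moreover have "y + m \<in> span (M \<union> F)" using y m by (intro span_add) (auto intro: span_base)
    ultimately show "\<exists>m\<in>span (M \<union> F). norm (x - m) < 1 / 2" by blast
  qed (auto intro: closed_span_Un_finite M F)
  then show ?thesis using that F(1) by blast
qed

lemma tot_bdd_not_bounded_below:
  assumes U: "subspace U" "infinite_dim sc U" and p: "tot_bdd U p" and "C \<ge> 0"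
  shows "\<exists>x\<in>U. C * p x < norm x"
proof (rule ccontr)
  assume "\<not> ?thesis"
  then have "norm (x - 0) \<le> C * p x" if "x \<in> U" for x using that by force
  then obtain B where "finite B" "U = span ({0} \<union> B)"
    using tot_bdd_finite_codim[OF U(1) subspace_single_0 _ _ p \<open>C \<ge> 0\<close>] subspace_0[OF U(1)] by (metis closed_singleton insert_subset empty_subsetI singletonI)
  then show False using U(2) unfolding infinite_dim_def by (metis finite.insertI insert_is_Un)
qed

end

section \<open>Schauder bases\<close>

locale schauder = normed_scale sc
  for sc :: "'k::real_or_complex \<Rightarrow> 'a::banach \<Rightarrow> 'a" +
  fixes b :: "nat \<Rightarrow> 'a"
  assumes basis: "schauder_basis sc b"
begin

definition coef :: "'a \<Rightarrow> nat \<Rightarrow> 'k" where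
  "coef x = (THE c. (\<lambda>n. sc (c n) (b n)) sums x)"

definition proj :: "nat \<Rightarrow> 'a \<Rightarrow> 'a" where
  "proj n x = (\<Sum>k<n. sc (coef x k) (b k))"

text \<open>The classical renorming that makes all partial sum projections contractions;
  \<open>proj_bounded\<close> amounts to its equivalence with \<open>norm\<close>.\<close>

definition basis_norm :: "'a \<Rightarrow> real" where
  "basis_norm x = (SUP n. norm (proj n x))"

lemma coef_sums: "(\<lambda>n. sc (coef x n) (b n)) sums x"
  unfolding coef_def
  by (rule theI'[where P = "\<lambda>c. (\<lambda>n. sc (c n) (b n)) sums x"])
    (use basis in \<open>simp add: schauder_basis_def\<close>)

lemma coef_eq: "(\<lambda>n. sc (c n) (b n)) sums x \<Longrightarrow> coef x = c"
  using basis coef_sums[of x] unfolding schauder_basis_def by blast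

lemma proj_LIMSEQ: "(\<lambda>n. proj n x) \<longlonglongrightarrow> x"
  using coef_sums[of x] by (simp add: sums_def proj_def)

lemma coef_add: "coef (x + y) k = coef x k + coef y k"
  using coef_eq[OF sums_add[OF coef_sums[of x] coef_sums[of y], folded scale_left_distrib]] by simp

lemma coef_scale: "coef (sc c x) k = c * coef x k"
proof -
  have "(\<lambda>n. sc c (sc (coef x n) (b n))) sums sc c x"
    using bounded_linear.sums[OF bounded_bilinear.bounded_linear_right[OF bounded_bilinear_sc] coef_sums] .
  then have "(\<lambda>n. sc (c * coef x n) (b n)) sums sc c x" by simp
  from coef_eq[OF this] show ?thesis by simp
qed

lemma coef_basis: "coef (b m) k = (if k = m then 1 else 0)"
proof -
  have "(\<lambda>n. if n = m then b n else 0) sums b m" by (rule sums_single)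
  also have "(\<lambda>n. if n = m then b n else 0) = (\<lambda>n. sc (if n = m then 1 else 0) (b n))" by auto
  finally have "(\<lambda>n. sc (if n = m then 1 else 0) (b n)) sums b m" .
  from coef_eq[OF this] show ?thesis by simp
qed

lemma basis_nonzero: "b m \<noteq> 0"
  using coef_basis[of m m] coef_scale[of 0 0 m] by auto

lemma proj_add: "proj n (x + y) = proj n x + proj n y"
  by (simp add: proj_def coef_add scale_left_distrib sum.distrib)

lemma proj_scale: "proj n (sc c x) = sc c (proj n x)"
  by (simp add: proj_def coef_scale scale_sum_right)

lemma proj_scaleR: "proj n (r *\<^sub>R x) = r *\<^sub>R proj n x"
  using proj_scale[of n "of_real r"] by (simp add: scale_of_real)

lemma proj_diff: "proj n (x - y) = proj n x - proj n y"
  using proj_add[of n "x - y" y] by simp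

lemma norm_proj_le: "norm (proj n x) \<le> basis_norm x"
proof -
  have "convergent (\<lambda>n. norm (proj n x))" using tendsto_norm[OF proj_LIMSEQ] by (auto simp: convergent_def)
  then have "Bseq (\<lambda>n. norm (proj n x))" by (rule convergent_imp_Bseq)
  then have "bdd_above (range (\<lambda>n. norm (proj n x)))" by (simp add: Bseq_eq_bounded bounded_imp_bdd_above)
  then show ?thesis unfolding basis_norm_def by (rule cSUP_upper[OF UNIV_I])
qed

lemma basis_norm_le: "(\<And>n. norm (proj n x) \<le> m) \<Longrightarrow> basis_norm x \<le> m"
  unfolding basis_norm_def by (rule cSUP_least) auto

lemma norm_le_basis_norm: "norm x \<le> basis_norm x"
  by (rule LIMSEQ_le_const2[OF tendsto_norm[OF proj_LIMSEQ]]) (simp add: norm_proj_le)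

text \<open>Completeness in the norm \<open>basis_norm\<close>: coefficientwise sums are again expansions.\<close>

lemma norm_proj_countably_subadditive:
  assumes X: "X sums x" and sm: "summable (\<lambda>j. basis_norm (X j))"
  shows "norm (proj n x) \<le> (\<Sum>j. basis_norm (X j))"
proof -
  have smn: "summable (\<lambda>j. norm (proj n (X j)))" for n
    by (rule summable_comparison_test'[OF sm, of 0]) (simp add: norm_proj_le)
  have smp: "summable (\<lambda>j. proj n (X j))" for n by (rule summable_norm_cancel[OF smn])
  define v where "v k = (\<Sum>j. sc (coef (X j) k) (b k))" for k
  have diff: "sc (coef y k) (b k) = proj (Suc k) y - proj k y" for y k by (simp add: proj_def)
  have smv: "summable (\<lambda>j. sc (coef (X j) k) (b k))" for k
    unfolding diff by (intro summable_diff smp)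
  \<comment> \<open>The partial sums lie on the line through \<open>b k\<close>, which is closed, so
    the limit \<open>v k\<close> does too and determines a coefficient.\<close>
  have "\<exists>c. v k = sc c (b k)" for k
  proof -
    have lim: "(\<lambda>m. \<Sum>j<m. sc (coef (X j) k) (b k)) \<longlonglongrightarrow> v k"
      using summable_sums[OF smv, of k] by (simp add: v_def sums_def)
    have mem: "\<forall>m. (\<Sum>j<m. sc (coef (X j) k) (b k)) \<in> {z. \<exists>c. z - sc c (b k) \<in> {0}}"
      by (simp flip: scale_sum_left)
    have "v k \<in> {z. \<exists>c. z - sc c (b k) \<in> {0}}"
      by (rule closed_sequentially[OF closed_add_line[OF subspace_single_0 closed_singleton] spec[OF mem] lim])
    then show ?thesis by auto
  qed
  then obtain c where c: "\<And>k. v k = sc (c k) (b k)" by metis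
  have partial: "(\<Sum>k<n. v k) = (\<Sum>j. proj n (X j))" for n
    unfolding v_def proj_def by (rule suminf_sum[symmetric]) (rule smv)
  have "(\<lambda>n. \<Sum>j. proj n (X j)) \<longlonglongrightarrow> (\<Sum>j. X j)"
  proof (rule Lim_transform2[OF tendsto_const], rule Lim_null_comparison[OF always_eventually[OF allI]])
    fix n
    have "norm (proj n (X j) - X j) \<le> 2 * basis_norm (X j)" for j
      using norm_triangle_ineq4[of "proj n (X j)" "X j"] norm_proj_le[of n "X j"] norm_le_basis_norm[of "X j"]
      by linarith
    then have "summable (\<lambda>j. norm (proj n (X j) - X j))"
      by (intro summable_comparison_test'[OF summable_mult[OF sm, of 2], of 0]) simp
    from summable_norm[OF this] have "norm ((\<Sum>j. proj n (X j)) - (\<Sum>j. X j)) \<le> (\<Sum>j. norm (proj n (X j) - X j))"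
      unfolding suminf_diff[OF smp sums_summable[OF X]] .
    then show "norm ((\<Sum>j. X j) - (\<Sum>j. proj n (X j))) \<le> (\<Sum>j. norm (proj n (X j) - X j))"
      by (subst norm_minus_commute)
  next
    have "(\<lambda>n. norm (proj n (X j) - X j)) \<longlonglongrightarrow> 0" for j
      using tendsto_norm[OF tendsto_diff[OF proj_LIMSEQ[of "X j"] tendsto_const[of "X j"]]] by simp
    moreover have "norm (norm (proj n (X j) - X j)) \<le> 2 * basis_norm (X j)" for n j
      using norm_triangle_ineq4[of "proj n (X j)" "X j"] norm_proj_le[of n "X j"] norm_le_basis_norm[of "X j"]
      by simp
    \<comment> \<open>Dominated convergence for series: each term tends to 0 in \<open>n\<close>,
      with the summable dominant \<open>2 * basis_norm (X j)\<close>.\<close>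
    ultimately have "(\<lambda>n. \<Sum>j. norm (proj n (X j) - X j)) \<longlonglongrightarrow> (\<Sum>j. 0)"
      by (intro tannerys_theorem[where M = "\<lambda>j. 2 * basis_norm (X j)", THEN conjunct2, THEN conjunct2])
        (auto intro!: always_eventually summable_mult sm)
    then show "(\<lambda>n. \<Sum>j. norm (proj n (X j) - X j)) \<longlonglongrightarrow> 0" by simp
  qed
  then have "(\<lambda>n. sc (c n) (b n)) sums x"
    using sums_unique[OF X] by (simp add: sums_def partial flip: c)
  \<comment> \<open>By uniqueness of expansions the coefficients of \<open>x\<close> are the
    termwise sums, so every projection commutes with the series.\<close>
  then have "coef x = c" by (rule coef_eq)
  then have "proj n x = (\<Sum>j. proj n (X j))" using partial[of n] by (simp add: proj_def c)
  then have "norm (proj n x) \<le> (\<Sum>j. norm (proj n (X j)))" using summable_norm[OF smn] by simp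
  also have "\<dots> \<le> (\<Sum>j. basis_norm (X j))" by (intro suminf_le norm_proj_le smn sm)
  finally show ?thesis .
qed

text \<open>The vectors whose partial sums are bounded by \<open>m\<close> exhaust the space as
  \<open>m\<close> grows, so by Baire some closure contains a ball. Half the difference of
  approximants to \<open>x0 + x\<close> and \<open>x0 - x\<close> approximates \<open>x\<close>,
  which moves the ball to the origin.\<close>

lemma proj_approximation:
  obtains m r where "m > 0" "r > 0"
    "\<And>x e. norm x < r \<Longrightarrow> e > 0 \<Longrightarrow> \<exists>y. (\<forall>n. norm (proj n y) \<le> m) \<and> norm (x - y) < e"
proof -
  define A where "A m = {y. \<forall>n. norm (proj n y) \<le> real m}" for m
  have "\<exists>m. interior (closure (A m)) \<noteq> {}"
  proof (rule ccontr)
    assume "\<not> ?thesis"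
    then have "Met_TC.mtopology interior_of (\<Union> (range (\<lambda>m. closure (A m)))) = {}"
      by (intro Met_TC.metric_Baire_category_alt) (auto simp: complete_UNIV)
    moreover have "(\<Union> (range (\<lambda>m. closure (A m)))) = UNIV"
    proof -
      have "x \<in> A (nat \<lceil>basis_norm x\<rceil>)" for x
        unfolding A_def using norm_proj_le[of _ x] by (auto intro: order_trans[OF norm_proj_le])  (meson order_trans real_nat_ceiling_ge)
      then show ?thesis using closure_subset by blast
    qed
    ultimately show False by simp
  qed
  then obtain m x0 where "x0 \<in> interior (closure (A m))" by blast
  then obtain r where r: "r > 0" "ball x0 r \<subseteq> closure (A m)" by (auto simp: mem_interior)
  show ?thesis
  proof (rule that[of "real m + 1" r])
    fix x :: 'a and e :: real assume x: "norm x < r" and e: "e > 0"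
    have "x0 + x \<in> closure (A m)" "x0 - x \<in> closure (A m)" using r(2) x by (auto simp: dist_norm subset_iff)
    then obtain y z where y: "y \<in> A m" "dist y (x0 + x) < e" and z: "z \<in> A m" "dist z (x0 - x) < e"
      using e by (meson closure_approachable)
    have yz: "norm (proj n ((1/2) *\<^sub>R (y - z))) \<le> real m + 1" for n
      using norm_triangle_ineq4[of "proj n y" "proj n z"] y(1) z(1)
      by (auto simp: proj_scaleR proj_diff A_def) (smt (verit))
    have "x - (1/2) *\<^sub>R (y - z) = (1/2) *\<^sub>R ((z - (x0 - x)) - (y - (x0 + x)))"
      by (simp add: algebra_simps flip: scaleR_left_distrib)
    then have "norm (x - (1/2) *\<^sub>R (y - z)) = norm ((z - (x0 - x)) - (y - (x0 + x))) / 2" by simp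
    also have "\<dots> < e"
      using norm_triangle_ineq4[of "z - (x0 - x)" "y - (x0 + x)"] y(2) z(2) unfolding dist_norm by linarith
    finally show "\<exists>y. (\<forall>n. norm (proj n y) \<le> real m + 1) \<and> norm (x - y) < e" using yz by blast
  qed (use r in auto)
qed

text \<open>The open mapping argument for the identity from \<open>basis_norm\<close> to
  \<open>norm\<close>: approximate, then approximate the error at half the scale, and so on. The
  approximants sum to \<open>x\<close>, and countable subadditivity bounds its projections.\<close>

theorem proj_bounded:
  obtains C where "C > 0" "\<And>n x. norm (proj n x) \<le> C * norm x"
proof -
  obtain m r where mr: "m > 0" "r > 0"
    and appr: "\<And>x e. norm x < r \<Longrightarrow> e > 0 \<Longrightarrow> \<exists>y. (\<forall>n. norm (proj n y) \<le> m) \<and> norm (x - y) < e"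
    by (rule proj_approximation) blast
  define t :: "nat \<Rightarrow> real" where "t j = (1/2) ^ j" for j
  have t: "t j > 0" for j by (simp add: t_def)
  have "\<exists>y. (\<forall>n. norm (proj n y) \<le> m * t j) \<and> norm (x - y) < r * t (Suc j)" if x: "norm x < r * t j" for x j
  proof -
    have "norm ((1 / t j) *\<^sub>R x) < r" using x t[of j] by (simp add: field_simps)
    then obtain y where y: "\<And>n. norm (proj n y) \<le> m" "norm ((1 / t j) *\<^sub>R x - y) < r / 2"
      using appr[of "(1 / t j) *\<^sub>R x" "r / 2"] mr by auto
    have "x - t j *\<^sub>R y = t j *\<^sub>R ((1 / t j) *\<^sub>R x - y)" using t[of j] by (simp add: algebra_simps)
    then have "norm (x - t j *\<^sub>R y) = t j * norm ((1 / t j) *\<^sub>R x - y)" using t[of j] by simp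
    also have "\<dots> < t j * (r / 2)" using y(2) t[of j] by simp
    also have "\<dots> = r * t (Suc j)" by (simp add: t_def)
    finally show ?thesis using y(1) t[of j]
      by (intro exI[of _ "t j *\<^sub>R y"]) (simp add: proj_scaleR mult.commute)
  qed
  then have "\<forall>j x. \<exists>y. norm x < r * t j \<longrightarrow> (\<forall>n. norm (proj n y) \<le> m * t j) \<and> norm (x - y) < r * t (Suc j)"
    by blast
  then obtain g where "\<forall>j x. norm x < r * t j \<longrightarrow>
      (\<forall>n. norm (proj n (g j x)) \<le> m * t j) \<and> norm (x - g j x) < r * t (Suc j)"
    unfolding choice_iff by blast
  then have g: "\<And>x j n. norm x < r * t j \<Longrightarrow> norm (proj n (g j x)) \<le> m * t j"
    "\<And>x j. norm x < r * t j \<Longrightarrow> norm (x - g j x) < r * t (Suc j)" by auto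
  have small: "norm (proj n x) \<le> 2 * m" if x: "norm x < r" for n x
  proof -
    \<comment> \<open>\<open>z j\<close> is the error left after \<open>j\<close>
      approximations.\<close>
    define z where "z = rec_nat x (\<lambda>j w. w - g j w)"
    have z: "z 0 = x" "z (Suc j) = z j - g j (z j)" for j by (simp_all add: z_def)
    have nz: "norm (z j) < r * t j" for j
      by (induction j) (use x g(2) in \<open>auto simp: z t_def\<close>)
    have part: "(\<Sum>j<k. g j (z j)) = x - z k" for k
      by (induction k) (auto simp: z)
    have tz: "(\<lambda>j. r * t j) \<longlonglongrightarrow> 0"
      unfolding t_def using tendsto_mult_left[OF LIMSEQ_power_zero[of "1/2 :: real"], of r] by simp
    have "z \<longlonglongrightarrow> 0"
      by (rule Lim_null_comparison[OF _ tz]) (auto intro!: always_eventually less_imp_le nz)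
    then have "(\<lambda>k. x - z k) \<longlonglongrightarrow> x - 0" by (intro tendsto_diff tendsto_const)
    then have sums: "(\<lambda>j. g j (z j)) sums x" by (simp add: sums_def part)
    have bn: "basis_norm (g j (z j)) \<le> m * t j" for j by (intro basis_norm_le g(1) nz)
    have bn0: "basis_norm y \<ge> 0" for y using norm_le_basis_norm[of y] norm_ge_zero[of y] by linarith
    have mt: "(\<lambda>j. m * t j) sums (m * 2)"
      unfolding t_def using sums_mult[OF geometric_sums[of "1/2 :: real"], of m] by simp
    have sb: "summable (\<lambda>j. basis_norm (g j (z j)))"
      by (rule summable_comparison_test'[OF sums_summable[OF mt], of 0]) (simp add: bn bn0)
    have "norm (proj n x) \<le> (\<Sum>j. basis_norm (g j (z j)))" by (rule norm_proj_countably_subadditive[OF sums sb])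
    also have "\<dots> \<le> (\<Sum>j. m * t j)" by (intro suminf_le bn sb sums_summable[OF mt])
    also have "\<dots> = m * 2" by (rule sums_unique[OF mt, symmetric])
    finally show ?thesis by simp
  qed
  show ?thesis
  \<comment> \<open>Rescaling \<open>x\<close> to norm \<open>r / 2\<close> turns the bound
    \<open>2 * m\<close> of \<open>small\<close> into the constant \<open>4 * m / r\<close>.\<close>
  proof (rule that[of "4 * m / r"])
    show "norm (proj n x) \<le> 4 * m / r * norm x" for n x
    proof (cases "x = 0")
      case True
      then show ?thesis using proj_scale[of n 0 0] by simp
    next
      case False
      define s where "s = r / (2 * norm x)"
      have s: "s > 0" using False mr by (simp add: s_def)
      have "norm (s *\<^sub>R x) < r" using False mr s by (simp add: s_def)
      from small[OF this, of n] have "s * norm (proj n x) \<le> 2 * m" using s by (simp add: proj_scaleR)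
      then show ?thesis using False mr by (simp add: s_def field_simps)
    qed
  qed (use mr in simp)
qed

lemma coef_bop: "(\<lambda>x. coef x k) \<in> bop (subsp sc UNIV) (subsp (*) UNIV)"
proof -
  obtain C where C: "C > 0" "\<And>n x. norm (proj n x) \<le> C * norm x" by (rule proj_bounded) blast
  show ?thesis
  proof (rule bopI[where C = "2 * C / norm (b k)"])
    fix x
    have "norm (sc (coef x k) (b k)) = norm (proj (Suc k) x - proj k x)" by (simp add: proj_def)
    also have "\<dots> \<le> 2 * C * norm x"
      using norm_triangle_ineq4[of "proj (Suc k) x" "proj k x"] C(2)[of "Suc k" x] C(2)[of k x] by linarith
    finally show "norm (coef x k) \<le> 2 * C / norm (b k) * norm x"
      using basis_nonzero[of k] by (simp add: norm_scale field_simps)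
  qed (auto simp: coef_add coef_scale)
qed

text \<open>Coefficient functionals are continuous, so their kernels are closed subspaces. For
  \<open>Y\<close> this says that coefficients are supported on the indices of its
  subsequence.\<close>

lemma coef_closed_span:
  assumes "x \<in> closed_span sc (b ` N)" "k \<notin> N"
  shows "coef x k = 0"
proof -
  have "bounded_linear (\<lambda>x. coef x k)"
  proof -
    obtain C where "\<And>x. norm (coef x k) \<le> C * norm x" by (rule bop_bound[OF coef_bop[of k]]) auto
    moreover have "coef (r *\<^sub>R x) k = r *\<^sub>R coef x k" for r x
      using coef_scale[of "of_real r" x k] by (simp add: scale_of_real scaleR_conv_of_real)
    ultimately show ?thesis by (intro bounded_linear_intro[of _ C]) (auto simp: coef_add mult.commute)
  qed
  then have cont: "continuous_on UNIV (\<lambda>x. coef x k)" by (rule linear_continuous_on)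
  have "closed {x. coef x k = 0}"
    using continuous_closed_preimage_constant[OF cont closed_UNIV, of 0] by simp
  moreover have "span (b ` N) \<subseteq> {x. coef x k = 0}"
    using assms(2) coef_scale[of 0 0 k]
    by (intro span_minimal subspaceI) (auto simp: coef_basis coef_add coef_scale)
  ultimately show ?thesis using assms(1) closure_minimal unfolding closed_span_def by blast
qed

end

section \<open>Extension of compact operators\<close>

lemma incl_bop:
  assumes "normed_scale s" "module.subspace s U" "U \<subseteq> V"
  shows "incl U \<in> bop (subsp s U) (subsp s V)"
proof -
  interpret normed_scale s by fact
  show ?thesis
    using assms(3) subspace_add[OF assms(2)] subspace_scale[OF assms(2)]
    by (intro bopI[where C = 1]) (auto simp: incl_def)
qed

lemma tot_bdd_minus:
  assumes S: "S \<in> bop (subsp s U) (subsp t V)" and T: "T \<in> bop (subsp s U) (subsp t V)"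
    and s: "normed_scale s" and t: "normed_scale t" and U: "module.subspace s U" and V: "module.subspace t V"
    and "tot_bdd U (\<lambda>x. norm (S x))" "tot_bdd U (\<lambda>x. norm (T x))"
  shows "tot_bdd U (\<lambda>x. norm ((S - T) x))"
proof -
  interpret normed_scale s by (rule s)
  show ?thesis
    by (rule tot_bdd_mono[OF tot_bdd_add[OF assms(7,8)] seminorm_on_norm_bop[OF minus_bop[OF S T t V] s t U], of 1])
      (auto simp: subspace_diff[OF U] norm_triangle_ineq4)
qed

section \<open>Dual norms and coordinates on a dual isomorphic to \<open>ell1\<close>\<close>

lemma
  assumes "f \<in> bop (subsp s W) scalars" "normed_scale s" "module.subspace s W"
  shows dual_norm_bound: "w \<in> W \<Longrightarrow> norm (f w) \<le> nrm (dual_space (subsp s W)) f * norm w"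
    and dual_norm_nonneg: "0 \<le> nrm (dual_space (subsp s W)) f"
proof -
  interpret normed_scale s by fact
  have f: "f \<in> bop (subsp s W) (subsp (*) UNIV)" using assms(1) by (simp add: scalars_eq_subsp)
  obtain C where C: "C > 0" "\<And>x. x \<in> W \<Longrightarrow> norm (f x) \<le> C * norm x" by (rule bop_bound[OF f]) blast
  have nd: "nrm (dual_space (subsp s W)) f = Sup {norm (f x) |x. x \<in> W \<and> norm x \<le> 1}"
    by (simp add: dual_space_def subsp_def)
  have bdd: "bdd_above {norm (f x) |x. x \<in> W \<and> norm x \<le> 1}"
  proof (rule bdd_aboveI)
    fix r assume "r \<in> {norm (f x) |x. x \<in> W \<and> norm x \<le> 1}"
    then obtain x where "r = norm (f x)" "x \<in> W" "norm x \<le> 1" by blast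
    then show "r \<le> C" using C(2)[of x] mult_left_le[of "norm x" C] C(1) by linarith
  qed
  have "norm (f 0) \<le> Sup {norm (f x) |x. x \<in> W \<and> norm x \<le> 1}"
    using subspace_0[OF assms(3)] by (intro cSup_upper bdd) auto
  then show "0 \<le> nrm (dual_space (subsp s W)) f" by (simp add: nd bop_zero[OF f])
  assume w: "w \<in> W"
  show "norm (f w) \<le> nrm (dual_space (subsp s W)) f * norm w"
  proof (cases "w = 0")
    case False
    let ?w = "(1 / norm w) *\<^sub>R w"
    have "norm (f ?w) \<le> Sup {norm (f x) |x. x \<in> W \<and> norm x \<le> 1}"
      using False subspace_scaleR[OF assms(3) w, of "1 / norm w"] by (intro cSup_upper bdd) auto
    then show ?thesis
      using False bop_scaleR[OF f assms(2) normed_scale_mult w, of "1 / norm w"]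
      by (simp add: nd field_simps)
  qed (simp add: bop_zero[OF f])
qed

lemma dual_norm_le:
  assumes "normed_scale s" "module.subspace s W" "\<And>w. w \<in> W \<Longrightarrow> norm (f w) \<le> m * norm w" "m \<ge> 0"
  shows "nrm (dual_space (subsp s W)) f \<le> m"
proof -
  interpret normed_scale s by fact
  have "norm (f x) \<le> m" if "x \<in> W" "norm x \<le> 1" for x
    using assms(3)[OF that(1)] mult_left_le[OF that(2) assms(4)] by linarith
  moreover have "0 \<in> W" by (rule subspace_0[OF assms(2)])
  ultimately have "Sup {norm (f x) |x. x \<in> W \<and> norm x \<le> 1} \<le> m"
    by (intro cSup_least) auto
  then show ?thesis by (simp add: dual_space_def subsp_def)
qed

text \<open>The functionals \<open>\<phi> i\<close> correspond to the unit vectors of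
  \<open>ell1\<close>, and \<open>A f\<close> lists the coordinates of \<open>f\<close>. The error
  estimate is the lower bound of the isomorphism applied to \<open>f\<close> minus its partial sum,
  whose coordinates are those of \<open>f\<close> with the first \<open>N\<close> set to
  zero.\<close>

lemma dual_ell1_representation:
  fixes s :: "'k::real_or_complex \<Rightarrow> 'a::real_normed_vector \<Rightarrow> 'a"
  assumes iso: "isomorphic (dual_space (subsp s W)) (ell1 :: ('k, nat \<Rightarrow> 'k) nspace)"
    and s: "normed_scale s" and W: "module.subspace s W"
  obtains \<phi> :: "nat \<Rightarrow> 'a \<Rightarrow> 'k" and A :: "('a \<Rightarrow> 'k) \<Rightarrow> nat \<Rightarrow> 'k" and D C :: real
  where "D > 0" "C > 0" "\<And>i. \<phi> i \<in> bop (subsp s W) scalars"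
    "\<And>i w. w \<in> W \<Longrightarrow> norm (\<phi> i w) \<le> D * norm w"
    "\<And>f. f \<in> bop (subsp s W) scalars \<Longrightarrow> summable (\<lambda>i. norm (A f i))"
    "\<And>F c (n :: nat) i. (\<And>k. F k \<in> bop (subsp s W) scalars) \<Longrightarrow>
       A (\<lambda>w. \<Sum>k<n. c k * F k w) i = (\<Sum>k<n. c k * A (F k) i)"
    "\<And>f m. f \<in> bop (subsp s W) scalars \<Longrightarrow> (\<And>w. w \<in> W \<Longrightarrow> norm (f w) \<le> m * norm w) \<Longrightarrow> m \<ge> 0 \<Longrightarrow>
       (\<Sum>i. norm (A f i)) \<le> C * m"
    "\<And>f N w. f \<in> bop (subsp s W) scalars \<Longrightarrow> w \<in> W \<Longrightarrow>
       norm (f w - (\<Sum>i<N. A f i * \<phi> i w)) \<le> D * (\<Sum>i. norm (A f (i + N))) * norm w"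
proof -
  interpret normed_scale s by (rule s)
  let ?E = "dual_space (subsp s W)"
  define Wd where "Wd = bop (subsp s W) (scalars :: ('k, 'k) nspace)"
  have cE: "carr ?E = Wd" by (simp add: dual_space_def Wd_def)
  have sE: "smult ?E c f = (\<lambda>x. c * f x)" for c f by (simp add: dual_space_def)
  obtain A where A: "A \<in> bop ?E (ell1 :: ('k, nat \<Rightarrow> 'k) nspace)" "bij_betw A Wd (carr ell1)"
    and "\<exists>c>0. \<forall>f\<in>Wd. c * nrm ?E f \<le> nrm ell1 (A f)"
    using iso unfolding isomorphic_def cE by blast
  then obtain c where c: "c > 0" "\<And>f. f \<in> Wd \<Longrightarrow> c * nrm ?E f \<le> nrm ell1 (A f)" by blast
  have Aadd: "A (f + g) = A f + A g" if "f \<in> Wd" "g \<in> Wd" for f g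
    using A(1) that unfolding bop_def cE by blast
  have Ascale: "A (\<lambda>x. r * f x) = (\<lambda>i. r * A f i)" if "f \<in> Wd" for f r
    using A(1) that unfolding bop_def cE sE by (simp add: ell1_def)
  have Asum: "summable (\<lambda>i. norm (A f i))" if "f \<in> Wd" for f
    using A(1) that unfolding bop_def cE by (auto simp: ell1_def)
  obtain C0 where C0: "\<And>f. f \<in> Wd \<Longrightarrow> nrm ell1 (A f) \<le> C0 * nrm ?E f"
    using A(1) unfolding bop_def cE by blast
  have ne: "nrm ell1 a = (\<Sum>i. norm (a i))" for a :: "nat \<Rightarrow> 'k" by (simp add: ell1_def)
  have Wd_plus: "f + g \<in> Wd" if "f \<in> Wd" "g \<in> Wd" for f g
    using plus_bop[OF _ _ normed_scale_mult vector_space_over_itself.subspace_UNIV] that unfolding Wd_def scalars_eq_subsp .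
  have Wd_scale: "(\<lambda>x. r * f x) \<in> Wd" if "f \<in> Wd" for f r
    using scale_bop[OF _ normed_scale_mult vector_space_over_itself.subspace_UNIV] that unfolding Wd_def scalars_eq_subsp .
  have Wd_zero: "(\<lambda>x. 0) \<in> Wd"
    using zero_bop[OF normed_scale_mult UNIV_I] unfolding Wd_def scalars_eq_subsp zero_fun_def .
  define e :: "nat \<Rightarrow> nat \<Rightarrow> 'k" where "e i j = (if j = i then 1 else 0)" for i j
  have e_sums: "(\<lambda>j. norm (e i j)) sums 1" for i
    using sums_single[of i "\<lambda>_. 1 :: real"] by (simp add: e_def if_distrib cong: if_cong)
  define \<phi> where "\<phi> i = inv_into Wd A (e i)" for i
  have \<phi>: "\<phi> i \<in> Wd" "A (\<phi> i) = e i" for i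
  proof -
    have "e i \<in> A ` Wd" using A(2) sums_summable[OF e_sums] by (auto simp: bij_betw_def ell1_def)
    then show "\<phi> i \<in> Wd" "A (\<phi> i) = e i" by (auto simp: \<phi>_def inv_into_into f_inv_into_f)
  qed
  have n\<phi>: "nrm ?E (\<phi> i) \<le> 1 / c" for i
    using c(2)[OF \<phi>(1)[of i]] c(1) sums_unique[OF e_sums, of i] by (simp add: \<phi>(2) ne field_simps)
  have Alin: "(\<lambda>w. \<Sum>k<n. r k * F k w) \<in> Wd \<and> A (\<lambda>w. \<Sum>k<n. r k * F k w) = (\<lambda>i. \<Sum>k<n. r k * A (F k) i)"
    if F: "\<And>k. F k \<in> Wd" for F r and n :: nat
  proof (induction n)
    case 0
    show ?case using Ascale[OF Wd_zero, of 0] Wd_zero by simp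
  next
    case (Suc n)
    have eq: "(\<lambda>w. \<Sum>k<Suc n. r k * F k w) = (\<lambda>w. \<Sum>k<n. r k * F k w) + (\<lambda>w. r n * F n w)" by auto
    have IH: "(\<lambda>w. \<Sum>k<n. r k * F k w) \<in> Wd" "A (\<lambda>w. \<Sum>k<n. r k * F k w) = (\<lambda>i. \<Sum>k<n. r k * A (F k) i)"
      using Suc by auto
    show ?case
      unfolding eq Aadd[OF IH(1) Wd_scale[OF F]] IH(2) Ascale[OF F]
      by (intro conjI Wd_plus[OF IH(1) Wd_scale[OF F]]) auto
  qed
  show ?thesis
  \<comment> \<open>\<open>1 / c\<close> comes from the lower bound of the isomorphism;
    \<open>\<bar>C0\<bar> + 1\<close> is a positive substitute for its upper bound.\<close>
  proof (rule that[of "1 / c" "\<bar>C0\<bar> + 1" \<phi> A])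
    show "\<phi> i \<in> bop (subsp s W) scalars" for i using \<phi>(1) by (simp add: Wd_def)
    show "norm (\<phi> i w) \<le> 1 / c * norm w" if "w \<in> W" for i w
      by (rule order_trans[OF dual_norm_bound[OF _ s W that]])
        (use \<phi>(1) in \<open>auto simp: Wd_def intro: mult_right_mono[OF n\<phi>, of "norm w", simplified]\<close>)
    show "summable (\<lambda>i. norm (A f i))" if "f \<in> bop (subsp s W) scalars" for f
      using Asum that by (simp add: Wd_def)
    show "A (\<lambda>w. \<Sum>k<n. r k * F k w) i = (\<Sum>k<n. r k * A (F k) i)"
      if "\<And>k. F k \<in> bop (subsp s W) scalars" for F r i and n :: nat
      using Alin[of F r n] that by (simp add: Wd_def)
    show "(\<Sum>i. norm (A f i)) \<le> (\<bar>C0\<bar> + 1) * m"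
      if f: "f \<in> bop (subsp s W) scalars" and m: "\<And>w. w \<in> W \<Longrightarrow> norm (f w) \<le> m * norm w" "m \<ge> 0" for f m
    proof -
      have "(\<Sum>i. norm (A f i)) \<le> C0 * nrm ?E f" using C0[of f] f by (simp add: ne Wd_def)
      also have "\<dots> \<le> (\<bar>C0\<bar> + 1) * nrm ?E f"
        by (intro mult_right_mono dual_norm_nonneg[OF f s W]) simp
      also have "\<dots> \<le> (\<bar>C0\<bar> + 1) * m" by (intro mult_left_mono dual_norm_le[OF s W m]) auto
      finally show ?thesis .
    qed
    show "norm (f w - (\<Sum>i<N. A f i * \<phi> i w)) \<le> 1 / c * (\<Sum>i. norm (A f (i + N))) * norm w"
      if f: "f \<in> bop (subsp s W) scalars" and w: "w \<in> W" for f N w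
    proof -
      define g where "g = f + (\<lambda>w. (-1) * (\<Sum>i<N. A f i * \<phi> i w))"
      have fW: "f \<in> Wd" using f by (simp add: Wd_def)
      note lin = Alin[of \<phi> "A f" N, OF \<phi>(1)]
      have g: "g \<in> Wd" unfolding g_def using Alin[of \<phi> "A f" N] \<phi>(1) by (intro Wd_plus Wd_scale fW) blast
      have "A g j = (if j < N then 0 else A f j)" for j
      proof -
        have "A g = A f + (\<lambda>j. (-1) * (\<Sum>i<N. A f i * e i j))"
          unfolding g_def Aadd[OF fW Wd_scale[OF conjunct1[OF lin]]] Ascale[OF conjunct1[OF lin]]
            conjunct2[OF lin] \<phi>(2) by (rule refl)
        moreover have "(\<Sum>i<N. A f i * e i j) = (if j < N then A f j else 0)"
          by (simp add: e_def if_distrib cong: if_cong)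
        ultimately show ?thesis by simp
      qed
      then have "(\<Sum>j. norm (A g j)) = (\<Sum>j. norm (A f (j + N)))"
        using suminf_split_initial_segment[OF Asum[OF g], of N] by simp
      then have "nrm ?E g \<le> 1 / c * (\<Sum>j. norm (A f (j + N)))"
        using c(2)[OF g] c(1) by (simp add: ne field_simps)
      then have "nrm ?E g * norm w \<le> 1 / c * (\<Sum>j. norm (A f (j + N))) * norm w"
        by (rule mult_right_mono) simp
      moreover have "norm (g w) \<le> nrm ?E g * norm w"
        using g by (intro dual_norm_bound[OF _ s W w]) (simp add: Wd_def)
      moreover have "g w = f w - (\<Sum>i<N. A f i * \<phi> i w)" by (simp add: g_def)
      ultimately show ?thesis by simp
    qed
  qed (use c in auto)
qed

context schauder
begin

text \<open>The projections are uniformly bounded and converge pointwise to the identity, hence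
  uniformly on totally bounded sets.\<close>

lemma proj_compact_approx:
  assumes K: "K \<in> bop (subsp s U) (subsp sc V)" and s: "normed_scale s" and U: "module.subspace s U"
    and tb: "tot_bdd U (\<lambda>x. norm (K x))" and e: "e > 0"
  obtains n where "\<And>x. x \<in> U \<Longrightarrow> norm (K x - proj n (K x)) \<le> e * norm x"
proof -
  interpret s: normed_scale s by (rule s)
  obtain C where C: "C > 0" "\<And>n x. norm (proj n x) \<le> C * norm x" by (rule proj_bounded) blast
  have ns: "normed_scale sc" by unfold_locales
  \<comment> \<open>Chosen so that passing to a net point costs \<open>(C + 1) * d = e / 2\<close>;
    the projection error at the net point is the other half.\<close>
  define d where "d = e / (2 * (C + 1))"
  have d: "d > 0" using e C by (simp add: d_def)
  obtain F where F: "finite F" "F \<subseteq> {x\<in>U. norm x \<le> 1}"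
    "\<And>x. x \<in> U \<Longrightarrow> norm x \<le> 1 \<Longrightarrow> \<exists>y\<in>F. norm (K (x - y)) < d"
    using tot_bddE[OF tb d] by auto
  have "eventually (\<lambda>n. \<forall>y\<in>F. dist (proj n (K y)) (K y) < e / 2) sequentially"
    using e by (intro eventually_ball_finite F(1) ballI tendstoD proj_LIMSEQ) auto
  then obtain n where n: "\<And>y. y \<in> F \<Longrightarrow> norm (K y - proj n (K y)) < e / 2"
    by (auto simp: eventually_sequentially dist_norm norm_minus_commute)
  have ball: "norm (K x - proj n (K x)) \<le> e" if x: "x \<in> U" "norm x \<le> 1" for x
  proof -
    obtain y where y: "y \<in> F" "norm (K (x - y)) < d" using F(3) x by blast
    have yU: "y \<in> U" using y F by auto
    have "K x - proj n (K x) = (K (x - y) - proj n (K (x - y))) + (K y - proj n (K y))"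
      using bop_diff[OF K s U x(1) yU] by (simp add: proj_diff)
    then have "norm (K x - proj n (K x)) \<le> norm (K (x - y)) + norm (proj n (K (x - y))) + norm (K y - proj n (K y))"
      using norm_triangle_ineq[of "K (x - y) - proj n (K (x - y))" "K y - proj n (K y)"]
        norm_triangle_ineq4[of "K (x - y)" "proj n (K (x - y))"] by simp
    also have "\<dots> \<le> (C + 1) * norm (K (x - y)) + e / 2"
      using C(2)[of n "K (x - y)"] n[OF y(1)] by (simp add: algebra_simps)
    also have "(C + 1) * norm (K (x - y)) \<le> (C + 1) * d" using y C by (intro mult_left_mono) auto
    also have "(C + 1) * d = e / 2" using C(1) by (simp add: d_def field_simps)
    finally show ?thesis by simp
  qed
  have "norm (K x - proj n (K x)) \<le> e * norm x" if "x \<in> U" for x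
  proof (cases "x = 0")
    case True
    then show ?thesis using proj_scale[of n 0 0] by (simp add: bop_zero[OF K])
  next
    case False
    have "norm (K ((1 / norm x) *\<^sub>R x) - proj n (K ((1 / norm x) *\<^sub>R x))) \<le> e"
      using False that by (intro ball s.subspace_scaleR[OF U]) auto
    moreover have "K ((1 / norm x) *\<^sub>R x) - proj n (K ((1 / norm x) *\<^sub>R x)) = (1 / norm x) *\<^sub>R (K x - proj n (K x))"
      by (simp add: bop_scaleR[OF K s ns that] proj_scaleR scaleR_diff_right)
    ultimately show ?thesis using False by (simp add: divide_le_eq)
  qed
  then show ?thesis using that by blast
qed

end

context schauder
begin

text \<open>With \<open>W\<^sup>*\<close> isomorphic to \<open>\<ell>\<^sub>1\<close> via functionals \<open>\<phi>\<^sub>i\<close>, the coefficient functionals of \<open>W\<close> are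
  nearly combinations of \<open>\<phi>\<^sub>0, \<dots>, \<phi>\<^sub>N\<close>; extending the functionals \<open>\<phi>\<^sub>i \<circ> K\<close> by Hahn-Banach and
  reassembling gives an approximate extension of \<open>K\<close> whose norm is controlled by that of \<open>K\<close>,
  because the span of the \<open>\<phi>\<^sub>i\<close> carries an \<open>\<ell>\<^sub>1\<close>-norm.\<close>

lemma approximate_compact_extension:
  assumes W: "subspace W" "\<And>k. k \<in> I \<Longrightarrow> b k \<in> W" "\<And>k w. w \<in> W \<Longrightarrow> k \<notin> I \<Longrightarrow> coef w k = 0"
    and iso: "isomorphic (dual_space (subsp sc W)) (ell1 :: ('k, nat \<Rightarrow> 'k) nspace)"
    and Y: "subspace Y"
  obtains L where "L > 0"
    "\<forall>K M e. K \<in> bop (subsp sc Y) (subsp sc W) \<and> tot_bdd Y (\<lambda>y. norm (K y)) \<and>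
      (\<forall>y\<in>Y. norm (K y) \<le> M * norm y) \<and> M > 0 \<and> e > 0 \<longrightarrow>
      (\<exists>G\<in>bop (subsp sc UNIV) (subsp sc W). tot_bdd UNIV (\<lambda>x. norm (G x)) \<and>
        (\<forall>x. norm (G x) \<le> L * M * norm x) \<and> (\<forall>y\<in>Y. norm (K y - G y) \<le> e * norm y))"
proof -
  have ns: "normed_scale sc" by unfold_locales
  obtain Cb where Cb: "Cb > 0" "\<And>n x. norm (proj n x) \<le> Cb * norm x" by (rule proj_bounded) blast
  obtain \<phi> :: "nat \<Rightarrow> 'a \<Rightarrow> 'k" and A :: "('a \<Rightarrow> 'k) \<Rightarrow> nat \<Rightarrow> 'k" and D C :: real
    where DC: "D > 0" "C > 0" and \<phi>: "\<And>i. \<phi> i \<in> bop (subsp sc W) scalars"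
      and n\<phi>: "\<And>i w. w \<in> W \<Longrightarrow> norm (\<phi> i w) \<le> D * norm w"
      and Asm: "\<And>f. f \<in> bop (subsp sc W) scalars \<Longrightarrow> summable (\<lambda>i. norm (A f i))"
      and Alin: "\<And>F c (n :: nat) i. (\<And>k. F k \<in> bop (subsp sc W) scalars) \<Longrightarrow>
        A (\<lambda>w. \<Sum>k<n. c k * F k w) i = (\<Sum>k<n. c k * A (F k) i)"
      and Abd: "\<And>f m. f \<in> bop (subsp sc W) scalars \<Longrightarrow> (\<And>w. w \<in> W \<Longrightarrow> norm (f w) \<le> m * norm w) \<Longrightarrow> m \<ge> 0 \<Longrightarrow>
        (\<Sum>i. norm (A f i)) \<le> C * m"
      and Atail: "\<And>f N w. f \<in> bop (subsp sc W) scalars \<Longrightarrow> w \<in> W \<Longrightarrow>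
        norm (f w - (\<Sum>i<N. A f i * \<phi> i w)) \<le> D * (\<Sum>i. norm (A f (i + N))) * norm w"
    by (rule dual_ell1_representation[OF iso ns W(1)]) blast
  \<comment> \<open>Basis vectors with index outside \<open>I\<close> are replaced by 0. On
    \<open>W\<close> this changes nothing, since those coefficients vanish there, and it keeps all
    combinations inside \<open>W\<close>.\<close>
  define \<beta> where "\<beta> k = (if k \<in> I then b k else 0)" for k
  have \<beta>W: "\<beta> k \<in> W" for k using W(2) subspace_0[OF W(1)] by (simp add: \<beta>_def)
  have projW: "proj n w = (\<Sum>k<n. sc (coef w k) (\<beta> k))" if "w \<in> W" for w n
    unfolding proj_def using W(3)[OF that] by (intro sum.cong) (auto simp: \<beta>_def)
  define f where "f k w = (if w \<in> W then coef w k else 0)" for k w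
  have f: "f k \<in> bop (subsp sc W) scalars" for k
  proof -
    have "(\<lambda>w. coef w k) \<circ> incl W \<in> bop (subsp sc W) (subsp (*) UNIV)"
      by (rule bop_comp[OF coef_bop incl_bop[OF ns W(1) subset_UNIV]])
    also have "(\<lambda>w. coef w k) \<circ> incl W = f k"
      using coef_scale[of 0 0 k] by (auto simp: fun_eq_iff f_def incl_def)
    finally show ?thesis by (simp add: scalars_eq_subsp)
  qed
  \<comment> \<open>The factor 4 collects a 2 from extending \<open>\<phi> i \<circ> K\<close> and a
    2 from the norming functional. The constant is independent of \<open>K\<close>, \<open>M\<close>
    and \<open>e\<close>, and also of the cut-offs \<open>n\<close> and \<open>N\<close>; the
    iteration in \<open>compact_extension\<close> depends on this.\<close>
  define L where "L = 4 * C * Cb * D"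
  have main: "\<exists>G\<in>bop (subsp sc UNIV) (subsp sc W). tot_bdd UNIV (\<lambda>x. norm (G x)) \<and>
        (\<forall>x. norm (G x) \<le> L * M * norm x) \<and> (\<forall>y\<in>Y. norm (K y - G y) \<le> e * norm y)"
    if K: "K \<in> bop (subsp sc Y) (subsp sc W)" and tb: "tot_bdd Y (\<lambda>y. norm (K y))"
      and KM': "\<forall>y\<in>Y. norm (K y) \<le> M * norm y" and M: "M > 0" and e: "e > 0" for K M e
  proof -
    have KM: "norm (K y) \<le> M * norm y" if "y \<in> Y" for y using KM' that by blast
    obtain n where n: "\<And>y. y \<in> Y \<Longrightarrow> norm (K y - proj n (K y)) \<le> e / 2 * norm y"
      using proj_compact_approx[OF K ns Y tb, of "e / 2"] e by auto
    \<comment> \<open>Each of the \<open>n\<close> coefficient functionals may cost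
      \<open>\<delta> * norm y\<close>; together they stay within half of \<open>e\<close>.\<close>
    define \<delta> where "\<delta> = e / (2 * (real n + 1))"
    have \<delta>: "\<delta> > 0" using e by (simp add: \<delta>_def)
    have tail: "(\<lambda>N. D * (\<Sum>i. norm (A (f k) (i + N))) * M * norm (\<beta> k)) \<longlonglongrightarrow> 0" for k
    proof -
      have "(\<lambda>N. \<Sum>i. norm (A (f k) (i + N))) \<longlonglongrightarrow> 0" by (rule suminf_exist_split2[OF Asm[OF f]])
      then have "(\<lambda>N. D * (\<Sum>i. norm (A (f k) (i + N))) * M * norm (\<beta> k)) \<longlonglongrightarrow> D * 0 * M * norm (\<beta> k)"
        by (intro tendsto_intros)
      then show ?thesis by simp
    qed
    have "eventually (\<lambda>N. \<forall>k\<in>{..<n}. D * (\<Sum>i. norm (A (f k) (i + N))) * M * norm (\<beta> k) < \<delta>) sequentially"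
      by (intro eventually_ball_finite ballI order_tendstoD(2)[OF tail \<delta>]) simp
    then obtain N where N: "\<And>k. k < n \<Longrightarrow> D * (\<Sum>i. norm (A (f k) (i + N))) * M * norm (\<beta> k) < \<delta>"
      by (auto simp: eventually_sequentially)
    have "\<exists>g. (\<forall>x y. g (x + y) = g x + g y) \<and> (\<forall>c x. g (sc c x) = c * g x) \<and>
        (\<forall>x. norm (g x) \<le> 2 * (D * M) * norm x) \<and> (\<forall>y\<in>Y. g y = \<phi> i (K y))" for i
    proof -
      have \<phi>K: "\<phi> i \<circ> K \<in> bop (subsp sc Y) (subsp (*) UNIV)"
        using bop_comp[OF \<phi>[unfolded scalars_eq_subsp] K] .
      have "norm (\<phi> i (K y)) \<le> D * M * norm y" if "y \<in> Y" for y
        using order_trans[OF n\<phi>[OF bop_mem[OF K that], of i] mult_left_mono[OF KM[OF that], of D]] DC by (simp add: mult.assoc)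
      then show ?thesis
        using Hahn_Banach[OF Y, of "\<lambda>y. \<phi> i (K y)" "D * M"] bop_add[OF \<phi>K] bop_scale[OF \<phi>K] DC M
        by (smt (verit) comp_apply mult_pos_pos)
    qed
    then obtain \<psi> where \<psi>: "\<And>i x y. \<psi> i (x + y) = \<psi> i x + \<psi> i y" "\<And>i c x. \<psi> i (sc c x) = c * \<psi> i x"
      "\<And>i x. norm (\<psi> i x) \<le> 2 * (D * M) * norm x" "\<And>i y. y \<in> Y \<Longrightarrow> \<psi> i y = \<phi> i (K y)" by metis
    \<comment> \<open>Replace \<open>f k\<close> by its partial sum of
      \<open>A (f k) i * \<phi> i\<close> in \<open>proj n (K y)\<close> and exchange the sums: the
      factor \<open>\<phi> i (K y)\<close> is left with the vector \<open>u i\<close>.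
      \<open>G\<close> puts the extension \<open>\<psi> i\<close> in place of that factor.\<close>
    define u where "u i = (\<Sum>k<n. sc (A (f k) i) (\<beta> k))" for i
    have uW: "u i \<in> W" for i unfolding u_def by (intro subspace_sum[OF W(1)] subspace_scale[OF W(1)] \<beta>W)
    define G where "G x = (\<Sum>i<N. sc (\<psi> i x) (u i))" for x
    have GM: "norm (G x) \<le> L * M * norm x" for x
    proof (cases "G x = 0")
      case True
      then show ?thesis using DC Cb M by (simp add: L_def)
    next
      case False
      obtain h where h: "\<And>x y. h (x + y) = h x + h y" "\<And>c x. h (sc c x) = c * h x"
        "\<And>x. norm (h x) \<le> 2 * norm x" "h (G x) = of_real (norm (G x))"
        by (rule norming_functional[OF False]) blast
      have h0: "h 0 = 0" using h(2)[of 0 0] by simp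
      have hsum: "h (\<Sum>i\<in>J. v i) = (\<Sum>i\<in>J. h (v i))" for v and J :: "nat set"
        by (induction J rule: infinite_finite_induct) (auto simp: h0 h(1))
      \<comment> \<open>On \<open>W\<close> the functional \<open>F\<close> is
        \<open>h \<circ> proj n\<close>, so its bound does not depend on \<open>n\<close>. Its
        coordinates are the values \<open>h (u i)\<close>, whose absolute sum is therefore bounded
        independently of \<open>n\<close> and \<open>N\<close>.\<close>
      define F where "F w = (\<Sum>k<n. h (\<beta> k) * f k w)" for w
      have FM: "norm (F w) \<le> 2 * Cb * norm w" if "w \<in> W" for w
      proof -
        have "F w = h (proj n w)" using that by (simp add: F_def f_def projW hsum h(2) mult.commute)
        then show ?thesis using h(3)[of "proj n w"] Cb(2)[of n w] by simp
      qed
      then have F: "F \<in> bop (subsp sc W) scalars"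
        unfolding scalars_eq_subsp
        by (intro bopI[where C = "2 * Cb"]) (auto simp: F_def f_def coef_add coef_scale subspace_add[OF W(1)]
            subspace_scale[OF W(1)] distrib_left sum.distrib sum_distrib_left mult.left_commute)
      have hu: "h (u i) = A F i" for i
      proof -
        have "A F i = (\<Sum>k<n. h (\<beta> k) * A (f k) i)" unfolding F_def by (rule Alin[OF f])
        then show ?thesis by (simp add: u_def hsum h(2) mult.commute)
      qed
      have "norm (G x) = norm (h (G x))" by (simp add: h(4))
      also have "h (G x) = (\<Sum>i<N. \<psi> i x * A F i)" by (simp add: G_def hsum h(2) hu)
      also have "norm \<dots> \<le> (\<Sum>i<N. 2 * (D * M) * norm x * norm (A F i))"
        by (rule sum_norm_le) (simp add: norm_mult mult_right_mono[OF \<psi>(3)])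
      also have "\<dots> = 2 * (D * M) * norm x * (\<Sum>i<N. norm (A F i))" by (simp add: sum_distrib_left)
      also have "\<dots> \<le> 2 * (D * M) * norm x * (C * (2 * Cb))"
      proof (rule mult_left_mono)
        have "(\<Sum>i<N. norm (A F i)) \<le> (\<Sum>i. norm (A F i))" by (rule sum_le_suminf[OF Asm[OF F]]) auto
        also have "\<dots> \<le> C * (2 * Cb)" using Cb by (intro Abd[OF F FM]) auto
        finally show "(\<Sum>i<N. norm (A F i)) \<le> C * (2 * Cb)" .
      qed (use DC M in simp)
      finally show ?thesis by (simp add: L_def mult_ac)
    qed
    have G: "G \<in> bop (subsp sc UNIV) (subsp sc W)"
    proof (rule bopI[where C = "L * M"])
      show "G x \<in> W" for x unfolding G_def by (intro subspace_sum[OF W(1)] subspace_scale[OF W(1)] uW)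
      show "G (x + y) = G x + G y" for x y by (simp add: G_def \<psi>(1) scale_left_distrib sum.distrib)
      show "G (sc c x) = sc c (G x)" for c x by (simp add: G_def \<psi>(2) scale_sum_right)
    qed (auto simp: GM)
    have \<psi>b: "\<psi> i \<in> bop (subsp sc UNIV) (subsp (*) UNIV)" for i
      by (rule bopI[OF _ _ _ _ \<psi>(3)]) (auto simp: \<psi>)
    have "tot_bdd UNIV (\<lambda>x. \<Sum>i<N. norm (\<psi> i x))"
      by (intro tot_bdd_sum tot_bdd_functional[OF \<psi>b ns subspace_UNIV]) auto
    then have "tot_bdd UNIV (\<lambda>x. norm (G x))"
    proof (rule tot_bdd_mono[OF _ seminorm_on_norm_bop[OF G ns ns subspace_UNIV]])
      fix x
      have "norm (G x) \<le> (\<Sum>i<N. norm (\<psi> i x) * norm (u i))"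
        unfolding G_def by (rule sum_norm_le) (simp add: norm_scale)
      also have "\<dots> \<le> (\<Sum>i<N. norm (\<psi> i x) * (\<Sum>j<N. norm (u j)))"
        by (intro sum_mono mult_left_mono member_le_sum) auto
      also have "\<dots> = (\<Sum>i<N. norm (\<psi> i x)) * (\<Sum>j<N. norm (u j))" by (simp add: sum_distrib_right)
      finally show "norm (G x) \<le> (\<Sum>j<N. norm (u j)) * (\<Sum>i<N. norm (\<psi> i x))" by (simp add: mult.commute)
    qed auto
    moreover have "norm (K y - G y) \<le> e * norm y" if y: "y \<in> Y" for y
    proof -
      have KW: "K y \<in> W" by (rule bop_mem[OF K y])
      have "G y = (\<Sum>i<N. \<Sum>k<n. sc (A (f k) i * \<phi> i (K y)) (\<beta> k))"
        by (simp add: G_def u_def \<psi>(4)[OF y] scale_sum_right mult.commute)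
      also have "\<dots> = (\<Sum>k<n. sc (\<Sum>i<N. A (f k) i * \<phi> i (K y)) (\<beta> k))"
        by (subst sum.swap) (simp add: scale_sum_left)
      finally have "proj n (K y) - G y = (\<Sum>k<n. sc (f k (K y) - (\<Sum>i<N. A (f k) i * \<phi> i (K y))) (\<beta> k))"
        using KW by (simp add: projW f_def scale_left_diff_distrib sum_subtractf)
      also have "norm \<dots> \<le> (\<Sum>k<n. \<delta> * norm y)"
      proof (rule sum_norm_le)
        fix k assume k: "k \<in> {..<n}"
        have pos: "D * (\<Sum>i. norm (A (f k) (i + N))) \<ge> 0"
          using DC by (intro mult_nonneg_nonneg suminf_nonneg summable_ignore_initial_segment[OF Asm[OF f]]) auto
        have "norm (sc (f k (K y) - (\<Sum>i<N. A (f k) i * \<phi> i (K y))) (\<beta> k))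
            \<le> D * (\<Sum>i. norm (A (f k) (i + N))) * norm (K y) * norm (\<beta> k)"
          unfolding norm_scale by (intro mult_right_mono Atail[OF f KW]) simp
        also have "\<dots> \<le> D * (\<Sum>i. norm (A (f k) (i + N))) * (M * norm y) * norm (\<beta> k)"
          by (intro mult_right_mono mult_left_mono KM[OF y] pos) simp
        also have "\<dots> = D * (\<Sum>i. norm (A (f k) (i + N))) * M * norm (\<beta> k) * norm y" by (simp add: mult_ac)
        also have "\<dots> \<le> \<delta> * norm y" using N[of k] k by (intro mult_right_mono) auto
        finally show "norm (sc (f k (K y) - (\<Sum>i<N. A (f k) i * \<phi> i (K y))) (\<beta> k)) \<le> \<delta> * norm y" .
      qed
      also have "\<dots> = real n * \<delta> * norm y" by simp
      also have "\<dots> \<le> e / 2 * norm y" using e by (intro mult_right_mono) (auto simp: \<delta>_def field_simps)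
      finally have "norm (proj n (K y) - G y) \<le> e / 2 * norm y" .
      then show ?thesis using n[OF y] norm_triangle_ineq[of "K y - proj n (K y)" "proj n (K y) - G y"] by simp
    qed
    ultimately show ?thesis using G GM by blast
  qed
  have "L > 0" using DC Cb by (simp add: L_def)
  then show ?thesis by (rule that) (use main in blast)
qed

text \<open>The approximate extension is iterated: \<open>H j\<close> is the error left on
  \<open>Y\<close> after \<open>j\<close> steps, bounded by \<open>M / 2 ^ j\<close>, and
  \<open>G j\<close> extends it up to half that bound. As the extension constant is the same at each
  step, the \<open>G j\<close> are summable and their sum extends \<open>K\<close>.\<close>

theorem compact_extension:
  assumes W: "subspace W" "closed W" "\<And>k. k \<in> I \<Longrightarrow> b k \<in> W" "\<And>k w. w \<in> W \<Longrightarrow> k \<notin> I \<Longrightarrow> coef w k = 0"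
    and iso: "isomorphic (dual_space (subsp sc W)) (ell1 :: ('k, nat \<Rightarrow> 'k) nspace)"
    and Y: "subspace Y"
    and K: "K \<in> bop (subsp sc Y) (subsp sc W)" "tot_bdd Y (\<lambda>y. norm (K y))"
  obtains G where "G \<in> bop (subsp sc UNIV) (subsp sc W)" "\<And>y. y \<in> Y \<Longrightarrow> G y = K y"
proof -
  have ns: "normed_scale sc" by unfold_locales
  obtain L where L: "L > 0" and appr:
    "\<forall>K M e. K \<in> bop (subsp sc Y) (subsp sc W) \<and> tot_bdd Y (\<lambda>y. norm (K y)) \<and>
      (\<forall>y\<in>Y. norm (K y) \<le> M * norm y) \<and> M > 0 \<and> e > 0 \<longrightarrow>
      (\<exists>G\<in>bop (subsp sc UNIV) (subsp sc W). tot_bdd UNIV (\<lambda>x. norm (G x)) \<and>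
        (\<forall>x. norm (G x) \<le> L * M * norm x) \<and> (\<forall>y\<in>Y. norm (K y - G y) \<le> e * norm y))"
    by (rule approximate_compact_extension[OF W(1,3,4) iso Y])
  obtain M where M: "M > 0" "\<And>y. y \<in> Y \<Longrightarrow> norm (K y) \<le> M * norm y" by (rule bop_bound[OF K(1)]) blast
  define t :: "nat \<Rightarrow> real" where "t j = M * (1/2) ^ j" for j
  have t: "t j > 0" for j using M by (simp add: t_def)
  define P where "P j H \<longleftrightarrow> H \<in> bop (subsp sc Y) (subsp sc W) \<and> tot_bdd Y (\<lambda>y. norm (H y))
      \<and> (\<forall>y\<in>Y. norm (H y) \<le> t j * norm y)" for j H
  define Q where "Q j H H' \<longleftrightarrow> (\<exists>G\<in>bop (subsp sc UNIV) (subsp sc W).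
      (\<forall>x. norm (G x) \<le> L * t j * norm x) \<and> (\<forall>y\<in>Y. H' y = H y - G y))" for j H H'
  \<comment> \<open>The clause for \<open>j = 0\<close> makes the dependent choice start at
    \<open>K\<close>.\<close>
  have "\<exists>H. \<forall>j. (P j (H j) \<and> (j = 0 \<longrightarrow> H j = K)) \<and> Q j (H j) (H (Suc j))"
  proof (rule dependent_nat_choice)
    show "\<exists>H. P 0 H \<and> (0 = (0::nat) \<longrightarrow> H = K)" using K M by (auto simp: P_def t_def)
    fix H j assume "P j H \<and> (j = 0 \<longrightarrow> H = K)"
    then have H: "H \<in> bop (subsp sc Y) (subsp sc W)" "tot_bdd Y (\<lambda>y. norm (H y))"
      "\<forall>y\<in>Y. norm (H y) \<le> t j * norm y" by (auto simp: P_def)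
    obtain G where G: "G \<in> bop (subsp sc UNIV) (subsp sc W)" "tot_bdd UNIV (\<lambda>x. norm (G x))"
      "\<And>x. norm (G x) \<le> L * t j * norm x" "\<And>y. y \<in> Y \<Longrightarrow> norm (H y - G y) \<le> t (Suc j) * norm y"
      using appr[rule_format, of H "t j" "t (Suc j)"] H t by blast
    define H' where "H' = H - (G \<circ> incl Y)"
    have H'y: "H' y = H y - G y" if "y \<in> Y" for y using that by (simp add: H'_def incl_def)
    have GY: "G \<circ> incl Y \<in> bop (subsp sc Y) (subsp sc W)"
      by (rule bop_comp[OF G(1) incl_bop[OF ns Y subset_UNIV]])
    have "tot_bdd Y (\<lambda>y. norm ((G \<circ> incl Y) y))"
      using tot_bdd_comp[OF G(2) incl_bop[OF ns Y subset_UNIV] ns ns Y subspace_UNIV] by simp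
    then have "tot_bdd Y (\<lambda>y. norm (H' y))"
      unfolding H'_def by (rule tot_bdd_minus[OF H(1) GY ns ns Y W(1) H(2)])
    moreover have "H' \<in> bop (subsp sc Y) (subsp sc W)"
      unfolding H'_def by (rule minus_bop[OF H(1) GY ns W(1)])
    ultimately have "P (Suc j) H'" using G(4) H'y by (simp add: P_def)
    moreover have "Q j H H'" unfolding Q_def using G H'y by blast
    ultimately show "\<exists>H'. (P (Suc j) H' \<and> (Suc j = 0 \<longrightarrow> H' = K)) \<and> Q j H H'" by blast
  qed
  then obtain H where H: "\<And>j. P j (H j)" "H 0 = K" "\<And>j. Q j (H j) (H (Suc j))" by blast
  then obtain G where G: "\<And>j. G j \<in> bop (subsp sc UNIV) (subsp sc W)"
    "\<And>j x. norm (G j x) \<le> L * t j * norm x" "\<And>j y. y \<in> Y \<Longrightarrow> H (Suc j) y = H j y - G j y"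
    unfolding Q_def by metis
  have tsums: "(\<lambda>j. L * t j * r) sums (L * (M * 2) * r)" for r
    unfolding t_def using sums_mult2[OF sums_mult[OF sums_mult[OF geometric_sums[of "1/2 :: real"], of M], of L], of r] by simp
  have smn: "summable (\<lambda>j. norm (G j x))" for x
    by (rule summable_comparison_test'[OF sums_summable[OF tsums], of 0]) (use G(2) in auto)
  have sm: "summable (\<lambda>j. G j x)" for x by (rule summable_norm_cancel[OF smn])
  define S where "S x = (\<Sum>j. G j x)" for x
  have "S \<in> bop (subsp sc UNIV) (subsp sc W)"
  proof (rule bopI[where C = "L * (M * 2)"])
    fix x y c
    have "(\<lambda>n. \<Sum>j<n. G j x) \<longlonglongrightarrow> S x" using summable_LIMSEQ[OF sm] by (simp add: S_def)
    moreover have "(\<Sum>j<n. G j x) \<in> W" for n by (intro subspace_sum[OF W(1)] bop_mem[OF G(1)]) simp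
    ultimately show "S x \<in> W" using closed_sequentially[OF W(2), of "\<lambda>n. \<Sum>j<n. G j x"] by blast
    show "S (x + y) = S x + S y"
      by (simp add: S_def bop_add[OF G(1)] suminf_add[OF sm sm])
    show "S (sc c x) = sc c (S x)"
      using bounded_linear.suminf[OF bounded_bilinear.bounded_linear_right[OF bounded_bilinear_sc] sm, of c x]
      by (simp add: S_def bop_scale[OF G(1)])
    have "norm (S x) \<le> (\<Sum>j. norm (G j x))" unfolding S_def by (rule summable_norm[OF smn])
    also have "\<dots> \<le> (\<Sum>j. L * t j * norm x)" by (rule suminf_le[OF G(2) smn sums_summable[OF tsums]])
    also have "\<dots> = L * (M * 2) * norm x" by (rule sums_unique[OF tsums, symmetric])
    finally show "norm (S x) \<le> L * (M * 2) * norm x" .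
  qed auto
  moreover have "S y = K y" if y: "y \<in> Y" for y
  proof -
    have part: "(\<Sum>j<n. G j y) = K y - H n y" for n
      by (induction n) (auto simp: H(2) G(3)[OF y])
    have "(\<lambda>n. t n * norm y) \<longlonglongrightarrow> 0"
      unfolding t_def using tendsto_mult_right[OF tendsto_mult_left[OF LIMSEQ_power_zero[of "1/2 :: real"], of M], of "norm y"] by simp
    then have "(\<lambda>n. H n y) \<longlonglongrightarrow> 0"
      by (rule Lim_null_comparison[rotated]) (use H(1) y in \<open>auto simp: P_def\<close>)
    then have "(\<lambda>n. K y - H n y) \<longlonglongrightarrow> K y - 0" by (intro tendsto_diff tendsto_const)
    then have "(\<lambda>j. G j y) sums K y" by (simp add: sums_def part)
    then show ?thesis by (simp add: S_def sums_iff)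
  qed
  ultimately show ?thesis using that by blast
qed

end

section \<open>Left ideals and finite-rank perturbations of the identity\<close>

lemma incl_bop_self: "normed_scale s \<Longrightarrow> module.subspace s U \<Longrightarrow> incl U \<in> bop (subsp s U) (subsp s U)"
  by (rule incl_bop) auto

lemma restrict_functional_bop:
  assumes s: "normed_scale s" and U: "module.subspace s U"
    and "\<And>x y. g (x + y) = g x + g y" "\<And>c x. g (s c x) = c * g x" "\<And>x. norm (g x) \<le> C * norm x"
  shows "(\<lambda>x. if x \<in> U then g x else 0) \<in> bop (subsp s U) (subsp (*) UNIV)"
proof -
  interpret normed_scale s by (rule s)
  show ?thesis
    by (rule bopI[where C = C]) (use assms(3-5) in \<open>auto simp: subspace_add[OF U] subspace_scale[OF U]\<close>)
qed

lemma rank_one_bop: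
  assumes g: "g \<in> bop (subsp s U) (subsp (*) UNIV)" and t: "normed_scale t" and V: "module.subspace t V" and e: "e \<in> V"
  shows "(\<lambda>x. t (g x) e) \<in> bop (subsp s U) (subsp t V)"
proof -
  interpret normed_scale t by (rule t)
  obtain C where C: "C > 0" "\<And>x. x \<in> U \<Longrightarrow> norm (g x) \<le> C * norm x" by (rule bop_bound[OF g]) blast
  show ?thesis
  proof (rule bopI[where C = "C * norm e"])
    show "norm (t (g x) e) \<le> C * norm e * norm x" if "x \<in> U" for x
      using mult_right_mono[OF C(2)[OF that], of "norm e"] by (simp add: norm_scale mult_ac)
  qed (auto simp: subspace_scale[OF V e] bop_outside[OF g] bop_add[OF g] bop_scale[OF g] scale_left_distrib)
qed

lemma tot_bdd_rank_one:
  assumes g: "g \<in> bop (subsp s U) (subsp (*) UNIV)" and s: "normed_scale s" and U: "module.subspace s U"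
    and t: "normed_scale t"
  shows "tot_bdd U (\<lambda>x. norm (t (g x) e))"
proof -
  interpret s: normed_scale s by (rule s)
  interpret t: normed_scale t by (rule t)
  show ?thesis
    by (rule tot_bdd_mono[where C = "norm e", OF tot_bdd_functional[OF g s U]
          seminorm_on_norm_bop[OF rank_one_bop[OF g t t.subspace_UNIV UNIV_I] s t U]])
      (auto simp: s.subspace_diff[OF U] t.norm_scale)
qed

lemma left_ideal_minus:
  assumes L: "left_ideal (subsp s U) L" and s: "normed_scale s" and "S \<in> L" "T \<in> L"
  shows "S - T \<in> L"
proof -
  interpret normed_scale s by (rule s)
  have "\<forall>c. \<forall>T\<in>L. (\<lambda>x. s c (T x)) \<in> L" using L by (simp add: left_ideal_def subsp_def)
  then have "(\<lambda>x. s (-1) (T x)) \<in> L" using assms(4) by blast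
  then have "S + (\<lambda>x. s (-1) (T x)) \<in> L" using L assms(3) by (simp add: left_ideal_def)
  also have "S + (\<lambda>x. s (-1) (T x)) = S - T" by (auto simp: fun_eq_iff)
  finally show ?thesis .
qed

text \<open>If \<open>T \<in> L\<close> does not vanish at a vector \<open>e\<close> of the range of \<open>F\<close>, then \<open>L\<close> contains a
  rank-one projection \<open>P\<close> onto \<open>e\<close>, and with \<open>I - F\<close> also \<open>I - (I - P) F (I - P)\<close>, whose finite-rank
  part has smaller rank.\<close>

lemma left_ideal_identity_of_finite_rank:
  assumes s: "normed_scale s" and U: "module.subspace s U" and L: "left_ideal (subsp s U) L"
    and nz: "\<And>x. x \<in> U \<Longrightarrow> x \<noteq> 0 \<Longrightarrow> \<exists>T\<in>L. T x \<noteq> 0"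
    and "finite J" "\<And>i. i \<in> J \<Longrightarrow> g i \<in> bop (subsp s U) (subsp (*) UNIV)" "\<And>i. i \<in> J \<Longrightarrow> e i \<in> U"
    and "(\<lambda>x. incl U x - (\<Sum>i\<in>J. s (g i x) (e i))) \<in> L"
  shows "incl U \<in> L"
  using assms(5-8)
proof (induction J arbitrary: g e rule: finite_induct)
  case empty
  then show ?case by simp
next
  case (insert j J)
  interpret normed_scale s by (rule s)
  let ?B = "bop (subsp s U) (subsp s U)"
  have Lcomp: "S \<circ> T \<in> L" if "S \<in> ?B" "T \<in> L" for S T using L that by (simp add: left_ideal_def)
  have Lplus: "S + T \<in> L" if "S \<in> L" "T \<in> L" for S T using L that by (simp add: left_ideal_def)
  have LB: "T \<in> ?B" if "T \<in> L" for T using L that by (auto simp: left_ideal_def)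
  note gj = insert.prems(1) and ej = insert.prems(2)
  show ?case
  proof (cases "e j = 0")
    case True
    then have "(\<lambda>x. incl U x - (\<Sum>i\<in>J. s (g i x) (e i))) \<in> L"
      using insert.prems(3) insert.hyps by simp
    then show ?thesis using insert.IH[of g e] gj ej by simp
  next
    case False
    then obtain T where T: "T \<in> L" "T (e j) \<noteq> 0" using nz ej by blast
    obtain h where h: "\<And>x y. h (x + y) = h x + h y" "\<And>c x. h (s c x) = c * h x"
      "\<And>x. norm (h x) \<le> 2 * norm x" "h (T (e j)) = of_real (norm (T (e j)))"
      by (rule norming_functional[OF T(2)]) blast
    \<comment> \<open>\<open>q\<close> is normalised so that \<open>q (T (e j)) = 1\<close>. The
      operator \<open>P\<close> below then fixes \<open>e j\<close>, and it lies in \<open>L\<close>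
      because \<open>T\<close> is its right-hand factor.\<close>
    define q where "q x = (if x \<in> U then inverse (h (T (e j))) * h x else 0)" for x
    have hne: "h (T (e j)) \<noteq> 0" using T(2) h(4) by simp
    have q: "q \<in> bop (subsp s U) (subsp (*) UNIV)"
      unfolding q_def
    proof (rule restrict_functional_bop[OF s U])
      show "norm (inverse (h (T (e j))) * h x) \<le> norm (inverse (h (T (e j)))) * 2 * norm x" for x
        using mult_left_mono[OF h(3)[of x], of "norm (inverse (h (T (e j))))"] by (simp add: norm_mult)
    qed (auto simp: h distrib_left)
    define P where "P = (\<lambda>x. s (q x) (e j)) \<circ> T"
    have PL: "P \<in> L" unfolding P_def by (rule Lcomp[OF rank_one_bop[OF q s U] T(1)]) (simp add: ej)
    have PB: "P \<in> ?B" by (rule LB[OF PL])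
    have Pj: "P (e j) = e j" using hne bop_mem[OF LB[OF T(1)], of "e j"] ej by (simp add: P_def q_def)
    define F where "F = (\<lambda>x. \<Sum>i\<in>insert j J. s (g i x) (e i))"
    have F: "F \<in> ?B"
    proof -
      have "incl U - (\<lambda>x. incl U x - F x) \<in> ?B"
        by (rule minus_bop[OF incl_bop_self[OF s U] LB s U]) (use insert.prems(3) in \<open>simp add: F_def\<close>)
      also have "incl U - (\<lambda>x. incl U x - F x) = F" by (simp add: fun_eq_iff)
      finally show ?thesis .
    qed
    have IF: "incl U - F \<in> L" using insert.prems(3) by (simp add: F_def fun_diff_def)
    define Q where "Q = incl U - P"
    have Q: "Q \<in> ?B" unfolding Q_def by (rule minus_bop[OF incl_bop_self[OF s U] PB s U])
    have Fdiff: "F (x - y) = F x - F y" if "x \<in> U" "y \<in> U" for x y by (rule bop_diff[OF F s U that])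
    \<comment> \<open>With \<open>Q = I - P\<close> this is
      \<open>I - F + F P = I - F Q\<close>.\<close>
    have "(incl U - F) + (F \<circ> P) \<in> L" by (intro Lplus IF Lcomp F PL)
    also have "(incl U - F) + (F \<circ> P) = incl U - (F \<circ> Q)"
    proof (rule ext)
      fix x show "((incl U - F) + (F \<circ> P)) x = (incl U - (F \<circ> Q)) x"
        using Fdiff[of x "P x"] bop_mem[OF PB, of x] bop_outside[OF F, of x] bop_outside[OF PB, of x]
        by (cases "x \<in> U") (auto simp: Q_def incl_def bop_zero[OF F])
    qed
    finally have L1: "incl U - (F \<circ> Q) \<in> L" .
    \<comment> \<open>This is \<open>I - F Q + P - P (I - F Q) = I - Q F Q\<close>.\<close>
    have "(incl U - (F \<circ> Q)) + (P - (P \<circ> (incl U - (F \<circ> Q)))) \<in> L"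
      by (intro Lplus L1 left_ideal_minus[OF L s] PL Lcomp PB)
    also have "(incl U - (F \<circ> Q)) + (P - (P \<circ> (incl U - (F \<circ> Q)))) = incl U - (Q \<circ> (F \<circ> Q))"
    proof (rule ext)
      fix x
      show "((incl U - (F \<circ> Q)) + (P - (P \<circ> (incl U - (F \<circ> Q))))) x = (incl U - (Q \<circ> (F \<circ> Q))) x"
      proof (cases "x \<in> U")
        case True
        have FQ: "F (Q x) \<in> U" by (intro bop_mem[OF F] bop_mem[OF Q] True)
        show ?thesis using True FQ bop_diff[OF PB s U True FQ] by (simp add: Q_def incl_def)
      next
        case False
        then show ?thesis
          by (simp add: bop_outside[OF Q] bop_outside[OF PB] bop_zero[OF F] bop_zero[OF Q] bop_zero[OF PB] incl_def)
      qed
    qed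
    also have "incl U - (Q \<circ> (F \<circ> Q)) = (\<lambda>x. incl U x - (\<Sum>i\<in>J. s ((g i \<circ> Q) x) (Q (e i))))"
    proof (rule ext)
      fix x
      have "Q (F (Q x)) = (\<Sum>i\<in>insert j J. Q (s (g i (Q x)) (e i)))"
        unfolding F_def by (rule bop_sum[OF Q s U]) (auto intro!: subspace_scale[OF U] simp: ej)
      also have "\<dots> = (\<Sum>i\<in>insert j J. s (g i (Q x)) (Q (e i)))"
        by (rule sum.cong[OF refl]) (rule bop_scale[OF Q], simp add: ej)
      \<comment> \<open>\<open>P\<close> fixes \<open>e j\<close>, so \<open>Q\<close> kills it and
        the sum loses the term for \<open>j\<close>.\<close>
      also have "Q (e j) = 0" using ej by (simp add: Q_def incl_def Pj)
      then have "(\<Sum>i\<in>insert j J. s (g i (Q x)) (Q (e i))) = (\<Sum>i\<in>J. s (g i (Q x)) (Q (e i)))"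
        using insert.hyps by simp
      finally show "(incl U - (Q \<circ> (F \<circ> Q))) x = incl U x - (\<Sum>i\<in>J. s ((g i \<circ> Q) x) (Q (e i)))" by simp
    qed
    finally have mem: "(\<lambda>x. incl U x - (\<Sum>i\<in>J. s ((g i \<circ> Q) x) (Q (e i)))) \<in> L" .
    have "g i \<circ> Q \<in> bop (subsp s U) (subsp (*) UNIV)" if "i \<in> J" for i
      by (rule bop_comp[OF gj Q]) (simp add: that)
    moreover have "Q (e i) \<in> U" if "i \<in> J" for i
      by (rule bop_mem[OF Q]) (simp add: ej that)
    ultimately show ?thesis by (rule insert.IH[OF _ _ mem])
  qed
qed

text \<open>The iterates of \<open>K\<close> decay geometrically, and applying their sum to
  \<open>x - K x\<close> telescopes. A left inverse is the right tool inside a left ideal, where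
  multiplication from the left is allowed.\<close>

lemma Neumann_left_inverse:
  fixes s :: "'k::real_or_complex \<Rightarrow> 'a::banach \<Rightarrow> 'a"
  assumes s: "normed_scale s" and U: "module.subspace s U" "closed U" and K: "K \<in> bop (subsp s U) (subsp s U)"
    and half: "\<And>x. x \<in> U \<Longrightarrow> norm (K x) \<le> 1 / 2 * norm x"
  obtains V where "V \<in> bop (subsp s U) (subsp s U)" "\<And>x. x \<in> U \<Longrightarrow> V (x - K x) = x"
proof -
  interpret normed_scale s by (rule s)
  define p where "p m x = (K ^^ m) x" for m x
  have pS: "p (Suc m) x = p m (K x)" "p (Suc m) x = K (p m x)" "p 0 x = x" for m x
    by (simp_all add: p_def funpow_swap1)
  have pU: "p m x \<in> U" if "x \<in> U" for m x by (induction m) (use that bop_mem[OF K] in \<open>auto simp: pS(2,3)\<close>)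
  have pn: "norm (p m x) \<le> (1/2) ^ m * norm x" if "x \<in> U" for m x
  proof (induction m)
    case (Suc m)
    then show ?case using half[OF pU[OF that, of m]] by (simp add: pS(2))
  qed (simp add: pS)
  have padd: "p m (x + y) = p m x + p m y" if "x \<in> U" "y \<in> U" for m x y
    by (induction m) (use that bop_add[OF K] pU in \<open>auto simp: pS(2,3)\<close>)
  have pscale: "p m (s c x) = s c (p m x)" if "x \<in> U" for m c x
    by (induction m) (use that bop_scale[OF K] pU in \<open>auto simp: pS(2,3)\<close>)
  have gs: "(\<lambda>m. (1/2) ^ m * r) sums (2 * r)" for r :: real
    using sums_mult2[OF geometric_sums[of "1/2 :: real"], of r] by simp
  have smn: "summable (\<lambda>m. norm (p m x))" if "x \<in> U" for x
    by (rule summable_comparison_test'[OF sums_summable[OF gs[of "norm x"]], of 0]) (use pn[OF that] in auto)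
  have sm: "summable (\<lambda>m. p m x)" if "x \<in> U" for x by (rule summable_norm_cancel[OF smn[OF that]])
  define V where "V x = (if x \<in> U then \<Sum>m. p m x else 0)" for x
  have "V \<in> bop (subsp s U) (subsp s U)"
  proof (rule bopI[where C = 2])
    fix x c assume x: "x \<in> U"
    have "(\<lambda>n. \<Sum>m<n. p m x) \<longlonglongrightarrow> V x" using summable_LIMSEQ[OF sm[OF x]] x by (simp add: V_def)
    moreover have "(\<Sum>m<n. p m x) \<in> U" for n by (intro subspace_sum[OF U(1)] pU x)
    ultimately show "V x \<in> U" using closed_sequentially[OF U(2), of "\<lambda>n. \<Sum>m<n. p m x"] by blast
    show "V (s c x) = s c (V x)"
      using bounded_linear.suminf[OF bounded_bilinear.bounded_linear_right[OF bounded_bilinear_sc] sm[OF x], of c] x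
      by (simp add: V_def pscale subspace_scale[OF U(1)])
    have "norm (V x) \<le> (\<Sum>m. norm (p m x))" using x summable_norm[OF smn[OF x]] by (simp add: V_def)
    also have "\<dots> \<le> (\<Sum>m. (1/2) ^ m * norm x)" by (rule suminf_le[OF pn[OF x] smn[OF x] sums_summable[OF gs]])
    also have "\<dots> = 2 * norm x" by (rule sums_unique[OF gs, symmetric])
    finally show "norm (V x) \<le> 2 * norm x" .
  next
    fix x y assume "x \<in> U" "y \<in> U"
    then show "V (x + y) = V x + V y"
      by (simp add: V_def padd subspace_add[OF U(1)] suminf_add[OF sm sm])
  qed (simp add: V_def)
  moreover have "V (x - K x) = x" if x: "x \<in> U" for x
  proof -
    have Kx: "K x \<in> U" by (rule bop_mem[OF K x])
    have "V (x - K x) = V x - V (K x)" by (rule bop_diff[OF calculation s U(1) x Kx])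
    also have "V (K x) = (\<Sum>m. p (Suc m) x)" using Kx by (simp add: V_def pS(1))
    also have "V x = (\<Sum>m. p (Suc m) x) + p 0 x" using x suminf_split_head[OF sm[OF x]] by (simp add: V_def)
    finally show ?thesis by (simp add: pS)
  qed
  ultimately show ?thesis using that by blast
qed

section \<open>Operators on the direct sum\<close>

definition pair_scale :: "('k \<Rightarrow> 'a \<Rightarrow> 'a) \<Rightarrow> 'k \<Rightarrow> 'a \<times> 'a \<Rightarrow> 'a \<times> 'a" where
  "pair_scale sc c z = (sc c (fst z), sc c (snd z))"

lemma normed_scale_pair:
  assumes "normed_scale sc" shows "normed_scale (pair_scale sc)"
proof -
  interpret normed_scale sc by fact
  show ?thesis
  proof
    show "norm (pair_scale sc c z) = norm c * norm z" for c z
    proof -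
      have "norm (pair_scale sc c z) = sqrt ((norm c)\<^sup>2 * ((norm (fst z))\<^sup>2 + (norm (snd z))\<^sup>2))"
        by (simp add: pair_scale_def norm_prod_def norm_scale power_mult_distrib distrib_left)
      then show ?thesis by (simp add: real_sqrt_mult norm_prod_def)
    qed
  qed (auto simp: pair_scale_def prod_eq_iff scale_right_distrib scale_left_distrib scale_of_real)
qed

lemma kop_iff:
  fixes s :: "'k::real_or_complex \<Rightarrow> 'a::banach \<Rightarrow> 'a"
  assumes "normed_scale s" "module.subspace s U"
  shows "T \<in> kop s U V \<longleftrightarrow> T \<in> bop (subsp s U) (subsp s V) \<and> tot_bdd U (\<lambda>x. norm (T x))"
  using compact_closure_iff_tot_bdd[of T s U s V] assms by (auto simp: kop_def)

locale AH_sum = schauder sc b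
  for sc :: "'k::real_or_complex \<Rightarrow> 'a::banach \<Rightarrow> 'a" and b +
  fixes Y :: "'a set" and r :: "nat \<Rightarrow> nat"
  assumes few: "very_few_operators sc"
    and iso_X: "isomorphic (dual_space (subsp sc UNIV)) (ell1 :: ('k, nat \<Rightarrow> 'k) nspace)"
    and Y: "subspace Y" "closed Y" "infinite_dim sc Y"
    and Y_span: "Y = closed_span sc (b ` range r)"
    and codim_Y: "infinite_codim sc Y"
    and iso_Y: "isomorphic (dual_space (subsp sc Y)) (ell1 :: ('k, nat \<Rightarrow> 'k) nspace)"
    and few_Y: "\<And>T. T \<in> bop (subsp sc Y) (subsp sc UNIV) \<Longrightarrow>
      \<exists>c. \<exists>K\<in>kop sc Y UNIV. T = (\<lambda>y. sc c (incl Y y) + K y)"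
begin

abbreviation "sz \<equiv> pair_scale sc"
abbreviation "Z \<equiv> (UNIV :: 'a set) \<times> Y"
abbreviation "SX \<equiv> subsp sc UNIV"
abbreviation "SY \<equiv> subsp sc Y"
abbreviation "SZ \<equiv> subsp sz Z"
abbreviation "BZ \<equiv> bop SZ SZ"

lemma ns: "normed_scale sc" by unfold_locales

lemma nsz: "normed_scale sz" by (rule normed_scale_pair[OF ns])

sublocale z: normed_scale sz by (rule nsz)

lemma dim_X: "infinite_dim sc UNIV" using few by (simp add: very_few_operators_def)

lemma Z_subspace: "z.subspace Z"
  using subspace_0[OF Y(1)] subspace_add[OF Y(1)] subspace_scale[OF Y(1)]
  by (intro z.subspaceI) (auto simp: pair_scale_def zero_prod_def)

lemma Z_closed: "closed Z" using Y(2) by (intro closed_Times) auto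

text \<open>The maximum norm of \<open>spaceZ\<close> and the product norm of the type are
  equivalent, so they have the same bounded operators. This allows \<open>Z\<close> to be treated as
  a closed subspace of the product type, where the results on \<open>subsp\<close> apply.\<close>

lemma BZ_eq: "bop (spaceZ sc Y) (spaceZ sc Y) = BZ"
proof -
  let ?n = "\<lambda>z :: 'a \<times> 'a. max (norm (fst z)) (norm (snd z))"
  have le: "?n z \<le> norm z" for z by (cases z) (simp add: norm_fst_le norm_snd_le)
  have ge: "norm z \<le> 2 * ?n z" for z
  proof -
    have "norm z \<le> norm (fst z) + norm (snd z)" using norm_Pair_le[of "fst z" "snd z"] by simp
    then show ?thesis by linarith
  qed
  have "(\<exists>C. \<forall>z\<in>Z. ?n (T z) \<le> C * ?n z) \<longleftrightarrow> (\<exists>C. \<forall>z\<in>Z. norm (T z) \<le> C * norm z)" for T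
  proof
    assume "\<exists>C. \<forall>z\<in>Z. ?n (T z) \<le> C * ?n z"
    then obtain C where C: "\<And>z. z \<in> Z \<Longrightarrow> ?n (T z) \<le> C * ?n z" by blast
    have "norm (T z) \<le> 2 * \<bar>C\<bar> * norm z" if "z \<in> Z" for z
    proof -
      have "norm (T z) \<le> 2 * (C * ?n z)" using ge[of "T z"] C[OF that] by linarith
      also have "C * ?n z \<le> \<bar>C\<bar> * norm z" by (intro mult_mono le) (auto simp: le_max_iff_disj)
      finally show ?thesis by simp
    qed
    then show "\<exists>C. \<forall>z\<in>Z. norm (T z) \<le> C * norm z" by blast
  next
    assume "\<exists>C. \<forall>z\<in>Z. norm (T z) \<le> C * norm z"
    then obtain C where C: "\<And>z. z \<in> Z \<Longrightarrow> norm (T z) \<le> C * norm z" by blast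
    have "?n (T z) \<le> \<bar>C\<bar> * 2 * ?n z" if "z \<in> Z" for z
    proof -
      have "?n (T z) \<le> C * norm z" using le[of "T z"] C[OF that] by linarith
      also have "\<dots> \<le> \<bar>C\<bar> * (2 * ?n z)" by (intro mult_mono ge) (auto simp: le_max_iff_disj)
      finally show ?thesis by simp
    qed
    then show "\<exists>C. \<forall>z\<in>Z. ?n (T z) \<le> C * ?n z" by blast
  qed
  then show ?thesis by (simp add: bop_def spaceZ_def sum_space_def subsp_def pair_scale_def)
qed

lemma left_ideal_Z_iff: "left_ideal (spaceZ sc Y) L \<longleftrightarrow> left_ideal SZ L"
  by (simp add: left_ideal_def BZ_eq) (simp add: spaceZ_def sum_space_def subsp_def pair_scale_def)

lemma maximal_left_ideal_Z_iff: "maximal_left_ideal (spaceZ sc Y) L \<longleftrightarrow> maximal_left_ideal SZ L"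
  by (simp add: maximal_left_ideal_def BZ_eq left_ideal_Z_iff)

lemma fixed_ideal_Z_iff: "fixed_ideal (spaceZ sc Y) L \<longleftrightarrow> fixed_ideal SZ L"
  by (simp add: fixed_ideal_def BZ_eq) (simp add: spaceZ_def sum_space_def subsp_def)

section \<open>Coordinate maps and compact operators on \<open>Z\<close>\<close>

definition inj1 :: "'a \<Rightarrow> 'a \<times> 'a" where "inj1 x = (x, 0)"
definition inj2 :: "'a \<Rightarrow> 'a \<times> 'a" where "inj2 y = (0, incl Y y)"
definition pr1 :: "'a \<times> 'a \<Rightarrow> 'a" where "pr1 z = (if z \<in> Z then fst z else 0)"
definition pr2 :: "'a \<times> 'a \<Rightarrow> 'a" where "pr2 z = (if z \<in> Z then snd z else 0)"

lemma inj1_bop: "inj1 \<in> bop SX SZ"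
  using subspace_0[OF Y(1)] by (intro bopI[where C = 1]) (auto simp: inj1_def pair_scale_def norm_Pair)

lemma inj2_bop: "inj2 \<in> bop SY SZ"
  using subspace_0[OF Y(1)] subspace_add[OF Y(1)] subspace_scale[OF Y(1)]
  by (intro bopI[where C = 1]) (auto simp: inj2_def incl_def pair_scale_def norm_Pair zero_prod_def)

lemma pr1_bop: "pr1 \<in> bop SZ SX"
  using subspace_add[OF Y(1)] subspace_scale[OF Y(1)]
  by (intro bopI[where C = 1]) (auto simp: pr1_def pair_scale_def norm_fst_le)

lemma pr2_bop: "pr2 \<in> bop SZ SY"
  using subspace_add[OF Y(1)] subspace_scale[OF Y(1)]
  by (intro bopI[where C = 1]) (auto simp: pr2_def pair_scale_def norm_snd_le)

text \<open>Compactness in the form of total boundedness; it agrees with compactness of the closed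
  image of the ball by \<open>compact_closure_iff_tot_bdd\<close>.\<close>

definition cpt :: "('a \<times> 'a \<Rightarrow> 'a \<times> 'a) \<Rightarrow> bool" where
  "cpt T \<longleftrightarrow> T \<in> BZ \<and> tot_bdd Z (\<lambda>z. norm (T z))"

lemma cpt_BZ: "cpt T \<Longrightarrow> T \<in> BZ" by (simp add: cpt_def)

lemma tot_bdd_post:
  assumes "tot_bdd U (\<lambda>x. norm (T x))" "T \<in> bop (subsp s U) (subsp t V)" "S \<in> bop (subsp t V) (subsp q W)"
    "normed_scale s" "normed_scale q" "module.subspace s U"
  shows "tot_bdd U (\<lambda>x. norm ((S \<circ> T) x))"
proof -
  interpret s: normed_scale s by fact
  obtain C where C: "C > 0" "\<And>x. x \<in> V \<Longrightarrow> norm (S x) \<le> C * norm x" by (rule bop_bound[OF assms(3)]) blast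
  show ?thesis
    by (rule tot_bdd_mono[where C = C, OF assms(1) seminorm_on_norm_bop[OF bop_comp[OF assms(3,2)] assms(4,5,6)]])
      (use C bop_mem[OF assms(2)] s.subspace_diff[OF assms(6)] in auto)
qed

lemma cpt_plus: assumes "cpt S" "cpt T" shows "cpt (S + T)"
proof -
  have "tot_bdd Z (\<lambda>z. norm ((S + T) z))"
    by (rule tot_bdd_mono[where C = 1, OF tot_bdd_add[of Z "\<lambda>z. norm (S z)" "\<lambda>z. norm (T z)"]
          seminorm_on_norm_bop[OF plus_bop[of S sz Z sz Z T] nsz nsz Z_subspace]])
      (use assms z.subspace_diff[OF Z_subspace] Z_subspace nsz in \<open>auto simp: cpt_def norm_triangle_ineq\<close>)
  then show ?thesis using assms by (simp add: cpt_def plus_bop[OF _ _ nsz Z_subspace])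
qed

lemma cpt_post: "S \<in> BZ \<Longrightarrow> cpt T \<Longrightarrow> cpt (S \<circ> T)"
  unfolding cpt_def using tot_bdd_post[of Z T sz sz Z S sz Z] bop_comp nsz Z_subspace by blast

lemma cpt_pre: "S \<in> BZ \<Longrightarrow> cpt T \<Longrightarrow> cpt (T \<circ> S)"
  unfolding cpt_def using tot_bdd_comp[of Z "\<lambda>z. norm (T z)" S sz Z sz] bop_comp[of T sz Z sz Z S sz Z] nsz Z_subspace
  by auto

lemma cpt_scale: assumes "cpt T" shows "cpt (\<lambda>z. sz c (T z))"
proof -
  have "(\<lambda>z. sz c (T z)) = (\<lambda>z. sz c (incl Z z)) \<circ> T"
    using bop_mem[OF cpt_BZ[OF assms]] bop_outside[OF cpt_BZ[OF assms]] z.subspace_0[OF Z_subspace]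
    by (auto simp: fun_eq_iff incl_def)
  then show ?thesis
    using cpt_post[OF scale_bop[OF incl_bop_self[OF nsz Z_subspace] nsz Z_subspace] assms] by simp
qed

lemma cpt_minus: assumes "cpt S" "cpt T" shows "cpt (S - T)"
proof -
  have "S - T = S + (\<lambda>z. sz (-1) (T z))" by (auto simp: fun_eq_iff)
  then show ?thesis using cpt_plus[OF assms(1) cpt_scale[OF assms(2), of "-1"]] by (simp only:)
qed

lemma cpt_zero: "cpt 0"
  using zero_bop[OF nsz z.subspace_0[OF Z_subspace]] tot_bdd_zero[of Z] by (simp add: cpt_def)

section \<open>Scalar matrices modulo compact operators\<close>

definition smat :: "'k \<Rightarrow> 'k \<Rightarrow> 'k \<Rightarrow> 'a \<times> 'a \<Rightarrow> 'a \<times> 'a" where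
  "smat a c d z = (if z \<in> Z then (sc a (fst z) + sc c (snd z), sc d (snd z)) else 0)"

lemma smat_BZ: "smat a c d \<in> BZ"
proof (rule bopI[where C = "norm a + norm c + norm d"])
  fix z assume z: "z \<in> Z"
  show "smat a c d z \<in> Z" using z subspace_scale[OF Y(1)] by (auto simp: smat_def)
  have "norm (smat a c d z) \<le> norm (sc a (fst z) + sc c (snd z)) + norm (sc d (snd z))"
    using z by (simp add: smat_def norm_Pair_le)
  also have "\<dots> \<le> norm a * norm (fst z) + norm c * norm (snd z) + norm d * norm (snd z)"
    using norm_triangle_ineq[of "sc a (fst z)" "sc c (snd z)"] by (simp add: norm_scale)
  also have "\<dots> \<le> norm a * norm z + norm c * norm z + norm d * norm z"
    by (cases z) (auto intro!: add_mono mult_left_mono norm_fst_le norm_snd_le)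
  finally show "norm (smat a c d z) \<le> (norm a + norm c + norm d) * norm z" by (simp add: algebra_simps)
qed (use subspace_add[OF Y(1)] subspace_scale[OF Y(1)] in
    \<open>auto simp: smat_def pair_scale_def scale_right_distrib mult.commute\<close>)

text \<open>A form of \<open>matrix_rep\<close> without blocks, in which products are easy to
  compute. \<open>matrix_rep_iff\<close> identifies the two; the scalars are the entries 11, 12, 22
  in this order.\<close>

definition rep :: "('a \<times> 'a \<Rightarrow> 'a \<times> 'a) \<Rightarrow> 'k \<Rightarrow> 'k \<Rightarrow> 'k \<Rightarrow> bool" where
  "rep T a c d \<longleftrightarrow> cpt (T - smat a c d)"

lemma rep_smat: "rep (smat a c d) a c d"
  using cpt_zero by (simp add: rep_def)

lemma rep_cpt: "cpt T \<Longrightarrow> rep T 0 0 0"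
proof -
  have "smat 0 0 0 = 0" by (auto simp: smat_def fun_eq_iff zero_prod_def)
  then show "cpt T \<Longrightarrow> rep T 0 0 0" by (simp add: rep_def)
qed

lemma rep_plus:
  assumes "rep S a c d" "rep T a' c' d'" shows "rep (S + T) (a + a') (c + c') (d + d')"
proof -
  have "(S + T) - smat (a + a') (c + c') (d + d') = (S - smat a c d) + (T - smat a' c' d')"
    by (auto simp: fun_eq_iff smat_def scale_left_distrib prod_eq_iff)
  then show ?thesis using cpt_plus assms unfolding rep_def by metis
qed

lemma rep_scale:
  assumes "rep T a c d" shows "rep (\<lambda>z. sz k (T z)) (k * a) (k * c) (k * d)"
proof -
  have "(\<lambda>z. sz k (T z)) - smat (k * a) (k * c) (k * d) = (\<lambda>z. sz k ((T - smat a c d) z))"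
    by (auto simp: fun_eq_iff smat_def pair_scale_def prod_eq_iff scale_right_distrib scale_right_diff_distrib)
  then show ?thesis using cpt_scale assms unfolding rep_def by metis
qed

text \<open>With scalar matrices \<open>M\<close> and \<open>M'\<close>, the error
  \<open>S T - M M'\<close> splits as \<open>(S - M) T + M (T - M')\<close>, and compact operators
  form a two-sided ideal.\<close>

lemma rep_comp:
  assumes S: "S \<in> BZ" "rep S a c d" and T: "T \<in> BZ" "rep T a' c' d'"
  shows "rep (S \<circ> T) (a * a') (a * c' + c * d') (d * d')"
proof -
  have "(S \<circ> T) - smat (a * a') (a * c' + c * d') (d * d')
      = ((S - smat a c d) \<circ> T) + (smat a c d \<circ> (T - smat a' c' d'))"
  proof (rule ext)
    fix z
    show "((S \<circ> T) - smat (a * a') (a * c' + c * d') (d * d')) z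
      = (((S - smat a c d) \<circ> T) + (smat a c d \<circ> (T - smat a' c' d'))) z"
    proof (cases "z \<in> Z")
      case True
      have "smat a c d (T z - smat a' c' d' z) = smat a c d (T z) - smat a c d (smat a' c' d' z)"
        by (rule bop_diff[OF smat_BZ nsz Z_subspace bop_mem[OF T(1) True] bop_mem[OF smat_BZ True]])
      moreover have "smat a c d (smat a' c' d' z) = smat (a * a') (a * c' + c * d') (d * d') z"
        using True subspace_scale[OF Y(1)]
        by (auto simp: smat_def scale_right_distrib scale_left_distrib)
      ultimately show ?thesis by simp
    next
      case False
      then show ?thesis
        by (simp add: bop_outside[OF T(1)] bop_outside[OF smat_BZ] bop_zero[OF S(1)] bop_zero[OF smat_BZ])
    qed
  qed
  moreover have "cpt ((S - smat a c d) \<circ> T)" using S T by (intro cpt_pre) (auto simp: rep_def)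
  moreover have "cpt (smat a c d \<circ> (T - smat a' c' d'))" using T by (intro cpt_post smat_BZ) (auto simp: rep_def)
  ultimately show ?thesis unfolding rep_def using cpt_plus by simp
qed

text \<open>Each scalar bounds the matrix from below on one summand: \<open>a\<close> on
  \<open>X\<close>, \<open>c\<close> and \<open>d\<close> on \<open>Y\<close>. A compact operator
  admits no non-zero lower bound on an infinite-dimensional space.\<close>

lemma cpt_smat_zero:
  assumes "cpt (smat a c d)" shows "a = 0 \<and> c = 0 \<and> d = 0"
proof -
  have tb: "tot_bdd Z (\<lambda>z. norm (smat a c d z))" using assms by (simp add: cpt_def)
  have aux: "k = 0" if U: "subspace U" "infinite_dim sc U" "tot_bdd U p"
    and le: "\<And>x. x \<in> U \<Longrightarrow> norm k * norm x \<le> p x" for U p and k :: 'k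
  proof (rule ccontr)
    assume k: "k \<noteq> 0"
    obtain x where x: "x \<in> U" "1 / norm k * p x < norm x"
      using tot_bdd_not_bounded_below[OF U, of "1 / norm k"] by auto
    then show False using le[OF x(1)] k by (simp add: field_simps)
  qed
  have "tot_bdd UNIV (\<lambda>x. norm (smat a c d (inj1 x)))"
    by (rule tot_bdd_comp[OF tb inj1_bop ns nsz subspace_UNIV Z_subspace])
  then have "a = 0"
    by (rule aux[OF subspace_UNIV dim_X])
      (use subspace_0[OF Y(1)] in \<open>simp add: smat_def inj1_def norm_Pair norm_scale\<close>)
  moreover have tb2: "tot_bdd Y (\<lambda>y. norm (smat a c d (inj2 y)))"
    by (rule tot_bdd_comp[OF tb inj2_bop ns nsz Y(1) Z_subspace])
  have "c = 0"
  proof (rule aux[OF Y(1,3) tb2])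
    fix y assume "y \<in> Y"
    then show "norm c * norm y \<le> norm (smat a c d (inj2 y))"
      using norm_fst_le[of "sc c y" "sc d y"] by (simp add: smat_def inj2_def incl_def norm_scale)
  qed
  moreover have "d = 0"
  proof (rule aux[OF Y(1,3) tb2])
    fix y assume "y \<in> Y"
    then show "norm d * norm y \<le> norm (smat a c d (inj2 y))"
      using norm_snd_le[of "sc d y" "sc c y"] by (simp add: smat_def inj2_def incl_def norm_scale)
  qed
  ultimately show ?thesis by blast
qed

lemma rep_unique:
  assumes "rep T a c d" "rep T a' c' d'" shows "a = a' \<and> c = c' \<and> d = d'"
proof -
  have "(T - smat a' c' d') - (T - smat a c d) = smat (a - a') (c - c') (d - d')"
    by (auto simp: fun_eq_iff smat_def scale_left_diff_distrib prod_eq_iff)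
  then have "cpt (smat (a - a') (c - c') (d - d'))" using cpt_minus assms unfolding rep_def by metis
  from cpt_smat_zero[OF this] show ?thesis by simp
qed

lemma matrix_rep_imp_rep:
  assumes T: "T \<in> BZ" and "matrix_rep sc Y T a c d" shows "rep T a c d"
proof -
  obtain K11 K12 K21 K22 where K: "K11 \<in> kop sc UNIV UNIV" "K12 \<in> kop sc Y UNIV" "K21 \<in> kop sc UNIV Y" "K22 \<in> kop sc Y Y"
    and Teq: "T = opmat Y (\<lambda>x. sc a x + K11 x) (\<lambda>y. sc c (incl Y y) + K12 y) K21 (\<lambda>y. sc d (incl Y y) + K22 y)"
    using assms(2) unfolding matrix_rep_def by blast
  have bdds: "K11 \<in> bop SX SX" "tot_bdd UNIV (\<lambda>x. norm (K11 x))"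
    "K12 \<in> bop SY SX" "tot_bdd Y (\<lambda>x. norm (K12 x))"
    "K21 \<in> bop SX SY" "tot_bdd UNIV (\<lambda>x. norm (K21 x))"
    "K22 \<in> bop SY SY" "tot_bdd Y (\<lambda>x. norm (K22 x))"
    using K by (auto simp: kop_iff[OF ns Y(1)] kop_iff[OF ns subspace_UNIV])
  have aux: "cpt (i \<circ> (K \<circ> p))" if "p \<in> bop SZ (subsp sc U)" "K \<in> bop (subsp sc U) (subsp sc V)"
    "tot_bdd U (\<lambda>x. norm (K x))" "i \<in> bop (subsp sc V) SZ" "subspace U" for p K i U V
    unfolding cpt_def
    using bop_comp[OF that(4) bop_comp[OF that(2,1)]]
      tot_bdd_post[OF _ bop_comp[OF that(2,1)] that(4) nsz nsz Z_subspace]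
      tot_bdd_comp[OF that(3,1) nsz ns Z_subspace that(5)] by simp
  have "cpt ((inj1 \<circ> (K11 \<circ> pr1)) + (inj1 \<circ> (K12 \<circ> pr2)) + (inj2 \<circ> (K21 \<circ> pr1)) + (inj2 \<circ> (K22 \<circ> pr2)))"
    by (intro cpt_plus aux[OF pr1_bop bdds(1,2) inj1_bop subspace_UNIV] aux[OF pr2_bop bdds(3,4) inj1_bop Y(1)]
        aux[OF pr1_bop bdds(5,6) inj2_bop subspace_UNIV] aux[OF pr2_bop bdds(7,8) inj2_bop Y(1)])
  moreover have "(inj1 \<circ> (K11 \<circ> pr1)) + (inj1 \<circ> (K12 \<circ> pr2)) + (inj2 \<circ> (K21 \<circ> pr1)) + (inj2 \<circ> (K22 \<circ> pr2)) = T - smat a c d"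
  proof (rule ext)
    fix z
    show "((inj1 \<circ> (K11 \<circ> pr1)) + (inj1 \<circ> (K12 \<circ> pr2)) + (inj2 \<circ> (K21 \<circ> pr1)) + (inj2 \<circ> (K22 \<circ> pr2))) z = (T - smat a c d) z"
      using bop_mem[OF bdds(5)] bop_mem[OF bdds(7)]
      by (auto simp: Teq opmat_def smat_def inj1_def inj2_def pr1_def pr2_def incl_def mem_Times_iff
          bop_zero[OF bdds(1)] bop_zero[OF bdds(3)] bop_zero[OF bdds(5)] bop_zero[OF bdds(7)] zero_prod_def)
  qed
  ultimately show ?thesis unfolding rep_def by (simp only:)
qed

text \<open>The entry on \<open>X\<close> is governed by the assumption of very few operators, the
  entries leaving \<open>Y\<close> by the assumption on operators from \<open>Y\<close> to
  \<open>X\<close>. For the entry on \<open>Y\<close> the codomain is first enlarged to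
  \<open>X\<close>; the compact remainder still maps into \<open>Y\<close>. The entry from
  \<open>X\<close> to \<open>Y\<close> is read as an operator on \<open>X\<close> and loses its
  scalar part.\<close>

lemma matrix_rep_exists:
  assumes T: "T \<in> BZ"
  obtains a c d where "matrix_rep sc Y T a c d"
proof -
  have T11: "pr1 \<circ> (T \<circ> inj1) \<in> bop SX SX"
    by (rule bop_comp[OF pr1_bop bop_comp[OF T inj1_bop]])
  have T12: "pr1 \<circ> (T \<circ> inj2) \<in> bop SY SX"
    by (rule bop_comp[OF pr1_bop bop_comp[OF T inj2_bop]])
  have T21: "pr2 \<circ> (T \<circ> inj1) \<in> bop SX SY"
    by (rule bop_comp[OF pr2_bop bop_comp[OF T inj1_bop]])
  have T22: "pr2 \<circ> (T \<circ> inj2) \<in> bop SY SY"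
    by (rule bop_comp[OF pr2_bop bop_comp[OF T inj2_bop]])
  have few': "\<exists>c K. S = (\<lambda>x. sc c x + K x) \<and> K \<in> kop sc UNIV UNIV" if "S \<in> bop SX SX" for S
    using few that unfolding very_few_operators_def by auto
  obtain a K11 where K11: "pr1 \<circ> (T \<circ> inj1) = (\<lambda>x. sc a x + K11 x)" "K11 \<in> kop sc UNIV UNIV"
    using few'[OF T11] by blast
  obtain c K12 where K12: "pr1 \<circ> (T \<circ> inj2) = (\<lambda>y. sc c (incl Y y) + K12 y)" "K12 \<in> kop sc Y UNIV"
    using few_Y[OF T12] by blast
  obtain d K22 where K22: "pr2 \<circ> (T \<circ> inj2) = (\<lambda>y. sc d (incl Y y) + K22 y)" "K22 \<in> kop sc Y UNIV"
    using few_Y[OF bop_codomain[OF T22]] by blast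
  have "K22 y \<in> Y" if "y \<in> Y" for y
  proof -
    have "K22 y = (pr2 \<circ> (T \<circ> inj2)) y - sc d (incl Y y)" using K22(1) by simp
    then show ?thesis using subspace_diff[OF Y(1) bop_mem[OF T22 that] subspace_scale[OF Y(1) that]] that by (simp add: incl_def)
  qed
  then have K22': "K22 \<in> kop sc Y Y"
    using K22(2) by (auto simp: kop_iff[OF ns Y(1)] intro: bop_codomain)
  obtain k K21 where K21: "pr2 \<circ> (T \<circ> inj1) = (\<lambda>x. sc k x + K21 x)" "K21 \<in> kop sc UNIV UNIV"
    using few'[OF bop_codomain[OF T21]] by auto
  \<comment> \<open>If \<open>k\<close> were non-zero, then \<open>x = - K21 x / k\<close> modulo \<open>Y\<close>, so \<open>Y\<close> would have finite codimension.\<close>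
  have "k = 0"
  proof (rule ccontr)
    assume k: "k \<noteq> 0"
    have tb: "tot_bdd UNIV (\<lambda>x. norm (K21 x))" using K21(2) by (simp add: kop_iff[OF ns subspace_UNIV])
    have "\<exists>m\<in>Y. norm (x - m) \<le> norm (inverse k) * norm (K21 x)" for x
    proof
      have "sc k x + K21 x \<in> Y" using bop_mem[OF T21, of x] fun_cong[OF K21(1), of x] by simp
      then show "sc (inverse k) (sc k x + K21 x) \<in> Y" by (rule subspace_scale[OF Y(1)])
      show "norm (x - sc (inverse k) (sc k x + K21 x)) \<le> norm (inverse k) * norm (K21 x)"
        using k by (simp add: scale_right_distrib norm_scale del: norm_inverse)
    qed
    then obtain B where "finite B" "UNIV = span (Y \<union> B)"
      using tot_bdd_finite_codim[OF subspace_UNIV Y(1,2) subset_UNIV tb, of "norm (inverse k)"] by auto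
    then show False using codim_Y unfolding infinite_codim_def by metis
  qed
  then have K21': "pr2 \<circ> (T \<circ> inj1) = K21" "K21 \<in> kop sc UNIV Y"
    using K21 T21 by (auto simp: kop_iff[OF ns subspace_UNIV])
  have "T = opmat Y (\<lambda>x. sc a x + K11 x) (\<lambda>y. sc c (incl Y y) + K12 y) K21 (\<lambda>y. sc d (incl Y y) + K22 y)"
    unfolding K11(1)[symmetric] K12(1)[symmetric] K21'(1)[symmetric] K22(1)[symmetric]
  proof (rule ext)
    fix z
    show "T z = opmat Y (pr1 \<circ> (T \<circ> inj1)) (pr1 \<circ> (T \<circ> inj2)) (pr2 \<circ> (T \<circ> inj1)) (pr2 \<circ> (T \<circ> inj2)) z"
    proof (cases "z \<in> Z")
      case True
      have m: "inj1 (fst z) \<in> Z" "inj2 (snd z) \<in> Z" using True bop_mem[OF inj1_bop] bop_mem[OF inj2_bop] by auto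
      have "T z = T (inj1 (fst z) + inj2 (snd z))" using True by (simp add: inj1_def inj2_def incl_def mem_Times_iff)
      also have "\<dots> = T (inj1 (fst z)) + T (inj2 (snd z))" by (rule bop_add[OF T m])
      finally show ?thesis using True bop_mem[OF T m(1)] bop_mem[OF T m(2)]
        by (simp add: opmat_def pr1_def pr2_def mem_Times_iff prod_eq_iff)
    next
      case False
      then show ?thesis using bop_outside[OF T False] by (simp add: opmat_def mem_Times_iff)
    qed
  qed
  then have "matrix_rep sc Y T a c d"
    unfolding matrix_rep_def using K11(2) K12(2) K21'(2) K22' by blast
  then show ?thesis using that by blast
qed

text \<open>The converse direction needs no computation: some block representation exists, and
  uniqueness identifies its scalars.\<close>

lemma matrix_rep_iff: "T \<in> BZ \<Longrightarrow> matrix_rep sc Y T a c d \<longleftrightarrow> rep T a c d"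
  using matrix_rep_imp_rep matrix_rep_exists rep_unique by metis

lemma rep_exists: assumes "T \<in> BZ" obtains a c d where "rep T a c d"
  using matrix_rep_exists[OF assms] matrix_rep_iff[OF assms] by metis

lemma M1_iff: "T \<in> M1 sc Y \<longleftrightarrow> T \<in> BZ \<and> (\<exists>a c. rep T a c 0)"
  unfolding M1_def BZ_eq using matrix_rep_iff[of T] by blast

lemma M2_iff: "T \<in> M2 sc Y \<longleftrightarrow> T \<in> BZ \<and> (\<exists>c d. rep T 0 c d)"
  unfolding M2_def BZ_eq using matrix_rep_iff[of T] by blast

end

section \<open>Maximal left ideals and their generators\<close>

context normed_scale
begin

text \<open>A gliding hump: a functional is built stepwise, adding a small multiple of a norming functional
  of \<open>u n\<close> whenever the value at \<open>u n\<close> is too small.\<close>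

lemma functional_not_dominated:
  assumes p: "seminorm_on UNIV p" and nb: "\<And>C. C \<ge> 0 \<Longrightarrow> \<exists>x. C * p x < norm x"
  obtains f where "f \<in> bop (subsp sc UNIV) (subsp (*) UNIV)" "\<And>C. \<exists>x. C * p x < norm (f x)"
proof -
  have p0: "p x \<ge> 0" for x
    using seminorm_on_diff[OF p, of 0 0] seminorm_on_diff[OF p, of x x] by simp
  \<comment> \<open>The bound is the square of the weight \<open>q n = (1/10) ^ n\<close> used
    below, so a functional of size about \<open>q n\<close> at \<open>u n\<close> eventually beats
    any multiple of \<open>p (u n)\<close>.\<close>
  have "\<exists>u. norm u = 1 \<and> p u < (1/100) ^ n" for n :: nat
  proof -
    obtain x where x: "100 ^ n * p x < norm x" using nb[of "100 ^ n"] by auto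
    have nx: "norm x > 0" using x p0[of x] by (meson le_less_trans mult_nonneg_nonneg zero_le_numeral zero_le_power)
    have "p ((1 / norm x) *\<^sub>R x) = (1 / norm x) * p x" using p nx by (simp add: seminorm_on_def)
    also have "\<dots> < (1/100) ^ n" using x nx by (simp add: field_simps power_divide)
    finally show ?thesis using nx by (intro exI[of _ "(1 / norm x) *\<^sub>R x"]) simp
  qed
  then obtain u where u: "\<And>n. norm (u n) = 1" "\<And>n. p (u n) < (1/100) ^ n" by metis
  have "\<exists>h. (\<forall>x y. h (x + y) = h x + h y) \<and> (\<forall>c x. h (sc c x) = c * h x) \<and>
      (\<forall>x. norm (h x) \<le> 2 * norm x) \<and> h (u n) = 1" for n
  proof -
    have "u n \<noteq> 0" using u(1)[of n] by auto
    then obtain g where "\<And>x y. g (x + y) = g x + g y" "\<And>c x. g (sc c x) = c * g x"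
      "\<And>x. norm (g x) \<le> 2 * norm x" "g (u n) = of_real (norm (u n))"
      by (rule norming_functional) blast
    then show ?thesis using u(1)[of n] by (intro exI[of _ g]) simp
  qed
  then obtain h where h: "\<And>n x y. h n (x + y) = h n x + h n y" "\<And>n c x. h n (sc c x) = c * h n x"
    "\<And>n x. norm (h n x) \<le> 2 * norm x" "\<And>n. h n (u n) = 1" by metis
  define q :: "nat \<Rightarrow> real" where "q n = (1/10) ^ n" for n
  have q: "q n > 0" "q (Suc n) = q n / 10" for n by (simp_all add: q_def)
  define f where "f = rec_nat (\<lambda>x. 0)
      (\<lambda>n F. if norm (F (u n)) \<ge> q n / 2 then F else (\<lambda>x. F x + of_real (q n) * h n x))"
  have f: "f 0 = (\<lambda>x. 0)"
    "f (Suc n) = (if norm (f n (u n)) \<ge> q n / 2 then f n else (\<lambda>x. f n x + of_real (q n) * h n x))" for n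
    by (simp_all add: f_def)
  have fadd: "f n (x + y) = f n x + f n y" for n x y
    by (induction n) (auto simp: f h algebra_simps)
  have fscale: "f n (sc c x) = c * f n x" for n c x
    by (induction n) (auto simp: f h algebra_simps)
  have step: "norm (f (Suc n) x - f n x) \<le> q n * (2 * norm x)" for n x
    using h(3)[of n x] q(1)[of n] mult_left_mono[OF h(3)[of n x], of "q n"] by (auto simp: f norm_mult)
  \<comment> \<open>If the old value is below \<open>q n / 2\<close>, the new term contributes
    exactly \<open>q n\<close> at \<open>u n\<close>, and more than \<open>q n / 2\<close>
    survives.\<close>
  have hump: "q n / 2 \<le> norm (f (Suc n) (u n))" for n
  proof (cases "norm (f n (u n)) \<ge> q n / 2")
    case False
    have "norm (of_real (q n) :: 'k) - norm (- f n (u n)) \<le> norm (of_real (q n) - (- f n (u n)))"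
      by (rule norm_triangle_ineq2)
    then show ?thesis using False q(1)[of n] by (simp add: f h(4) add.commute)
  qed (simp add: f)
  \<comment> \<open>The changes from stage \<open>n\<close> on add up to at most
    \<open>2 * q n * (1 + 1/10 + 1/100 + ...) = 20 / 9 * q n\<close> per unit of norm.\<close>
  have dist: "norm (f (n + k) x - f n x) \<le> 20 / 9 * (q n - q (n + k)) * norm x" for n k x
  proof (induction k)
    case (Suc k)
    have "norm (f (n + Suc k) x - f n x) \<le> norm (f (Suc (n + k)) x - f (n + k) x) + norm (f (n + k) x - f n x)"
      using norm_triangle_ineq[of "f (Suc (n + k)) x - f (n + k) x" "f (n + k) x - f n x"] by simp
    also have "\<dots> \<le> q (n + k) * (2 * norm x) + 20 / 9 * (q n - q (n + k)) * norm x"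
      by (intro add_mono step Suc)
    also have "\<dots> = 20 / 9 * (q n - q (n + Suc k)) * norm x"
      unfolding add_Suc_right q(2) by (simp add: field_simps)
    finally show ?case .
  qed simp
  have dist': "norm (f m x - f n x) \<le> 20 / 9 * q n * norm x" if mn: "m \<ge> n" for m n x
  proof -
    obtain k where k: "m = n + k" using le_Suc_ex[OF mn] by blast
    have "20 / 9 * (q n - q (n + k)) * norm x \<le> 20 / 9 * q n * norm x"
      using q(1)[of "n + k"] by (intro mult_right_mono) auto
    then show ?thesis unfolding k by (rule order_trans[OF dist])
  qed
  have conv: "convergent (\<lambda>n. f n x)" for x
  proof (rule Cauchy_convergent_scalars, rule metric_CauchyI)
    fix e :: real assume e: "e > 0"
    have "(\<lambda>n. 20 / 9 * q n * norm x) \<longlonglongrightarrow> 20 / 9 * 0 * norm x"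
      unfolding q_def by (intro tendsto_intros LIMSEQ_power_zero) simp
    from order_tendstoD(2)[OF this, of "e / 2"] have "eventually (\<lambda>n. 20 / 9 * q n * norm x < e / 2) sequentially"
      using e by simp
    then obtain N where N: "20 / 9 * q N * norm x < e / 2" by (auto simp: eventually_sequentially)
    have near: "dist (f m x) (f N x) < e / 2" if "m \<ge> N" for m
      using dist'[OF that, of x] N by (simp add: dist_norm)
    show "\<exists>M. \<forall>m\<ge>M. \<forall>n\<ge>M. dist (f m x) (f n x) < e"
      by (intro exI[of _ N] allI impI dist_triangle_half_l[OF near near])
  qed
  define F where "F x = lim (\<lambda>n. f n x)" for x
  have lim: "(\<lambda>n. f n x) \<longlonglongrightarrow> F x" for x using conv[of x] by (simp add: F_def convergent_LIMSEQ_iff)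
  have close: "norm (F x - f n x) \<le> 20 / 9 * q n * norm x" for n x
    by (rule LIMSEQ_le_const2[OF tendsto_norm[OF tendsto_diff[OF lim tendsto_const]]]) (use dist' in blast)
  show ?thesis
  proof (rule that[of F])
    show "F \<in> bop (subsp sc UNIV) (subsp (*) UNIV)"
    proof (rule bopI[where C = "20 / 9"])
      show "F (x + y) = F x + F y" for x y
        using LIMSEQ_unique[OF lim[of "x + y"]] tendsto_add[OF lim[of x] lim[of y]] by (simp add: fadd)
      show "F (sc c x) = c * F x" for c x
        using LIMSEQ_unique[OF lim[of "sc c x"]] tendsto_mult[OF tendsto_const[of c] lim[of x]] by (simp add: fscale)
      show "norm (F x) \<le> 20 / 9 * norm x" for x using close[of x 0] by (simp add: f q_def)
    qed auto
    fix C :: real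
    obtain n where n: "real n > 4 * (\<bar>C\<bar> + 1)" using reals_Archimedean2 by blast
    have "real m \<le> 10 ^ m" for m :: nat
    proof (induction m)
      case (Suc m)
      moreover have "(1 :: real) \<le> 10 ^ m" by simp
      ultimately show ?case unfolding of_nat_Suc power_Suc by linarith
    qed simp
    from this[of n] n have "4 * (\<bar>C\<bar> + 1) \<le> 10 ^ n" by linarith
    then have Cn: "(\<bar>C\<bar> + 1) * q n \<le> 1 / 4" by (simp add: q_def power_divide field_simps)
    have "C * p (u n) \<le> (\<bar>C\<bar> + 1) * p (u n)" by (intro mult_right_mono p0) auto
    also have "\<dots> < (\<bar>C\<bar> + 1) * (1/100) ^ n" using u(2)[of n] by (intro mult_strict_left_mono) auto
    also have "(1/100 :: real) ^ n = q n * q n" unfolding q_def power_mult_distrib[symmetric] by simp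
    also have "(\<bar>C\<bar> + 1) * (q n * q n) \<le> 1 / 4 * q n"
      using mult_right_mono[OF Cn, of "q n"] q(1)[of n] by simp
    also have "\<dots> \<le> norm (F (u n))"
    proof -
      have "norm (f (Suc n) (u n)) - norm (F (u n)) \<le> norm (F (u n) - f (Suc n) (u n))"
        by (metis norm_minus_commute norm_triangle_ineq2)
      \<comment> \<open>After stage \<open>n\<close> the value at \<open>u n\<close> moves by at
        most \<open>20 / 9 * q n / 10 = 2 / 9 * q n\<close>, and
        \<open>1 / 2 - 2 / 9 > 1 / 4\<close>.\<close>
      then show ?thesis using hump[of n] close[of "u n" "Suc n"] q[of n] u(1)[of n] by simp
    qed
    finally show "\<exists>x. C * p x < norm (F x)" by blast
  qed
qed

end

lemma sum_bop:
  assumes "finite J" "\<And>i. i \<in> J \<Longrightarrow> f i \<in> bop (subsp s U) (subsp t V)" "normed_scale t" "module.subspace t V"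
  shows "(\<lambda>x. \<Sum>i\<in>J. f i x) \<in> bop (subsp s U) (subsp t V)"
  using assms(1,2)
proof (induction J rule: finite_induct)
  case empty
  interpret normed_scale t by fact
  show ?case using zero_bop[OF assms(3) subspace_0[OF assms(4)]] by (simp add: zero_fun_def)
next
  case (insert j J)
  have eq: "(\<lambda>x. \<Sum>i\<in>insert j J. f i x) = f j + (\<lambda>x. \<Sum>i\<in>J. f i x)" using insert by auto
  show ?case unfolding eq by (rule plus_bop[OF _ _ assms(3,4)]) (use insert in auto)
qed

section \<open>Left ideals of operators on \<open>Z\<close> and the two characters\<close>

context AH_sum
begin

lemma b_Y: assumes "k \<in> range r" shows "b k \<in> Y"
proof -
  have "b k \<in> span (b ` range r)" using assms by (intro span_base imageI)
  then show ?thesis unfolding Y_span closed_span_def by (rule subsetD[OF closure_subset])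
qed

lemma coef_Y: "y \<in> Y \<Longrightarrow> k \<notin> range r \<Longrightarrow> coef y k = 0"
  using coef_closed_span[of y "range r" k] unfolding Y_span[symmetric] .

lemma incl_Z: "incl Z = smat 1 0 1"
  by (auto simp: fun_eq_iff incl_def smat_def)

lemma left_ideal_subset: "left_ideal SZ L \<Longrightarrow> T \<in> L \<Longrightarrow> T \<in> BZ"
  and left_ideal_plus: "left_ideal SZ L \<Longrightarrow> S \<in> L \<Longrightarrow> T \<in> L \<Longrightarrow> S + T \<in> L"
  and left_ideal_comp: "left_ideal SZ L \<Longrightarrow> S \<in> BZ \<Longrightarrow> T \<in> L \<Longrightarrow> S \<circ> T \<in> L"
  by (auto simp: left_ideal_def)

lemma left_ideal_scale:
  assumes "left_ideal SZ L" "T \<in> L" shows "(\<lambda>z. sz c (T z)) \<in> L"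
proof -
  have "\<forall>c. \<forall>T\<in>L. (\<lambda>z. sz c (T z)) \<in> L" using assms(1) by (simp add: left_ideal_def subsp_def)
  then show ?thesis using assms(2) by blast
qed

lemma left_ideal_identity:
  assumes L: "left_ideal SZ L" and "incl Z \<in> L" shows "L = BZ"
proof
  show "BZ \<subseteq> L"
  proof
    fix T assume T: "T \<in> BZ"
    have "T \<circ> incl Z = T" by (auto simp: fun_eq_iff incl_def bop_zero[OF T] bop_outside[OF T])
    then show "T \<in> L" using left_ideal_comp[OF L T assms(2)] by simp
  qed
qed (use left_ideal_subset[OF L] in blast)

text \<open>\<open>M1\<close> and \<open>M2\<close> are the kernels of the characters of the algebra of bounded operators that pick a diagonal entry.\<close>

lemma character_kernel_maximal:
  fixes \<theta> :: "'k \<Rightarrow> 'k \<Rightarrow> 'k"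
  assumes add: "\<And>a a' d d'. \<theta> (a + a') (d + d') = \<theta> a d + \<theta> a' d'"
    and mult: "\<And>a a' d d'. \<theta> (a * a') (d * d') = \<theta> a d * \<theta> a' d'"
    and scale: "\<And>k a d. \<theta> (k * a) (k * d) = k * \<theta> a d" and one: "\<theta> 1 1 = 1"
    and M: "\<And>T. T \<in> M \<longleftrightarrow> T \<in> BZ \<and> (\<exists>a c d. rep T a c d \<and> \<theta> a d = 0)"
  shows "maximal_left_ideal SZ M" "\<not> fixed_ideal SZ M"
proof -
  have zero: "\<theta> 0 0 = 0" using scale[of 0 0 0] by simp
  have cptM: "T \<in> M" if "cpt T" for T using that rep_cpt[OF that] zero M cpt_BZ by blast
  have li: "left_ideal SZ M"
    unfolding left_ideal_def
  proof (intro conjI ballI allI)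
    show "M \<subseteq> BZ" using M by blast
    show "0 \<in> M" by (rule cptM[OF cpt_zero])
    fix S T assume S: "S \<in> M" and T: "T \<in> M"
    from S T obtain a c d a' c' d' where "rep S a c d" "\<theta> a d = 0" "rep T a' c' d'" "\<theta> a' d' = 0"
      using M by meson
    then have "rep (S + T) (a + a') (c + c') (d + d')" "\<theta> (a + a') (d + d') = 0"
      using rep_plus add by auto
    moreover have "S + T \<in> BZ" using S T M by (intro plus_bop[OF _ _ nsz Z_subspace]) auto
    ultimately show "S + T \<in> M" using M by blast
  next
    fix k T assume T: "T \<in> M"
    then obtain a c d where "rep T a c d" "\<theta> a d = 0" using M by meson
    then have "rep (\<lambda>z. sz k (T z)) (k * a) (k * c) (k * d)" "\<theta> (k * a) (k * d) = 0"
      using rep_scale scale by auto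
    moreover have "(\<lambda>z. sz k (T z)) \<in> BZ" using T M by (intro scale_bop[OF _ nsz Z_subspace]) auto
    ultimately have "(\<lambda>z. sz k (T z)) \<in> M" using M by blast
    then show "(\<lambda>x. smult SZ k (T x)) \<in> M" by (simp add: subsp_def)
  next
    fix S T assume S: "S \<in> BZ" and T: "T \<in> M"
    obtain a c d where Sr: "rep S a c d" by (rule rep_exists[OF S])
    obtain a' c' d' where Tr: "rep T a' c' d'" "\<theta> a' d' = 0" using T M by meson
    have TB: "T \<in> BZ" using T M by blast
    have "\<theta> (a * a') (d * d') = 0" using mult Tr(2) by simp
    then show "S \<circ> T \<in> M" using rep_comp[OF S Sr TB Tr(1)] bop_comp[OF S TB] M by blast
  qed
  have id: "incl Z \<notin> M"
  proof
    assume "incl Z \<in> M"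
    then obtain a c d where r: "rep (incl Z) a c d" "\<theta> a d = 0" using M by meson
    from rep_unique[OF r(1) rep_smat[of 1 0 1, folded incl_Z]] show False using r(2) one by simp
  qed
  show "maximal_left_ideal SZ M"
    unfolding maximal_left_ideal_def
  proof (intro conjI allI impI li)
    show "M \<noteq> BZ" using id incl_bop_self[OF nsz Z_subspace] by blast
    fix N assume N: "left_ideal SZ N \<and> M \<subseteq> N"
    then have liN: "left_ideal SZ N" by blast
    show "N = M \<or> N = BZ"
    proof (rule disjCI)
      assume "N \<noteq> BZ"
      show "N = M"
      proof (rule ccontr)
        assume "N \<noteq> M"
        then obtain T where T: "T \<in> N" "T \<notin> M" using N by blast
        have TB: "T \<in> BZ" by (rule left_ideal_subset[OF liN T(1)])
        obtain a c d where Tr: "rep T a c d" by (rule rep_exists[OF TB])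
        have ne: "\<theta> a d \<noteq> 0" using T(2) TB Tr M by blast
        \<comment> \<open>With this \<open>k\<close> the operator \<open>I + k T\<close> has
          character value 0 and lies in \<open>M\<close>; subtracting \<open>k T\<close>, which lies
          in \<open>N\<close>, leaves the identity.\<close>
        define k where "k = - inverse (\<theta> a d)"
        define S where "S = incl Z + (\<lambda>z. sz k (T z))"
        have "rep S (1 + k * a) (0 + k * c) (1 + k * d)"
          unfolding S_def using rep_plus[OF rep_smat[of 1 0 1, folded incl_Z] rep_scale[OF Tr]] .
        moreover have "\<theta> (1 + k * a) (1 + k * d) = 1 + k * \<theta> a d" by (simp only: add one scale)
        then have "\<theta> (1 + k * a) (1 + k * d) = 0" using ne by (simp add: k_def)
        moreover have "S \<in> BZ"
          unfolding S_def by (intro plus_bop[OF _ _ nsz Z_subspace] incl_bop_self[OF nsz Z_subspace] scale_bop[OF TB nsz Z_subspace])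
        ultimately have "S \<in> N" using M N by blast
        then have "S - (\<lambda>z. sz k (T z)) \<in> N"
          by (rule left_ideal_minus[OF liN nsz _ left_ideal_scale[OF liN T(1)]])
        then have "incl Z \<in> N" by (simp add: S_def)
        then show False using left_ideal_identity[OF liN] \<open>N \<noteq> BZ\<close> by blast
      qed
    qed
  qed
  show "\<not> fixed_ideal SZ M"
  proof
    assume "fixed_ideal SZ M"
    then obtain x where x: "x \<in> Z" "x \<noteq> 0" "M = {T \<in> BZ. T x = 0}" by (auto simp: fixed_ideal_def subsp_def)
    obtain h where h: "\<And>x y. h (x + y) = h x + h y" "\<And>c x. h (sz c x) = c * h x"
      "\<And>x. norm (h x) \<le> 2 * norm x" "h x = of_real (norm x)"
      by (rule z.norming_functional[OF x(2)]) blast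
    define g where "g z = (if z \<in> Z then h z else 0)" for z
    have g: "g \<in> bop SZ (subsp (*) UNIV)"
      unfolding g_def by (rule restrict_functional_bop[OF nsz Z_subspace h(1-3)])
    \<comment> \<open>This rank-one operator is compact, hence in \<open>M\<close>, but does not
      vanish at \<open>x\<close>.\<close>
    have "cpt (\<lambda>z. sz (g z) x)"
      unfolding cpt_def using rank_one_bop[OF g nsz Z_subspace x(1)] tot_bdd_rank_one[OF g nsz Z_subspace nsz] by blast
    then have "sz (g x) x = 0" using cptM x(3) by blast
    then show False using x h(4) by (simp add: g_def)
  qed
qed

lemma M1_maximal: "maximal_left_ideal SZ (M1 sc Y)" "\<not> fixed_ideal SZ (M1 sc Y)"
proof -
  have M: "T \<in> M1 sc Y \<longleftrightarrow> T \<in> BZ \<and> (\<exists>a c d. rep T a c d \<and> d = 0)" for T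
    using M1_iff[of T] by blast
  show "maximal_left_ideal SZ (M1 sc Y)" "\<not> fixed_ideal SZ (M1 sc Y)"
    by (rule character_kernel_maximal[where \<theta> = "\<lambda>a d. d", OF _ _ _ _ M]; simp)+
qed

lemma M2_maximal: "maximal_left_ideal SZ (M2 sc Y)" "\<not> fixed_ideal SZ (M2 sc Y)"
proof -
  have M: "T \<in> M2 sc Y \<longleftrightarrow> T \<in> BZ \<and> (\<exists>a c d. rep T a c d \<and> a = 0)" for T
    using M2_iff[of T] by blast
  show "maximal_left_ideal SZ (M2 sc Y)" "\<not> fixed_ideal SZ (M2 sc Y)"
    by (rule character_kernel_maximal[where \<theta> = "\<lambda>a d. a", OF _ _ _ _ M]; simp)+
qed

section \<open>Non-fixed maximal left ideals\<close>

lemma nonfixed_contains_cpt: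
  assumes max: "maximal_left_ideal SZ L" and nf: "\<not> fixed_ideal SZ L" and K: "cpt K"
  shows "K \<in> L"
proof (rule ccontr)
  assume KL: "K \<notin> L"
  have L: "left_ideal SZ L" "L \<noteq> BZ"
    and maxL: "\<And>N. left_ideal SZ N \<Longrightarrow> L \<subseteq> N \<Longrightarrow> N = L \<or> N = BZ"
    using max by (auto simp: maximal_left_ideal_def)
  have L0: "0 \<in> L" using L(1) by (simp add: left_ideal_def)
  \<comment> \<open>\<open>L\<close> plus the compact operators is a left ideal that contains
    \<open>L\<close> and \<open>K\<close>. By maximality it is the whole algebra, so the identity is
    a sum of an element of \<open>L\<close> and a compact operator.\<close>
  define N where "N = {S + T |S T. S \<in> L \<and> cpt T}"
  have NI: "S + T \<in> N" if "S \<in> L" "cpt T" for S T using that by (auto simp: N_def)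
  have "left_ideal SZ N"
    unfolding left_ideal_def
  proof (intro conjI ballI allI)
    show "N \<subseteq> BZ"
    proof
      fix P assume "P \<in> N"
      then obtain S T where "P = S + T" "S \<in> L" "cpt T" by (auto simp: N_def)
      then show "P \<in> BZ" using plus_bop[OF left_ideal_subset[OF L(1)] cpt_BZ nsz Z_subspace] by simp
    qed
    show "0 \<in> N" using NI[OF L0 cpt_zero] by simp
  next
    fix P Q assume "P \<in> N" "Q \<in> N"
    then obtain S T S' T' where e: "P = S + T" "Q = S' + T'" and m: "S \<in> L" "cpt T" "S' \<in> L" "cpt T'"
      by (auto simp: N_def)
    have "P + Q = (S + S') + (T + T')" by (simp add: e)
    then show "P + Q \<in> N" using NI[OF left_ideal_plus[OF L(1) m(1,3)] cpt_plus[OF m(2,4)]] by simp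
  next
    fix k P assume "P \<in> N"
    then obtain S T where e: "P = S + T" and m: "S \<in> L" "cpt T" by (auto simp: N_def)
    have "(\<lambda>x. smult SZ k (P x)) = (\<lambda>z. sz k (S z)) + (\<lambda>z. sz k (T z))"
      by (auto simp: e subsp_def z.scale_right_distrib fun_eq_iff)
    then show "(\<lambda>x. smult SZ k (P x)) \<in> N"
      using NI[OF left_ideal_scale[OF L(1) m(1)] cpt_scale[OF m(2)]] by metis
  next
    fix R P assume R: "R \<in> BZ" and "P \<in> N"
    then obtain S T where e: "P = S + T" and m: "S \<in> L" "cpt T" by (auto simp: N_def)
    have SB: "S \<in> BZ" and TB: "T \<in> BZ" using left_ideal_subset[OF L(1) m(1)] cpt_BZ[OF m(2)] by auto
    have "R \<circ> P = (R \<circ> S) + (R \<circ> T)"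
    proof (rule ext)
      fix z show "(R \<circ> P) z = ((R \<circ> S) + (R \<circ> T)) z"
        using bop_add[OF R bop_mem[OF SB] bop_mem[OF TB], of z z]
        by (cases "z \<in> Z") (auto simp: e bop_outside[OF SB] bop_outside[OF TB] bop_zero[OF R])
    qed
    then show "R \<circ> P \<in> N" using NI[OF left_ideal_comp[OF L(1) R m(1)] cpt_post[OF R m(2)]] by simp
  qed
  moreover have "L \<subseteq> N" using NI[OF _ cpt_zero] by auto
  moreover have "K \<in> N" using NI[OF L0 K] by simp
  ultimately have "N = BZ" using maxL KL by blast
  then have "incl Z \<in> N" using incl_bop_self[OF nsz Z_subspace] by simp
  then obtain S T where ST: "incl Z = S + T" "S \<in> L" "cpt T" by (auto simp: N_def)
  have TB: "T \<in> BZ" by (rule cpt_BZ[OF ST(3)])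
  have tbT: "tot_bdd Z (\<lambda>z. norm (T z))" using ST(3) by (simp add: cpt_def)
  have T1: "pr1 \<circ> T \<in> bop SZ SX" by (rule bop_comp[OF pr1_bop TB])
  have T2: "pr2 \<circ> T \<in> bop SZ SY" by (rule bop_comp[OF pr2_bop TB])
  have tb1: "tot_bdd Z (\<lambda>z. norm ((pr1 \<circ> T) z))" by (rule tot_bdd_post[OF tbT TB pr1_bop nsz ns Z_subspace])
  have tb2: "tot_bdd Z (\<lambda>z. norm ((pr2 \<circ> T) z))" by (rule tot_bdd_post[OF tbT TB pr2_bop nsz ns Z_subspace])
  \<comment> \<open>An error of 1/4 in each coordinate leaves a remainder of norm at most 1/2, as
    the Neumann series requires.\<close>
  obtain n1 where n1: "\<And>z. z \<in> Z \<Longrightarrow> norm ((pr1 \<circ> T) z - proj n1 ((pr1 \<circ> T) z)) \<le> 1 / 4 * norm z"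
    by (rule proj_compact_approx[OF T1 nsz Z_subspace tb1, of "1/4"]) auto
  obtain n2 where n2: "\<And>z. z \<in> Z \<Longrightarrow> norm ((pr2 \<circ> T) z - proj n2 ((pr2 \<circ> T) z)) \<le> 1 / 4 * norm z"
    by (rule proj_compact_approx[OF T2 nsz Z_subspace tb2, of "1/4"]) auto
  define J where "J = {..<n1} <+> {..<n2}"
  have J: "finite J" by (simp add: J_def)
  define g where "g = case_sum (\<lambda>k z. coef ((pr1 \<circ> T) z) k) (\<lambda>k z. coef ((pr2 \<circ> T) z) k)"
  \<comment> \<open>In the second coordinate indices outside \<open>range r\<close> receive 0, so
    that \<open>e i\<close> stays in \<open>Z\<close>; the corresponding coefficients vanish on
    \<open>Y\<close>.\<close>
  define e where "e = case_sum (\<lambda>k. (b k, 0)) (\<lambda>k. (0, if k \<in> range r then b k else 0))"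
  have g: "g i \<in> bop SZ (subsp (*) UNIV)" for i
    using bop_comp[OF coef_bop T1] bop_comp[OF coef_bop bop_codomain[OF T2, of UNIV]]
    by (cases i) (auto simp: g_def comp_def)
  have e: "e i \<in> Z" for i
    using b_Y subspace_0[OF Y(1)] by (cases i) (auto simp: e_def)
  define F where "F z = (\<Sum>i\<in>J. sz (g i z) (e i))" for z
  have F: "F \<in> BZ"
    unfolding F_def by (intro sum_bop J rank_one_bop g e nsz Z_subspace)
  have Feq: "F z = (proj n1 ((pr1 \<circ> T) z), proj n2 ((pr2 \<circ> T) z))" if z: "z \<in> Z" for z
  proof -
    have fs: "fst (\<Sum>i\<in>A. v i) = (\<Sum>i\<in>A. fst (v i))" "snd (\<Sum>i\<in>A. v i) = (\<Sum>i\<in>A. snd (v i))"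
      for v :: "nat \<Rightarrow> 'a \<times> 'a" and A
      by (simp_all add: fst_sum snd_sum)
    have "(\<Sum>k<n2. sc (coef ((pr2 \<circ> T) z) k) (if k \<in> range r then b k else 0)) = proj n2 ((pr2 \<circ> T) z)"
      unfolding proj_def using coef_Y[OF bop_mem[OF T2 z]] by (intro sum.cong) auto
    then show ?thesis
      by (simp add: F_def J_def sum.Plus g_def e_def pair_scale_def proj_def prod_eq_iff fs)
  qed
  define K' where "K' = T - F"
  have K': "K' \<in> BZ" unfolding K'_def by (rule minus_bop[OF TB F nsz Z_subspace])
  have "norm (K' z) \<le> 1 / 2 * norm z" if z: "z \<in> Z" for z
  proof -
    have "K' z = ((pr1 \<circ> T) z - proj n1 ((pr1 \<circ> T) z), (pr2 \<circ> T) z - proj n2 ((pr2 \<circ> T) z))"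
      using bop_mem[OF TB z] by (simp add: K'_def Feq[OF z] pr1_def pr2_def prod_eq_iff)
    then show ?thesis using norm_Pair_le[of "(pr1 \<circ> T) z - proj n1 ((pr1 \<circ> T) z)" "(pr2 \<circ> T) z - proj n2 ((pr2 \<circ> T) z)"]
        n1[OF z] n2[OF z] by simp
  qed
  then obtain V where V: "V \<in> BZ" "\<And>z. z \<in> Z \<Longrightarrow> V (z - K' z) = z"
    using Neumann_left_inverse[OF nsz Z_subspace Z_closed K'] by blast
  \<comment> \<open>On \<open>Z\<close>, \<open>S = I - T = (I - K') - F\<close>, hence
    \<open>V S = I - V F\<close>.\<close>
  have "V \<circ> S = (\<lambda>z. incl Z z - (\<Sum>i\<in>J. sz (g i z) (V (e i))))"
  proof (rule ext)
    fix z
    show "(V \<circ> S) z = incl Z z - (\<Sum>i\<in>J. sz (g i z) (V (e i)))"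
    proof (cases "z \<in> Z")
      case True
      have "S z + T z = z" using fun_cong[OF ST(1), of z] True by (simp add: incl_def)
      then have "S z = z - T z" by (simp add: eq_diff_eq)
      also have "\<dots> = (z - K' z) - F z" by (simp add: K'_def)
      finally have "V (S z) = V (z - K' z) - V (F z)"
        using bop_diff[OF V(1) nsz Z_subspace z.subspace_diff[OF Z_subspace True bop_mem[OF K' True]] bop_mem[OF F True]]
        by simp
      also have "V (F z) = (\<Sum>i\<in>J. V (sz (g i z) (e i)))"
        unfolding F_def by (rule bop_sum[OF V(1) nsz Z_subspace]) (rule z.subspace_scale[OF Z_subspace e])
      also have "\<dots> = (\<Sum>i\<in>J. sz (g i z) (V (e i)))" by (simp add: bop_scale[OF V(1) e])
      finally show ?thesis using True V(2)[OF True] by (simp add: incl_def)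
    next
      case False
      then show ?thesis
        by (simp add: bop_outside[OF left_ideal_subset[OF L(1) ST(2)]] bop_zero[OF V(1)] bop_outside[OF g] incl_def)
    qed
  qed
  then have mem: "(\<lambda>z. incl Z z - (\<Sum>i\<in>J. sz (g i z) (V (e i)))) \<in> L"
    using left_ideal_comp[OF L(1) V(1) ST(2)] by simp
  \<comment> \<open>A non-zero vector annihilated by all of \<open>L\<close> would put
    \<open>L\<close> inside a proper fixed left ideal, which equals \<open>L\<close> by
    maximality.\<close>
  have nz: "\<exists>T\<in>L. T x \<noteq> 0" if x: "x \<in> Z" "x \<noteq> 0" for x
  proof (rule ccontr)
    assume "\<not> ?thesis"
    then have sub: "L \<subseteq> {T \<in> BZ. T x = 0}" using left_ideal_subset[OF L(1)] by auto
    have "left_ideal SZ {T \<in> BZ. T x = 0}"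
      unfolding left_ideal_def
      using zero_bop[OF nsz z.subspace_0[OF Z_subspace]] plus_bop[OF _ _ nsz Z_subspace] scale_bop[OF _ nsz Z_subspace]
        bop_comp[of _ sz Z sz Z _ sz Z] bop_zero[of _ sz Z sz Z]
      by (auto simp: subsp_def)
    moreover have "{T \<in> BZ. T x = 0} \<noteq> BZ"
    proof -
      have "incl Z x \<noteq> 0" using x by (simp add: incl_def)
      then show ?thesis using incl_bop_self[OF nsz Z_subspace] by blast
    qed
    ultimately have "L = {T \<in> BZ. T x = 0}" using maxL[OF _ sub] by blast
    then have "fixed_ideal SZ L" unfolding fixed_ideal_def using x by (auto simp: subsp_def)
    then show False using nf by blast
  qed
  have "incl Z \<in> L"
    by (rule left_ideal_identity_of_finite_rank[OF nsz Z_subspace L(1) nz J g bop_mem[OF V(1) e] mem])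
  then show False using left_ideal_identity[OF L(1)] L(2) by blast
qed

text \<open>As \<open>L\<close> contains the compact operators, membership depends on the scalar
  matrix alone. An element outside \<open>M1\<close> yields \<open>smat 0 0 1\<close>, an element
  outside \<open>M2\<close> a matrix with rows \<open>(1, t)\<close> and \<open>(0, 0)\<close>;
  together they generate the identity. So \<open>L\<close> lies in one of the two ideals, and
  maximality gives equality.\<close>

lemma nonfixed_maximal_cases:
  assumes max: "maximal_left_ideal SZ L" and nf: "\<not> fixed_ideal SZ L"
  shows "L = M1 sc Y \<or> L = M2 sc Y"
proof -
  have L: "left_ideal SZ L" "L \<noteq> BZ"
    and maxL: "\<And>N. left_ideal SZ N \<Longrightarrow> L \<subseteq> N \<Longrightarrow> N = L \<or> N = BZ"
    using max by (auto simp: maximal_left_ideal_def)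
  have cptL: "T \<in> L" if "cpt T" for T by (rule nonfixed_contains_cpt[OF max nf that])
  have repL: "smat a c d \<in> L" if "rep T a c d" "T \<in> L" for T a c d
    using left_ideal_minus[OF L(1) nsz that(2) cptL, of "T - smat a c d"] that(1) by (simp add: rep_def)
  have comp: "smat a c d \<circ> smat a' c' d' = smat (a * a') (a * c' + c * d') (d * d')" for a c d a' c' d'
    using subspace_scale[OF Y(1)]
    by (auto simp: fun_eq_iff smat_def scale_right_distrib scale_left_distrib zero_prod_def)
  have "L \<subseteq> M1 sc Y \<or> L \<subseteq> M2 sc Y"
  proof (rule ccontr)
    assume "\<not> ?thesis"
    then obtain S T where S: "S \<in> L" "S \<notin> M1 sc Y" and T: "T \<in> L" "T \<notin> M2 sc Y" by blast
    have SB: "S \<in> BZ" and TB: "T \<in> BZ" using left_ideal_subset[OF L(1)] S T by auto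
    obtain a c d where Sr: "rep S a c d" by (rule rep_exists[OF SB])
    obtain a' c' d' where Tr: "rep T a' c' d'" by (rule rep_exists[OF TB])
    have d: "d \<noteq> 0" using S(2) SB Sr M1_iff by blast
    have a': "a' \<noteq> 0" using T(2) TB Tr M2_iff by blast
    have "smat 0 0 (inverse d) \<circ> smat a c d \<in> L" by (intro left_ideal_comp[OF L(1)] smat_BZ repL[OF Sr S(1)])
    then have E2: "smat 0 0 1 \<in> L" using d by (simp add: comp)
    have "smat (inverse a') 0 0 \<circ> smat a' c' d' \<in> L" by (intro left_ideal_comp[OF L(1)] smat_BZ repL[OF Tr T(1)])
    \<comment> \<open>This multiple of \<open>smat 0 0 1\<close> cancels the off-diagonal entry of
      the matrix obtained from \<open>T\<close> and supplies the missing diagonal 1.\<close>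
    moreover have "smat 0 (- (inverse a' * c')) 1 \<circ> smat 0 0 1 \<in> L" by (intro left_ideal_comp[OF L(1)] smat_BZ E2)
    ultimately have "smat 1 (inverse a' * c') 0 + smat 0 (- (inverse a' * c')) 1 \<in> L"
      using a' by (intro left_ideal_plus[OF L(1)]) (simp_all add: comp)
    also have "smat 1 (inverse a' * c') 0 + smat 0 (- (inverse a' * c')) 1 = incl Z"
      by (auto simp: fun_eq_iff incl_Z smat_def)
    finally show False using left_ideal_identity[OF L(1)] L(2) by blast
  qed
  then show ?thesis
    using maxL M1_maximal(1) M2_maximal(1) unfolding maximal_left_ideal_def by metis
qed

section \<open>Generators of \<open>M1\<close> and \<open>M2\<close>\<close>

lemma opmat_R1: "opmat Y (\<lambda>x. x) 0 0 0 = smat 1 0 0"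
  and opmat_R2: "opmat Y 0 (incl Y) 0 0 = smat 0 1 0"
  by (simp_all add: fun_eq_iff opmat_def smat_def mem_Times_iff incl_def)

lemma smat_M1: "smat a c 0 \<in> M1 sc Y"
  using smat_BZ rep_smat M1_iff by blast

text \<open>The first summand reproduces \<open>T\<close> on vectors \<open>(x, 0)\<close>. For the
  second, \<open>S\<close> has to send \<open>(y, 0)\<close> to \<open>T (0, y)\<close>: the scalar
  part is \<open>sc c y\<close> in the first coordinate, because the entry 22 is 0, and the two
  compact blocks are extended from \<open>Y\<close> to \<open>X\<close>.\<close>

lemma M1_decomposition:
  assumes "T \<in> M1 sc Y"
  obtains S where "S \<in> BZ" "T = (T \<circ> smat 1 0 0) + (S \<circ> smat 0 1 0)"
proof -
  obtain a c where T: "T \<in> BZ" "rep T a c 0" using assms M1_iff by blast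
  define K where "K = T - smat a c 0"
  have K: "K \<in> BZ" "tot_bdd Z (\<lambda>z. norm (K z))" using T(2) by (auto simp: K_def rep_def cpt_def)
  have K2: "K \<circ> inj2 \<in> bop SY SZ" by (rule bop_comp[OF K(1) inj2_bop])
  have tb: "tot_bdd Y (\<lambda>y. norm ((K \<circ> inj2) y))"
    using tot_bdd_comp[OF K(2) inj2_bop ns nsz Y(1) Z_subspace] by simp
  obtain G1 where G1: "G1 \<in> bop SX SX" "\<And>y. y \<in> Y \<Longrightarrow> G1 y = (pr1 \<circ> (K \<circ> inj2)) y"
    by (rule compact_extension[OF subspace_UNIV closed_UNIV _ _ iso_X Y(1) bop_comp[OF pr1_bop K2]
          tot_bdd_post[OF tb K2 pr1_bop ns ns Y(1)], of UNIV]) auto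
  obtain G2 where G2: "G2 \<in> bop SX SY" "\<And>y. y \<in> Y \<Longrightarrow> G2 y = (pr2 \<circ> (K \<circ> inj2)) y"
    \<comment> \<open>The target here is \<open>Y\<close>, so the index set is
      \<open>range r\<close> and the isomorphism used is that of the dual of
      \<open>Y\<close>.\<close>
    by (rule compact_extension[OF Y(1,2) b_Y coef_Y iso_Y Y(1) bop_comp[OF pr2_bop K2]
          tot_bdd_post[OF tb K2 pr2_bop ns ns Y(1)]]) auto
  define S where "S = smat c 0 0 + (inj1 \<circ> (G1 \<circ> pr1)) + (inj2 \<circ> (G2 \<circ> pr1))"
  have "S \<in> BZ"
    unfolding S_def
    by (intro plus_bop[OF _ _ nsz Z_subspace] smat_BZ bop_comp[OF inj1_bop] bop_comp[OF inj2_bop]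
        bop_comp[OF G1(1) pr1_bop] bop_comp[OF G2(1) pr1_bop])
  moreover have "T z = ((T \<circ> smat 1 0 0) + (S \<circ> smat 0 1 0)) z" for z
  proof (cases "z \<in> Z")
    case True
    obtain x y where z: "z = (x, y)" and y: "y \<in> Y" using True by auto
    have Y0: "0 \<in> Y" by (rule subspace_0[OF Y(1)])
    have Ky: "K (0, y) \<in> Z" using y by (intro bop_mem[OF K(1)]) simp
    have "S (y, 0) = (sc c y + G1 y, G2 y)"
      using Y0 bop_mem[OF G2(1), of y] by (simp add: S_def smat_def inj1_def inj2_def pr1_def incl_def)
    also have "\<dots> = (sc c y, 0) + K (0, y)"
      using Ky y by (simp add: G1(2) G2(2) pr1_def pr2_def inj2_def incl_def prod_eq_iff)
    also have "\<dots> = T (0, y)" using y by (simp add: K_def smat_def)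
    finally have "S (y, 0) = T (0, y)" .
    moreover have "T z = T (x, 0) + T (0, y)" using bop_add[OF T(1), of "(x, 0)" "(0, y)"] Y0 y by (simp add: z)
    ultimately show ?thesis using y by (simp add: z smat_def)
  next
    case False
    then show ?thesis by (simp add: bop_outside[OF T(1)] bop_outside[OF smat_BZ] bop_zero[OF T(1)] bop_zero[OF \<open>S \<in> BZ\<close>])
  qed
  ultimately show ?thesis using that by blast
qed

lemma M1_generated: "left_generated (spaceZ sc Y) (M1 sc Y) [opmat Y (\<lambda>x. x) 0 0 0, opmat Y 0 (incl Y) 0 0]"
proof -
  have li: "left_ideal SZ (M1 sc Y)" using M1_maximal(1) by (simp add: maximal_left_ideal_def)
  have sum2: "(\<Sum>j<length [smat 1 0 0, smat 0 1 0]. S j \<circ> [smat 1 0 0, smat 0 1 0] ! j)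
      = (S 0 \<circ> smat 1 0 0) + (S 1 \<circ> smat 0 1 0)" for S :: "nat \<Rightarrow> 'a \<times> 'a \<Rightarrow> 'a \<times> 'a"
    by (simp add: lessThan_Suc numeral_2_eq_2 add.commute)
  show ?thesis
    unfolding left_generated_def BZ_eq opmat_R1 opmat_R2 sum2
  proof (intro equalityI subsetI)
    fix T assume T: "T \<in> M1 sc Y"
    then obtain S where S: "S \<in> BZ" "T = (T \<circ> smat 1 0 0) + (S \<circ> smat 0 1 0)" by (rule M1_decomposition)
    have "T \<in> BZ" using T M1_iff by blast
    then show "T \<in> {(S 0 \<circ> smat 1 0 0) + (S 1 \<circ> smat 0 1 0) |S. \<forall>j<length [smat 1 0 0, smat 0 1 0]. S j \<in> BZ}"
      using S by (intro CollectI exI[of _ "\<lambda>j :: nat. if j = 0 then T else S"]) simp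
  next
    fix T assume "T \<in> {(S 0 \<circ> smat 1 0 0) + (S 1 \<circ> smat 0 1 0) |S. \<forall>j<length [smat 1 0 0, smat 0 1 0]. S j \<in> BZ}"
    then obtain S where S: "T = (S 0 \<circ> smat 1 0 0) + (S 1 \<circ> smat 0 1 0)" "\<forall>j<2. S (j :: nat) \<in> BZ" by auto
    show "T \<in> M1 sc Y"
      unfolding S(1) using S(2) by (intro left_ideal_plus[OF li] left_ideal_comp[OF li] smat_M1) auto
  qed
qed

text \<open>A single generator lies in \<open>M1\<close> itself, so \<open>d = 0\<close> and the top
  scalar row of any \<open>S \<circ> R\<close> is a multiple of \<open>(a, c)\<close>. But
  \<open>M1\<close> realises both rows \<open>(1, 0)\<close> and \<open>(0, 1)\<close>.\<close>

lemma M1_not_principal: "\<not> (\<exists>R\<in>BZ. left_generated (spaceZ sc Y) (M1 sc Y) [R])"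
proof
  assume "\<exists>R\<in>BZ. left_generated (spaceZ sc Y) (M1 sc Y) [R]"
  then obtain R where R: "R \<in> BZ" "left_generated (spaceZ sc Y) (M1 sc Y) [R]" by blast
  have M: "T \<in> M1 sc Y \<longleftrightarrow> (\<exists>S\<in>BZ. T = S \<circ> R)" for T
  proof -
    have "M1 sc Y = {S 0 \<circ> R |S :: nat \<Rightarrow> _. S 0 \<in> BZ}"
      using R(2) by (simp add: left_generated_def BZ_eq)
    then show ?thesis by (auto intro: exI[of _ "\<lambda>_. _"])
  qed
  obtain a c d where Rr: "rep R a c d" by (rule rep_exists[OF R(1)])
  have ex: "\<exists>s1 s2 s3. x = s1 * a \<and> y = s1 * c + s2 * d \<and> 0 = s3 * d" for x y
  proof -
    obtain S where S: "S \<in> BZ" "smat x y 0 = S \<circ> R" using M smat_M1 by blast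
    obtain s1 s2 s3 where Sr: "rep S s1 s2 s3" by (rule rep_exists[OF S(1)])
    show ?thesis using rep_unique[OF rep_smat rep_comp[OF S(1) Sr R(1) Rr, folded S(2)]] by blast
  qed
  have "R \<in> M1 sc Y"
  proof -
    have "incl Z \<circ> R = R"
      using bop_mem[OF R(1)] bop_outside[OF R(1)] z.subspace_0[OF Z_subspace] by (auto simp: fun_eq_iff incl_def)
    then show ?thesis using M incl_bop_self[OF nsz Z_subspace] by metis
  qed
  then have d: "d = 0" using M1_iff rep_unique[OF Rr] by blast
  obtain s t where "1 = s * a" "0 = s * c" using ex[of 1 0] d by auto
  then have "c = 0" by auto
  then show False using ex[of 0 1] d by simp
qed

text \<open>For a functional \<open>f\<close> on \<open>X\<close>, the operator sending
  \<open>(x, y)\<close> to \<open>f x\<close> times a fixed vector is compact, so it lies in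
  \<open>M2\<close>; writing it through the generators dominates \<open>f\<close> by a multiple of
  \<open>p\<close>. The generators are compact on \<open>X\<close>, so \<open>p\<close> is totally
  bounded and has no lower bound by the norm.\<close>

lemma M2_not_finitely_generated:
  "\<not> (\<exists>Rs. set Rs \<subseteq> BZ \<and> left_generated (spaceZ sc Y) (M2 sc Y) Rs)"
proof
  assume "\<exists>Rs. set Rs \<subseteq> BZ \<and> left_generated (spaceZ sc Y) (M2 sc Y) Rs"
  then obtain Rs where Rs: "set Rs \<subseteq> BZ"
    and M: "M2 sc Y = {\<Sum>j<length Rs. S j \<circ> Rs ! j |S. \<forall>j<length Rs. S j \<in> BZ}"
    by (auto simp: left_generated_def BZ_eq)
  have sum_apply: "(\<Sum>j\<in>J. f j) z = (\<Sum>j\<in>J. f j z)" for f :: "nat \<Rightarrow> 'a \<times> 'a \<Rightarrow> 'a \<times> 'a" and J z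
    by (induction J rule: infinite_finite_induct) auto
  have RB: "Rs ! j \<in> BZ" if "j < length Rs" for j using Rs that by auto
  have RM: "Rs ! j \<in> M2 sc Y" if j: "j < length Rs" for j
  proof -
    \<comment> \<open>These coefficients single out \<open>Rs ! j\<close>, which shows that each
      generator belongs to the ideal.\<close>
    define S where "S i = (if i = j then incl Z else 0)" for i
    have "incl Z \<circ> Rs ! j = Rs ! j"
      using bop_mem[OF RB[OF j]] bop_outside[OF RB[OF j]] z.subspace_0[OF Z_subspace] by (auto simp: fun_eq_iff incl_def)
    then have comp: "S i \<circ> Rs ! i = (if i = j then Rs ! j else 0)" for i by (auto simp: S_def fun_eq_iff)
    have "(\<Sum>i<length Rs. S i \<circ> Rs ! i) = Rs ! j" using j by (simp add: comp)
    moreover have "\<forall>i<length Rs. S i \<in> BZ"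
      using incl_bop_self[OF nsz Z_subspace] cpt_BZ[OF cpt_zero] by (simp add: S_def)
    ultimately show ?thesis unfolding M by force
  qed
  define p where "p x = (\<Sum>j<length Rs. norm ((Rs ! j) (inj1 x)))" for x
  have "tot_bdd UNIV (\<lambda>x. norm ((Rs ! j) (inj1 x)))" if j: "j < length Rs" for j
  proof -
    obtain c d where "rep (Rs ! j) 0 c d" using RM[OF j] M2_iff by blast
    then have tb: "tot_bdd Z (\<lambda>z. norm ((Rs ! j - smat 0 c d) z))" by (simp add: rep_def cpt_def)
    have "tot_bdd UNIV (\<lambda>x. norm ((Rs ! j - smat 0 c d) (inj1 x)))"
      by (rule tot_bdd_comp[OF tb inj1_bop ns nsz subspace_UNIV Z_subspace])
    \<comment> \<open>With entry 11 equal to 0 the scalar matrix vanishes on \<open>X\<close>, so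
      the generator itself is totally bounded there.\<close>
    moreover have "smat 0 c d (inj1 x) = 0" for x by (simp add: smat_def inj1_def zero_prod_def)
    ultimately show ?thesis by simp
  qed
  then have tbp: "tot_bdd UNIV p"
    unfolding p_def by (intro tot_bdd_sum) auto
  have "\<exists>x. C * p x < norm x" if "C \<ge> 0" for C
    using tot_bdd_not_bounded_below[OF subspace_UNIV dim_X tbp that] by blast
  then obtain f where f: "f \<in> bop SX (subsp (*) UNIV)" "\<And>C. \<exists>x. C * p x < norm (f x)"
    using functional_not_dominated[OF tot_bdd_seminorm[OF tbp]] by blast
  obtain e where e: "e \<in> Z" "e \<noteq> 0"
    using bop_mem[OF inj1_bop, of "b 0"] basis_nonzero[of 0] by (auto simp: inj1_def zero_prod_def)
  define T where "T = (\<lambda>z. sz ((f \<circ> pr1) z) e)"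
  have fp: "f \<circ> pr1 \<in> bop SZ (subsp (*) UNIV)" by (rule bop_comp[OF f(1) pr1_bop])
  have "cpt T"
    unfolding cpt_def T_def
    using rank_one_bop[OF fp nsz Z_subspace e(1)] tot_bdd_rank_one[OF fp nsz Z_subspace nsz] by blast
  then have "T \<in> M2 sc Y" using rep_cpt cpt_BZ M2_iff by blast
  then obtain S where S: "T = (\<Sum>j<length Rs. S j \<circ> Rs ! j)" "\<And>j. j < length Rs \<Longrightarrow> S j \<in> BZ"
    unfolding M by blast
  have "\<exists>C. C > 0 \<and> (\<forall>z\<in>Z. norm (S j z) \<le> C * norm z)" if "j < length Rs" for j
    using bop_bound[OF S(2)[OF that]] by metis
  then obtain C where C: "\<And>j. j < length Rs \<Longrightarrow> C j > 0"
    "\<And>j z. j < length Rs \<Longrightarrow> z \<in> Z \<Longrightarrow> norm (S j z) \<le> C j * norm z" by metis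
  define D where "D = (\<Sum>j<length Rs. C j)"
  have "norm (f x) * norm e \<le> D * p x" for x
  proof -
    have "T (inj1 x) = sz (f x) e" using bop_mem[OF inj1_bop, of x] by (simp add: T_def pr1_def inj1_def)
    then have "norm (f x) * norm e = norm (T (inj1 x))" by (simp add: z.norm_scale)
    also have "\<dots> \<le> (\<Sum>j<length Rs. D * norm ((Rs ! j) (inj1 x)))"
      unfolding S(1) sum_apply
    proof (rule sum_norm_le)
      fix j assume "j \<in> {..<length Rs}"
      then have j: "j < length Rs" by simp
      have "norm ((S j \<circ> Rs ! j) (inj1 x)) \<le> C j * norm ((Rs ! j) (inj1 x))"
        using C(2)[OF j bop_mem[OF RB[OF j] bop_mem[OF inj1_bop UNIV_I]]] by simp
      also have "\<dots> \<le> D * norm ((Rs ! j) (inj1 x))"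
        unfolding D_def using j C(1) by (intro mult_right_mono member_le_sum) (auto intro: less_imp_le)
      finally show "norm ((S j \<circ> Rs ! j) (inj1 x)) \<le> D * norm ((Rs ! j) (inj1 x))" .
    qed
    also have "\<dots> = D * p x" by (simp add: p_def sum_distrib_left)
    finally show ?thesis .
  qed
  moreover obtain x where "D / norm e * p x < norm (f x)" using f(2) by blast
  ultimately show False using e(2) by (smt (verit) divide_less_eq mult.commute times_divide_eq_left zero_less_norm_iff)
qed

end

theorem theorem1p9:
  fixes sc :: "'k::real_or_complex \<Rightarrow> 'a::banach \<Rightarrow> 'a"
    and b :: "nat \<Rightarrow> 'a"
    and Y :: "'a set"
  assumes "normed_scale sc"
    and "very_few_operators sc"
    and "schauder_basis sc b" and "shrinking sc b"
    and "isomorphic (dual_space (subsp sc UNIV)) (ell1 :: ('k, nat \<Rightarrow> 'k) nspace)"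
    and "module.subspace sc Y" and "closed Y" and "infinite_dim sc Y"
    and "\<exists>r :: nat \<Rightarrow> nat. strict_mono r \<and> Y = closed_span sc (range (b \<circ> r))"
    and "infinite_codim sc Y"
    and "isomorphic (dual_space (subsp sc Y)) (ell1 :: ('k, nat \<Rightarrow> 'k) nspace)"
    and "\<forall>T\<in>bop (subsp sc Y) (subsp sc UNIV).
           \<exists>c. \<exists>K\<in>kop sc Y UNIV. T = (\<lambda>y. sc c (incl Y y) + K y)"
  shows "{L. maximal_left_ideal (spaceZ sc Y) L \<and> \<not> fixed_ideal (spaceZ sc Y) L}
           = {M1 sc Y, M2 sc Y}
    \<and> left_generated (spaceZ sc Y) (M1 sc Y)
        [opmat Y (\<lambda>x. x) 0 0 0, opmat Y 0 (incl Y) 0 0]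
    \<and> \<not> (\<exists>R\<in>bop (spaceZ sc Y) (spaceZ sc Y). left_generated (spaceZ sc Y) (M1 sc Y) [R])
    \<and> \<not> (\<exists>Rs. set Rs \<subseteq> bop (spaceZ sc Y) (spaceZ sc Y)
           \<and> left_generated (spaceZ sc Y) (M2 sc Y) Rs)"
proof -
  interpret normed_scale sc by fact
  obtain r :: "nat \<Rightarrow> nat" where Y_eq: "Y = closed_span sc (b ` range r)"
    using assms(9) by (auto simp: image_comp)
  interpret AH_sum sc b Y r
    by unfold_locales (fact assms | fact Y_eq | erule assms(12)[THEN bspec])+
  show ?thesis
  proof (intro conjI)
    show "{L. maximal_left_ideal (spaceZ sc Y) L \<and> \<not> fixed_ideal (spaceZ sc Y) L} = {M1 sc Y, M2 sc Y}"
      unfolding maximal_left_ideal_Z_iff fixed_ideal_Z_iff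
      using nonfixed_maximal_cases M1_maximal M2_maximal by blast
    show "\<not> (\<exists>R\<in>bop (spaceZ sc Y) (spaceZ sc Y). left_generated (spaceZ sc Y) (M1 sc Y) [R])"
      unfolding BZ_eq by (rule M1_not_principal)
    show "\<not> (\<exists>Rs. set Rs \<subseteq> bop (spaceZ sc Y) (spaceZ sc Y) \<and> left_generated (spaceZ sc Y) (M2 sc Y) Rs)"
      unfolding BZ_eq by (rule M2_not_finitely_generated)
  qed (rule M1_generated)
qed

end
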